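(* Let $F/\mathbb{F}_q$ be a function field of genus $g$ containing $s$ places of degree $r>1$, denoted by $P_1,\ldots,P_s$. Let $\mathcal{C}_{\mathrm{par}}$ be the $q$-ary single parity check code of length $r+1$ and dimension $r$, which has minimum distance $2$. For an integer $k$ with $g-1<k<rs-g+1$, let $G$ be a divisor of $F$ of degree $k+g-1$ with $\mathrm{Supp}(G)\cap\{P_1,\ldots,P_s\}=\emptyset$. Then the generalized algebraic-geometric code $C(P_1,\ldots,P_s:G:\mathcal{C}_{\mathrm{par}},\ldots,\mathcal{C}_{\mathrm{par}})$ is a linear code over $\mathbb{F}_q$ with locality $r$, of length $n=(r+1)s$ and dimension $k$, whose minimum distance $d$ satisfies $$d\ge2\left(s-\left\lfloor\frac{k+g-1}{r}\right\rfloor\right).$$ It follows that the rate of this code verifies $$\frac{k}{n}\ge\frac{r}{r+1}-\frac{r}{2}\delta-\frac{g-1}{n},\qquad\text{where }\delta=\frac{d}{n}.$$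
   Context: $F/\mathbb{F}_q$ is an algebraic function field (of one variable) with full constant field $\mathbb{F}_q$; $P_1,\ldots,P_s$ are distinct; $\mathcal{L}(G)$ is the Riemann-Roch space of $G$. For a place $P$ of degree $r$ and $f$ regular at $P$, $f(P)$ denotes the class of $f$ in the residue class field of $P$, which is isomorphic to $\mathbb{F}_{q^r}$. Single parity check code: $\mathcal{C}_{\mathrm{par}}=\{(c_1,\ldots,c_{r+1})\in\mathbb{F}_q^{r+1} : \sum_i c_i=0\}$. Generalized AG code: fix $\mathbb{F}_q$-linear isomorphisms $\pi_i$ from the residue class field of $P_i$ onto $\mathcal{C}_{\mathrm{par}}$ ($1\le i\le s$). Then $C(P_1,\ldots,P_s:G:\mathcal{C}_{\mathrm{par}},\ldots,\mathcal{C}_{\mathrm{par}})$ is the image of $\mathcal{L}(G)\to\mathbb{F}_q^{(r+1)s}$, $f\mapsto(\pi_1(f(P_1)),\ldots,\pi_s(f(P_s)))$ (vectors concatenated). Locality: a linear code $\mathcal{C}\subset\mathbb{F}_q^n$ has locality $r$ if for each $1\le i\le n$ there is a set $N_i\subset\{1,\ldots,n\}\smallsetminus\{i\}$ with $|N_i|\le r$ such that, for all $c\in\mathcal{C}$, $c_i$ is determined by $(c_j)_{j\in N_i}$ ($r$ not required to be minimal). Assertions involving the minimum distance concern nonzero codes (i.e. $k\ge1$). *)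

theory Defs
  imports
    "HOL-Algebra.Finite_Extensions"
    "HOL-Algebra.Generated_Fields"
    "HOL-Algebra.QuotRing"
    "HOL-Library.Poly_Mapping"
    "Jordan_Normal_Form.VS_Connect"
begin

section \<open>Function fields, places and divisors\<close>

text \<open>
  The field of constants is a type \<open>'q\<close>, embedded by \<open>emb\<close> into the function field, which is a
  type \<open>'f\<close>. The record \<^term>\<open>class_ring\<close> turns either type into a ring in the sense of HOL-Algebra.
  The axiom \<open>finite_over_rational\<close> says that \<open>'f\<close> is a finite extension of some \<open>'q(x)\<close> with
  \<open>x\<close> transcendental, and \<open>full_constant_field\<close> that \<open>'q\<close> is the full constant field.
\<close>

locale function_field = field_hom emb
  for emb :: "'q :: {field, finite} \<Rightarrow> 'f :: field" +
  assumes finite_over_rational: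
    "\<exists>x. ring.transcendental class_ring (range emb) x \<and>
       ring.finite_dimension class_ring (generate_field class_ring (insert x (range emb))) UNIV"
  and full_constant_field:
    "ring.algebraic class_ring (range emb) y \<Longrightarrow> y \<in> range emb"

definition valuation_ring :: "('q :: field \<Rightarrow> 'f :: field) \<Rightarrow> 'f set \<Rightarrow> bool" where
  "valuation_ring emb A \<longleftrightarrow>
     subring A class_ring \<and> range emb \<subset> A \<and> A \<subset> UNIV \<and> (\<forall>z. z \<in> A \<or> inverse z \<in> A)"

definition is_place :: "('q :: field \<Rightarrow> 'f :: field) \<Rightarrow> 'f set \<Rightarrow> bool" where
  "is_place emb P \<longleftrightarrow> (\<exists>A. valuation_ring emb A \<and> maximalideal P (class_ring\<lparr>carrier := A\<rparr>))"

text \<open>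
  A place determines its valuation ring: a nonzero \<open>z\<close> lies outside the ring iff \<open>1/z\<close> is in the
  maximal ideal. Zero is listed separately because \<open>inverse 0 = 0\<close>.
\<close>

definition place_ring :: "'f :: field set \<Rightarrow> 'f ring" where
  "place_ring P = class_ring\<lparr>carrier := {z. z = 0 \<or> inverse z \<notin> P}\<rparr>"

definition residue_field :: "'f :: field set \<Rightarrow> 'f set ring" where
  "residue_field P = place_ring P Quot P"

definition residue :: "'f :: field set \<Rightarrow> 'f \<Rightarrow> 'f set" where
  "residue P f = P +>\<^bsub>place_ring P\<^esub> f"

definition residue_space :: "('q :: field \<Rightarrow> 'f :: field) \<Rightarrow> 'f set \<Rightarrow> ('q, 'f set) module" where
  "residue_space emb P =
     \<lparr>carrier = carrier (residue_field P), mult = mult (residue_field P),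
      one = one (residue_field P), zero = zero (residue_field P), add = add (residue_field P),
      smult = (\<lambda>c a. residue P (emb c) \<otimes>\<^bsub>residue_field P\<^esub> a)\<rparr>"

definition place_degree :: "('q :: field \<Rightarrow> 'f :: field) \<Rightarrow> 'f set \<Rightarrow> nat" where
  "place_degree emb P = vectorspace.dim class_ring (residue_space emb P)"

text \<open>
  The normalized discrete valuation: \<open>z = t^n u\<close> with \<open>t\<close> a generator of the maximal ideal and
  \<open>u\<close> a unit. Only meaningful for \<open>z \<noteq> 0\<close>.
\<close>

definition place_val :: "'f :: field set \<Rightarrow> 'f \<Rightarrow> int" where
  "place_val P z =
     (THE n. \<exists>t u. P = PIdl\<^bsub>place_ring P\<^esub> t \<and> u \<in> Units (place_ring P) \<and> z = (t powi n) * u)"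

definition is_divisor :: "('q :: field \<Rightarrow> 'f :: field) \<Rightarrow> ('f set \<Rightarrow>\<^sub>0 int) \<Rightarrow> bool" where
  "is_divisor emb G \<longleftrightarrow> (\<forall>P \<in> Poly_Mapping.keys G. is_place emb P)"

definition div_degree :: "('q :: field \<Rightarrow> 'f :: field) \<Rightarrow> ('f set \<Rightarrow>\<^sub>0 int) \<Rightarrow> int" where
  "div_degree emb G =
     (\<Sum>P \<in> Poly_Mapping.keys G. Poly_Mapping.lookup G P * int (place_degree emb P))"

definition RR_space :: "('q :: field \<Rightarrow> 'f :: field) \<Rightarrow> ('f set \<Rightarrow>\<^sub>0 int) \<Rightarrow> 'f set" where
  "RR_space emb G =
     {f. f = 0 \<or> (\<forall>P. is_place emb P \<longrightarrow> place_val P f \<ge> - Poly_Mapping.lookup G P)}"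

definition field_space :: "('q :: field \<Rightarrow> 'f :: field) \<Rightarrow> ('q, 'f) module" where
  "field_space emb =
     \<lparr>carrier = UNIV, mult = (*), one = 1, zero = 0, add = (+), smult = (\<lambda>c f. emb c * f)\<rparr>"

definition RR_dim :: "('q :: field \<Rightarrow> 'f :: field) \<Rightarrow> ('f set \<Rightarrow>\<^sub>0 int) \<Rightarrow> nat" where
  "RR_dim emb G = vectorspace.dim class_ring ((field_space emb)\<lparr>carrier := RR_space emb G\<rparr>)"

definition genus :: "('q :: field \<Rightarrow> 'f :: field) \<Rightarrow> int" where
  "genus emb =
     (GREATEST g. \<exists>A. is_divisor emb A \<and> g = div_degree emb A - int (RR_dim emb A) + 1)"

section \<open>Codes\<close>

definition linear_code :: "nat \<Rightarrow> 'q :: field vec set \<Rightarrow> bool" where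
  "linear_code n C \<longleftrightarrow> VectorSpace.subspace class_ring C (module_vec TYPE('q) n)"

definition code_dim :: "nat \<Rightarrow> 'q :: field vec set \<Rightarrow> nat" where
  "code_dim n C = vectorspace.dim class_ring ((module_vec TYPE('q) n)\<lparr>carrier := C\<rparr>)"

definition hamming_dist :: "'q vec \<Rightarrow> 'q vec \<Rightarrow> nat" where
  "hamming_dist c c' = card {i. i < dim_vec c \<and> c $ i \<noteq> c' $ i}"

text \<open>Only meaningful for codes with at least two words.\<close>

definition min_distance :: "'q vec set \<Rightarrow> nat" where
  "min_distance C = Min {hamming_dist c c' | c c'. c \<in> C \<and> c' \<in> C \<and> c \<noteq> c'}"

definition has_locality :: "nat \<Rightarrow> 'q vec set \<Rightarrow> nat \<Rightarrow> bool" where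
  "has_locality n C r \<longleftrightarrow>
     (\<forall>i<n. \<exists>N \<subseteq> {..<n} - {i}. card N \<le> r \<and>
        (\<forall>c\<in>C. \<forall>c'\<in>C. (\<forall>j\<in>N. c $ j = c' $ j) \<longrightarrow> c $ i = c' $ i))"

definition parity_code :: "nat \<Rightarrow> 'q :: field vec set" where
  "parity_code r = {c \<in> carrier_vec (r + 1). (\<Sum>i<r + 1. c $ i) = 0}"

definition residue_iso ::
    "('q :: field \<Rightarrow> 'f :: field) \<Rightarrow> 'f set \<Rightarrow> nat \<Rightarrow> 'q vec set \<Rightarrow> ('f set \<Rightarrow> 'q vec) \<Rightarrow> bool" where
  "residue_iso emb P m C \<pi> \<longleftrightarrow>
     linear_map class_ring (residue_space emb P) ((module_vec TYPE('q) m)\<lparr>carrier := C\<rparr>) \<pi> \<and>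
     bij_betw \<pi> (carrier (residue_field P)) C"

text \<open>The places are indexed by \<open>0, \<dots>, s - 1\<close>.\<close>

definition gen_AG_code ::
    "('q :: field \<Rightarrow> 'f :: field) \<Rightarrow> nat \<Rightarrow> (nat \<Rightarrow> 'f set) \<Rightarrow> ('f set \<Rightarrow>\<^sub>0 int) \<Rightarrow>
     (nat \<Rightarrow> 'f set \<Rightarrow> 'q vec) \<Rightarrow> 'q vec set" where
  "gen_AG_code emb s P G \<pi> =
     (\<lambda>f. vec_of_list (concat (map (\<lambda>i. list_of_vec (\<pi> i (residue (P i) f))) [0..<s])))
       ` RR_space emb G"

end

theory Submission
  imports Defs "Jordan_Normal_Form.Char_Poly"
begin

text \<open>
  The evaluation map is injective on \<open>L(G)\<close>, because a function vanishing at all \<open>P\<^sub>i\<close> lies in the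
  Riemann-Roch space of a divisor of negative degree; a function that vanishes at \<open>z\<close> of the places
  satisfies \<open>r z \<le> deg G\<close>, and every other block is a nonzero word of the parity check code, of
  weight at least \<open>2\<close>. A coordinate is recovered from the other \<open>r\<close> coordinates of its block. So the
  theorem reduces to the part of the Riemann-Roch theorem that says \<open>\<ell>(G) = deg G + 1 - g\<close> for
  \<open>deg G \<ge> 2g - 1\<close>.

  Since the constant field is finite, dimensions are logarithms of indices of additive subgroups of
  \<open>F\<close>, and linear algebra becomes counting. For \<open>y \<noteq> 0\<close> and a subgroup \<open>T\<close> of \<open>F\<close> with \<open>y T \<subseteq> T\<close>, the
  index of \<open>y T\<close> in \<open>T\<close> is bounded by counting \<open>y\<close>-adic digit sums; this makes valuation rings
  discrete, residue fields finite, and gives the degree bound for zeros that Riemann's inequality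
  needs. Adeles are replaced by functions whose poles are restricted only at a finite set of places;
  by weak approximation the indices are the same. Finally, if \<open>i(A) = \<ell>(A) - deg A - 1 + g\<close> is positive,
  then multiplication by elements of \<open>L(A)\<close> and double counting give \<open>\<ell>(A) \<le> g\<close>, hence
  \<open>deg A \<le> 2g - 2\<close>.
\<close>

section \<open>Indices of additive subgroups\<close>

text \<open>\<open>GREATEST\<close> in the genus, \<open>THE\<close> in the valuation and
  \<open>dim\<close> in the degree of a place carry no information until boundedness, uniqueness or
  finiteness is known. Most of the proof before the final counting argument establishes exactly
  this; once the maximum in the genus exists, i(A) \<ge> 0 holds for every divisor by definition.
  The digit count is the source of these finiteness results. Its bound q^(n d), with n = [F : K(x)],
  does not depend on T. For T a valuation ring it yields uniformizers and finite residue fields. For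
  T the functions regular at a finite set of places it bounds the degree of the zeros of y there.
  For y = 1/x the bound is sharp, and the pole divisor of x has degree exactly n; this turns
  Riemann's inequality into a comparison of growth rates. In the last step the number g arises as
  i(0), because l(0) = 1. A nonzero f in L(A) maps a space of dimension i(0) onto one of dimension
  i(A), and the double count then compares |L(A)| with q^g.\<close>

definition add_subgroup :: "'a :: ab_group_add set \<Rightarrow> bool" where
  "add_subgroup A \<longleftrightarrow> 0 \<in> A \<and> (\<forall>x\<in>A. \<forall>y\<in>A. x - y \<in> A)"

definition coset :: "'a :: ab_group_add set \<Rightarrow> 'a \<Rightarrow> 'a set" where
  "coset A b = {y. y - b \<in> A}"

text \<open>An infinite index is represented by \<open>0\<close>; the index of a subgroup is then multiplicative
  without finiteness hypotheses.\<close>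

definition idx :: "'a :: ab_group_add set \<Rightarrow> 'a set \<Rightarrow> nat" where
  "idx A B = card (coset A ` B)"

definition sumset :: "'a :: ab_group_add set \<Rightarrow> 'a set \<Rightarrow> 'a set" where
  "sumset A B = {a + b | a b. a \<in> A \<and> b \<in> B}"

lemma add_subgroup_zero: "add_subgroup A \<Longrightarrow> 0 \<in> A"
  and add_subgroup_diff: "add_subgroup A \<Longrightarrow> x \<in> A \<Longrightarrow> y \<in> A \<Longrightarrow> x - y \<in> A"
  by (auto simp: add_subgroup_def)

lemma add_subgroup_minus: "add_subgroup A \<Longrightarrow> x \<in> A \<Longrightarrow> - x \<in> A"
  using add_subgroup_diff[of A 0 x] by (simp add: add_subgroup_zero)

lemma add_subgroup_add: "add_subgroup A \<Longrightarrow> x \<in> A \<Longrightarrow> y \<in> A \<Longrightarrow> x + y \<in> A"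
  using add_subgroup_diff[of A x "- y"] by (simp add: add_subgroup_minus)

lemma add_subgroup_sum:
  "add_subgroup A \<Longrightarrow> (\<And>i. i \<in> I \<Longrightarrow> f i \<in> A) \<Longrightarrow> sum f I \<in> A"
  by (induction I rule: infinite_finite_induct) (auto simp: add_subgroup_zero add_subgroup_add)

lemma add_subgroup_Int: "add_subgroup A \<Longrightarrow> add_subgroup B \<Longrightarrow> add_subgroup (A \<inter> B)"
  by (auto simp: add_subgroup_def)

lemma sumsetI: "a \<in> A \<Longrightarrow> b \<in> B \<Longrightarrow> a + b \<in> sumset A B"
  by (auto simp: sumset_def)

lemma sumsetE:
  assumes "z \<in> sumset A B"
  obtains a b where "z = a + b" "a \<in> A" "b \<in> B"
  using assms by (auto simp: sumset_def)

lemma subset_sumset1: "add_subgroup B \<Longrightarrow> A \<subseteq> sumset A B"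
  using sumsetI[of _ A 0 B, OF _ add_subgroup_zero] by auto

lemma subset_sumset2: "add_subgroup A \<Longrightarrow> B \<subseteq> sumset A B"
  using sumsetI[of 0 A _ B, OF add_subgroup_zero] by auto

lemma add_subgroup_sumset:
  assumes "add_subgroup A" "add_subgroup B"
  shows "add_subgroup (sumset A B)"
  unfolding add_subgroup_def
proof (intro conjI ballI)
  show "0 \<in> sumset A B"
    using subset_sumset1[OF assms(2), of A] add_subgroup_zero[OF assms(1)] by blast
  fix x y assume "x \<in> sumset A B" "y \<in> sumset A B"
  then obtain a b a' b' where ab: "x = a + b" "y = a' + b'" "a \<in> A" "b \<in> B" "a' \<in> A" "b' \<in> B"
    by (elim sumsetE)
  have "(a - a') + (b - b') \<in> sumset A B"
    using ab assms by (intro sumsetI add_subgroup_diff)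
  then show "x - y \<in> sumset A B" unfolding ab by (simp add: algebra_simps)
qed

lemma sumset_least:
  "add_subgroup C \<Longrightarrow> A \<subseteq> C \<Longrightarrow> B \<subseteq> C \<Longrightarrow> sumset A B \<subseteq> C"
  by (auto elim!: sumsetE intro: add_subgroup_add)

lemma add_subgroup_mult_image:
  fixes A :: "'a :: ring set"
  assumes "add_subgroup A" shows "add_subgroup ((*) c ` A)"
  unfolding add_subgroup_def
proof (intro conjI ballI)
  show "0 \<in> (*) c ` A" using add_subgroup_zero[OF assms] by (auto intro: rev_image_eqI)
  fix x y assume "x \<in> (*) c ` A" "y \<in> (*) c ` A"
  then obtain a b where "x = c * a" "y = c * b" "a \<in> A" "b \<in> A" by auto
  then show "x - y \<in> (*) c ` A"
    using add_subgroup_diff[OF assms] by (auto simp: right_diff_distrib[symmetric])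
qed

lemma coset_eq_iff:
  assumes "add_subgroup A"
  shows "coset A b = coset A c \<longleftrightarrow> b - c \<in> A"
proof
  assume "coset A b = coset A c"
  moreover have "b \<in> coset A b" using assms by (simp add: coset_def add_subgroup_zero)
  ultimately show "b - c \<in> A" by (simp add: coset_def)
next
  assume bc: "b - c \<in> A"
  have "y - b \<in> A \<longleftrightarrow> y - c \<in> A" for y
  proof
    assume "y - b \<in> A"
    from add_subgroup_add[OF assms this bc] show "y - c \<in> A" by simp
  next
    assume "y - c \<in> A"
    from add_subgroup_diff[OF assms this bc] show "y - b \<in> A" by simp
  qed
  then show "coset A b = coset A c" by (auto simp: coset_def)
qed

lemma coset_reps:
  obtains R where "R \<subseteq> B" "inj_on (coset A) R" "coset A ` R = coset A ` B"
proof -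
  obtain R where "R \<subseteq> B" "coset A ` B = coset A ` R" "inj_on (coset A) R"
    using subset_image_inj[of "coset A ` B" "coset A" B] by auto
  with that show thesis by metis
qed

text \<open>Both maps induce the same partition of \<open>B\<close>, so one transversal serves both.
  The argument also covers infinite images, where both cardinalities read 0.\<close>

lemma card_image_cong:
  assumes "\<And>x y. x \<in> B \<Longrightarrow> y \<in> B \<Longrightarrow> f x = f y \<longleftrightarrow> g x = g y"
  shows "card (f ` B) = card (g ` B)"
proof -
  obtain R where R: "R \<subseteq> B" "f ` B = f ` R" "inj_on f R"
    using subset_image_inj[of "f ` B" f B] by auto
  have "inj_on g R"
  proof (rule inj_onI)
    fix x y assume "x \<in> R" "y \<in> R" "g x = g y"
    then show "x = y" using assms[of x y] R(1) inj_onD[OF R(3)] by blast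
  qed
  moreover have "g ` B = g ` R"
  proof -
    have "g b \<in> g ` R" if b: "b \<in> B" for b
    proof -
      obtain r where "r \<in> R" "f b = f r" using R(2) b by blast
      then show ?thesis using assms[of b r] b R(1) by auto
    qed
    then show ?thesis using R(1) by auto
  qed
  ultimately show ?thesis using R by (simp add: card_image)
qed

lemma finite_cosets: "idx A B \<noteq> 0 \<Longrightarrow> finite (coset A ` B)"
  unfolding idx_def by (rule ccontr) simp

lemma idx_image:
  assumes "add_subgroup A" "add_subgroup A'"
    and "\<And>x y. x \<in> B \<Longrightarrow> y \<in> B \<Longrightarrow> f x - f y \<in> A' \<longleftrightarrow> x - y \<in> A"
  shows "card (coset A' ` f ` B) = idx A B"
  unfolding idx_def image_image
  by (rule card_image_cong) (simp add: coset_eq_iff assms)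

text \<open>The last hypothesis says that \<open>f\<close>, not assumed additive, induces an
  injection on cosets. The larger index has to be nonzero because 0 encodes infinity.\<close>

lemma idx_le_of_map:
  assumes "add_subgroup A" "add_subgroup A'" "f ` B \<subseteq> B'" "idx A' B' \<noteq> 0"
    and "\<And>x y. x \<in> B \<Longrightarrow> y \<in> B \<Longrightarrow> f x - f y \<in> A' \<longleftrightarrow> x - y \<in> A"
  shows "idx A B \<le> idx A' B'"
proof -
  have "idx A B = card (coset A' ` f ` B)"
    using idx_image[OF assms(1,2), of B f] assms(5) by simp
  also have "\<dots> \<le> idx A' B'"
    unfolding idx_def using assms(3,4) by (intro card_mono image_mono finite_cosets)
  finally show ?thesis .
qed

lemma idx_eq_of_map:
  assumes "add_subgroup A" "add_subgroup A'" "f ` B \<subseteq> B'"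
    and "\<And>x y. x \<in> B \<Longrightarrow> y \<in> B \<Longrightarrow> f x - f y \<in> A' \<longleftrightarrow> x - y \<in> A"
    and "\<And>y. y \<in> B' \<Longrightarrow> \<exists>x\<in>B. y - f x \<in> A'"
  shows "idx A B = idx A' B'"
proof -
  have "coset A' ` f ` B = coset A' ` B'"
  proof
    show "coset A' ` B' \<subseteq> coset A' ` f ` B"
    proof
      fix Z assume "Z \<in> coset A' ` B'"
      then obtain y where y: "y \<in> B'" "Z = coset A' y" by blast
      with assms(5) obtain x where "x \<in> B" "y - f x \<in> A'" by blast
      then show "Z \<in> coset A' ` f ` B" using y coset_eq_iff[OF assms(2), of y "f x"] by blast
    qed
  qed (use assms(3) in auto)
  then show ?thesis
    using idx_image[OF assms(1,2), of B f] assms(4) by (simp add: idx_def)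
qed

text \<open>Sums r + s of representatives of \<open>B\<close> modulo \<open>A\<close> and of
  \<open>C\<close> modulo \<open>B\<close> represent every class of \<open>C\<close> modulo
  \<open>A\<close> exactly once.\<close>

lemma idx_trans:
  assumes "add_subgroup A" "add_subgroup B" "add_subgroup C" "A \<subseteq> B" "B \<subseteq> C"
  shows "idx A C = idx A B * idx B C"
proof -
  obtain R where R: "R \<subseteq> B" "inj_on (coset A) R" "coset A ` R = coset A ` B"
    by (rule coset_reps)
  obtain S where S: "S \<subseteq> C" "inj_on (coset B) S" "coset B ` S = coset B ` C"
    by (rule coset_reps)
  have rep: "\<exists>t\<in>T. b - t \<in> G" if G: "add_subgroup G" and T: "coset G ` T = coset G ` H" and b: "b \<in> H" for G T H b
  proof -
    have "coset G b \<in> coset G ` T" unfolding T using b by (rule imageI)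
    then show ?thesis using coset_eq_iff[OF G, of b] by auto
  qed
  have inj: "inj_on (\<lambda>(r, s). coset A (r + s)) (R \<times> S)"
  proof (rule inj_onI, clarify)
    fix r s r' s' assume rs: "r \<in> R" "s \<in> S" "r' \<in> R" "s' \<in> S"
      and eq: "coset A (r + s) = coset A (r' + s')"
    have d: "r + s - (r' + s') \<in> A" using eq coset_eq_iff[OF assms(1)] by blast
    moreover have "r' - r \<in> B" using rs R(1) assms(2) by (intro add_subgroup_diff) auto
    ultimately have "(r + s - (r' + s')) + (r' - r) \<in> B"
      using assms(2,4) by (intro add_subgroup_add) auto
    then have "s - s' \<in> B" by (simp add: algebra_simps)
    then have ss: "s = s'" using rs coset_eq_iff[OF assms(2), of s s'] inj_onD[OF S(2)] by blast
    then have "r - r' \<in> A" using d by simp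
    then have "r = r'" using rs coset_eq_iff[OF assms(1), of r r'] inj_onD[OF R(2)] by blast
    with ss show "r = r' \<and> s = s'" by simp
  qed
  have surj: "(\<lambda>(r, s). coset A (r + s)) ` (R \<times> S) = coset A ` C"
  proof
    show "(\<lambda>(r, s). coset A (r + s)) ` (R \<times> S) \<subseteq> coset A ` C"
    proof clarify
      fix r s assume "r \<in> R" "s \<in> S"
      then have "r + s \<in> C" using R(1) S(1) assms(3,5) by (intro add_subgroup_add) auto
      then show "coset A (r + s) \<in> coset A ` C" by blast
    qed
    show "coset A ` C \<subseteq> (\<lambda>(r, s). coset A (r + s)) ` (R \<times> S)"
    proof
      fix Z assume "Z \<in> coset A ` C"
      then obtain c where c: "c \<in> C" "Z = coset A c" by blast
      then obtain s where s: "s \<in> S" "c - s \<in> B"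
        using rep[OF assms(2) S(3)] by blast
      then obtain r where r: "r \<in> R" "c - s - r \<in> A"
        using rep[OF assms(1) R(3)] by blast
      have "Z = coset A (r + s)"
        unfolding c(2) coset_eq_iff[OF assms(1)] using r(2) by (simp add: algebra_simps)
      then show "Z \<in> (\<lambda>(r, s). coset A (r + s)) ` (R \<times> S)"
        using r s by (auto intro: rev_image_eqI[of "(r, s)"])
    qed
  qed
  have "idx A C = card (R \<times> S)"
    unfolding idx_def surj[symmetric] by (rule card_image[OF inj])
  also have "\<dots> = idx A B * idx B C"
    unfolding idx_def R(3)[symmetric] S(3)[symmetric]
    using R(2) S(2) by (simp add: card_image card_cartesian_product)
  finally show ?thesis .
qed

lemma idx_refl:
  assumes "add_subgroup A" shows "idx A A = 1"
proof -
  have "coset A a = coset A 0" if "a \<in> A" for a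
    using that assms by (simp add: coset_eq_iff)
  then have "coset A ` A = {coset A 0}"
    using add_subgroup_zero[OF assms] by blast
  then show ?thesis by (simp add: idx_def)
qed

lemma idx_eq_one_imp:
  assumes "add_subgroup A" "add_subgroup B" "A \<subseteq> B" "idx A B = 1"
  shows "A = B"
proof -
  obtain Z where Z: "coset A ` B = {Z}"
    using assms(4) unfolding idx_def by (rule card_1_singletonE)
  have "b \<in> A" if "b \<in> B" for b
  proof -
    have "coset A b = coset A 0" using Z that add_subgroup_zero[OF assms(2)] by blast
    then show ?thesis using coset_eq_iff[OF assms(1), of b 0] by simp
  qed
  then show ?thesis using assms(3) by blast
qed

lemma idx_nonzero_subset:
  assumes "B \<subseteq> C" "idx A C \<noteq> 0" "B \<noteq> {}"
  shows "idx A B \<noteq> 0"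
proof -
  have "finite (coset A ` C)" using assms(2) by (rule finite_cosets)
  then have "finite (coset A ` B)" by (rule finite_subset[OF image_mono[OF assms(1)]])
  then show ?thesis using assms(3) by (simp add: idx_def)
qed

text \<open>The second isomorphism theorem, induced by the inclusion of \<open>B\<close> into A +
  B.\<close>

lemma idx_sumset:
  assumes "add_subgroup A" "add_subgroup B"
  shows "idx A (sumset A B) = idx (A \<inter> B) B"
proof -
  have "idx (A \<inter> B) B = idx A (sumset A B)"
  proof (rule idx_eq_of_map[where f = "\<lambda>x. x"])
    show "\<exists>x\<in>B. y - x \<in> A" if "y \<in> sumset A B" for y :: 'a
    proof -
      obtain a b where "y = a + b" "a \<in> A" "b \<in> B" using \<open>y \<in> sumset A B\<close> by (rule sumsetE)
      then show ?thesis by (intro bexI[of _ b]) auto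
    qed
  qed (use assms subset_sumset2 in \<open>auto simp: add_subgroup_Int add_subgroup_diff\<close>)
  then show ?thesis by simp
qed

lemma idx_mult_image:
  fixes c :: "'a :: field"
  assumes "add_subgroup A" "c \<noteq> 0"
  shows "idx ((*) c ` A) ((*) c ` B) = idx A B"
proof (rule idx_eq_of_map[where f = "(*) c", symmetric])
  show "\<exists>x\<in>B. y - c * x \<in> (*) c ` A" if "y \<in> (*) c ` B" for y
    using that add_subgroup_zero[OF assms(1)] by (auto intro!: rev_image_eqI[of 0])
qed (use assms in \<open>auto simp: add_subgroup_mult_image right_diff_distrib[symmetric]\<close>)

text \<open>Lagrange's theorem, obtained from the tower 0 \<le> A \<le> B.\<close>

lemma card_eq_card_mult_idx:
  assumes "add_subgroup A" "add_subgroup B" "A \<subseteq> B"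
  shows "card B = card A * idx A B"
proof -
  have z: "add_subgroup {0 :: 'a}" by (simp add: add_subgroup_def)
  have c: "idx {0 :: 'a} Z = card Z" for Z
    unfolding idx_def by (intro card_image inj_onI) (auto simp: coset_eq_iff[OF z])
  show ?thesis
    using idx_trans[OF z assms(1,2)] assms by (simp add: c add_subgroup_zero)
qed

lemma idx_reps:
  assumes "add_subgroup A" "idx A B \<noteq> 0"
  obtains R where "finite R" "R \<subseteq> B" "card R = idx A B"
    "\<And>b. b \<in> B \<Longrightarrow> \<exists>r\<in>R. b - r \<in> A" 
    "\<And>r r'. r \<in> R \<Longrightarrow> r' \<in> R \<Longrightarrow> r - r' \<in> A \<Longrightarrow> r = r'"
proof -
  obtain R where R: "R \<subseteq> B" "inj_on (coset A) R" "coset A ` R = coset A ` B"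
    by (rule coset_reps)
  have "finite (coset A ` R)" unfolding R(3) using assms(2) by (rule finite_cosets)
  then have "finite R" using R(2) by (rule finite_imageD)
  moreover have "card R = idx A B" using R by (metis card_image idx_def)
  moreover have "\<exists>r\<in>R. b - r \<in> A" if "b \<in> B" for b
  proof -
    have "coset A b \<in> coset A ` R" unfolding R(3) using that by (rule imageI)
    then show ?thesis using coset_eq_iff[OF assms(1), of b] by auto
  qed
  moreover have "r = r'" if "r \<in> R" "r' \<in> R" "r - r' \<in> A" for r r'
    using that coset_eq_iff[OF assms(1), of r r'] inj_onD[OF R(2)] by blast
  ultimately show thesis using that R(1) by blast
qed

text \<open>If a > b, then (a/b)^e outgrows any constant. This removes the factor that clearing the
  denominators of the digits costs.\<close>

lemma nat_power_growth:
  fixes a b C :: nat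
  assumes "\<And>e. a ^ e \<le> C * b ^ e"
  shows "a \<le> b"
proof (rule ccontr)
  assume "\<not> a \<le> b"
  then have ab: "a > b" by simp
  show False
  proof (cases "b = 0")
    case True
    with assms[of 1] ab show False by simp
  next
    case False
    define t where "t = real a / real b"
    have "t > 1" using ab False by (simp add: t_def)
    then obtain e where e: "real C < t ^ e" using real_arch_pow by blast
    have "real (a ^ e) \<le> real (C * b ^ e)" using assms[of e] by (simp only: of_nat_le_iff)
    then have "t ^ e \<le> real C" using False by (simp add: t_def power_divide field_simps)
    with e show False by simp
  qed
qed

section \<open>Function fields as finite extensions of a rational function field\<close>

lemma eval_class_ring_simps:
  "ring.eval class_ring [] y = (0 :: 'a :: field)"
  "ring.eval class_ring (a # l) y = a * y ^ length l + ring.eval class_ring l (y :: 'a)"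
  by (simp_all add: ring.eval.simps[OF class_ring.ring_axioms] class_ring_simps)

lemma eval_class_ring_append:
  "ring.eval class_ring (l @ [a]) y = ring.eval class_ring l y * (y :: 'a :: field) + a"
proof (induction l)
  case Nil
  then show ?case by (simp add: eval_class_ring_simps)
next
  case (Cons b l)
  then show ?case by (simp add: eval_class_ring_simps algebra_simps)
qed

context function_field
begin

sublocale emb_poly: map_poly_inj_idom_hom emb ..

abbreviation pev :: "'q poly \<Rightarrow> 'f \<Rightarrow> 'f" where
  "pev p z \<equiv> poly (map_poly emb p) z"

lemma pev_simps [simp]:
  "pev (p + q) z = pev p z + pev q z"
  "pev (p * q) z = pev p z * pev q z"
  "pev (- p) z = - pev p z"
  "pev (p - q) z = pev p z - pev q z"
  "pev (monom a k) z = emb a * z ^ k"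
  "pev (pCons a p) z = emb a + z * pev p z"
  by (simp_all add: hom_distribs poly_monom)

lemma pev_sum: "pev (\<Sum>i\<in>I. p i) z = (\<Sum>i\<in>I. pev (p i) z)"
  by (induction I rule: infinite_finite_induct) simp_all

text \<open>HOL-Algebra lists coefficients with the leading one first, hence
  \<open>rev\<close>.\<close>

lemma eval_class_ring:
  "ring.eval class_ring (map emb (rev (coeffs p))) y = pev p y"
proof (induction p)
  case 0
  then show ?case by (simp add: eval_class_ring_simps)
next
  case (pCons a p)
  then show ?case by (simp add: eval_class_ring_append cCons_def eval_class_ring_simps)
qed

text \<open>Transcendence is injectivity of evaluation on coefficient lists; a root makes the list
  of \<open>p\<close> and the empty list evaluate alike.\<close>

lemma algebraic_of_root:
  assumes "p \<noteq> 0" "pev p y = 0"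
  shows "ring.algebraic class_ring (range emb) y"
proof
  let ?l = "map emb (rev (coeffs p))"
  assume "ring.transcendental class_ring (range emb) y"
  then have inj: "inj_on (\<lambda>p. ring.eval class_ring p y)
      (carrier (univ_poly class_ring (range emb)))"
    unfolding ring.transcendental_def[OF class_ring.ring_axioms] .
  have "?l \<noteq> []" using assms(1) by simp
  moreover have "hd ?l \<noteq> 0"
    using assms(1) by (simp add: hd_map hd_rev last_coeffs_eq_coeff_degree)
  ultimately have "?l \<in> carrier (univ_poly class_ring (range emb))"
    by (auto simp: univ_poly_def polynomial_def)
  moreover have "[] \<in> carrier (univ_poly class_ring (range emb))"
    by (simp add: univ_poly_def polynomial_def)
  moreover have "ring.eval class_ring ?l y = ring.eval class_ring [] y"
    unfolding eval_class_ring using assms(2) by (simp add: eval_class_ring_simps)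
  ultimately have "?l = []" using inj_onD[OF inj, of ?l "[]"] by simp
  then show False using \<open>?l \<noteq> []\<close> by simp
qed

lemma pev_nonzero_of_transcendental:
  "ring.transcendental class_ring (range emb) y \<Longrightarrow> p \<noteq> 0 \<Longrightarrow> pev p y \<noteq> 0"
  using algebraic_of_root by blast

lemma pev_nonzero: "y \<notin> range emb \<Longrightarrow> p \<noteq> 0 \<Longrightarrow> pev p y \<noteq> 0"
  using algebraic_of_root full_constant_field by blast

text \<open>For transcendental \<open>x\<close> this is the K(x)-span of \<open>U\<close>. The
  polynomial \<open>b\<close> is a common denominator of the coefficients, so K(x) itself never has
  to be formed.\<close>

definition rational_span :: "'f \<Rightarrow> 'f set \<Rightarrow> 'f set" where
  "rational_span x U =
     {f. \<exists>b p. b \<noteq> 0 \<and> pev b x * f = (\<Sum>v\<in>U. pev (p v) x * v)}"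

lemma rational_spanI:
  "b \<noteq> 0 \<Longrightarrow> pev b x * f = (\<Sum>v\<in>U. pev (p v) x * v) \<Longrightarrow> f \<in> rational_span x U"
  unfolding rational_span_def by blast

lemma rational_spanE:
  assumes "f \<in> rational_span x U"
  obtains b p where "b \<noteq> 0" "pev b x * f = (\<Sum>v\<in>U. pev (p v) x * v)"
  using assms unfolding rational_span_def by blast

lemma rational_span_base:
  assumes "finite U" "w \<in> U" shows "w \<in> rational_span x U"
proof (rule rational_spanI[where b = 1 and p = "\<lambda>v. if v = w then 1 else 0"])
  have "(\<Sum>v\<in>U. pev (if v = w then 1 else 0) x * v) = (\<Sum>v\<in>U. if v = w then v else 0)"
    by (rule sum.cong) auto
  then show "pev 1 x * w = (\<Sum>v\<in>U. pev (if v = w then 1 else 0) x * v)"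
    using assms by simp
qed simp

lemma rational_span_add:
  assumes "f \<in> rational_span x U" "h \<in> rational_span x U"
  shows "f + h \<in> rational_span x U"
proof -
  obtain b p where b: "b \<noteq> 0" "pev b x * f = (\<Sum>v\<in>U. pev (p v) x * v)"
    using assms(1) by (rule rational_spanE)
  obtain c q where c: "c \<noteq> 0" "pev c x * h = (\<Sum>v\<in>U. pev (q v) x * v)"
    using assms(2) by (rule rational_spanE)
  show ?thesis
  proof (rule rational_spanI[where b = "b * c" and p = "\<lambda>v. c * p v + b * q v"])
    have "pev (b * c) x * (f + h) = pev c x * (pev b x * f) + pev b x * (pev c x * h)"
      by (simp add: algebra_simps)
    also have "\<dots> = (\<Sum>v\<in>U. pev (c * p v + b * q v) x * v)"
      unfolding b c by (simp add: sum_distrib_left sum.distrib algebra_simps)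
    finally show "pev (b * c) x * (f + h) = (\<Sum>v\<in>U. pev (c * p v + b * q v) x * v)" .
  qed (use b c in simp)
qed

lemma rational_span_mult:
  assumes "f \<in> rational_span x U" "c \<noteq> 0" "pev c x * k = pev a x"
  shows "k * f \<in> rational_span x U"
proof -
  obtain b p where b: "b \<noteq> 0" "pev b x * f = (\<Sum>v\<in>U. pev (p v) x * v)"
    using assms(1) by (rule rational_spanE)
  show ?thesis
  proof (rule rational_spanI[where b = "b * c" and p = "\<lambda>v. a * p v"])
    have "pev (b * c) x * (k * f) = (pev c x * k) * (pev b x * f)"
      by (simp add: algebra_simps)
    also have "\<dots> = (\<Sum>v\<in>U. pev (a * p v) x * v)"
      unfolding b assms(3) by (simp add: sum_distrib_left algebra_simps)
    finally show "pev (b * c) x * (k * f) = (\<Sum>v\<in>U. pev (a * p v) x * v)" .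
  qed (use b assms in simp)
qed

lemma rational_span_mono:
  assumes "U \<subseteq> V" "finite V" shows "rational_span x U \<subseteq> rational_span x V"
proof
  fix f assume "f \<in> rational_span x U"
  then obtain b p where b: "b \<noteq> 0" "pev b x * f = (\<Sum>v\<in>U. pev (p v) x * v)"
    by (rule rational_spanE)
  show "f \<in> rational_span x V"
  proof (rule rational_spanI[where b = b and p = "\<lambda>v. if v \<in> U then p v else 0"])
    have "(\<Sum>v\<in>V. pev (if v \<in> U then p v else 0) x * v) = (\<Sum>v\<in>U. pev (p v) x * v)"
      by (rule sum.mono_neutral_cong_right) (use assms in auto)
    then show "pev b x * f = (\<Sum>v\<in>V. pev (if v \<in> U then p v else 0) x * v)" using b by simp
  qed (use b in simp)
qed

text \<open>Quotients of polynomials in \<open>x\<close> are closed under the field operations. At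
  inverses the old numerator becomes a denominator and must be a nonzero polynomial, which follows
  from \<open>tr\<close>.\<close>

lemma generate_field_fraction:
  assumes "k \<in> generate_field class_ring (insert x (range emb))"
    and tr: "\<And>p. p \<noteq> 0 \<Longrightarrow> pev p x \<noteq> 0"
  shows "\<exists>a c. c \<noteq> 0 \<and> pev c x * k = pev a x"
  using assms(1)
proof (induction rule: generate_field.induct)
  case one
  show ?case by (rule exI[of _ 1], rule exI[of _ 1]) simp
next
  case (incl h)
  then consider "h = x" | e where "h = emb e" by auto
  then show ?case
  proof cases
    case 1
    then show ?thesis by (intro exI[of _ "[:0, 1:]"] exI[of _ 1]) simp
  next
    case (2 e)
    then show ?thesis by (intro exI[of _ "[:e:]"] exI[of _ 1]) simp
  qed
next
  case (a_inv h)
  then obtain a c where "c \<noteq> 0" "pev c x * h = pev a x" by blast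
  then show ?case
    by (intro exI[of _ "- a"] exI[of _ c]) (simp add: class_ring_simps)
next
  case (m_inv h)
  then obtain a c where ac: "c \<noteq> 0" "pev c x * h = pev a x" by blast
  have h: "h \<noteq> 0" using m_inv by simp
  then have a: "a \<noteq> 0" using ac tr[of c] by auto
  have "pev a x * inverse h = pev c x" unfolding ac(2)[symmetric] using h by simp
  then show ?case using a h
    by (intro exI[of _ c] exI[of _ a]) (simp add: class_ring_simps)
next
  case (eng_add h1 h2)
  then obtain a c a' c' where *: "c \<noteq> 0" "pev c x * h1 = pev a x" "c' \<noteq> 0" "pev c' x * h2 = pev a' x"
    by blast
  have "pev (c * c') x * (h1 + h2) = pev c' x * (pev c x * h1) + pev c x * (pev c' x * h2)"
    by (simp add: algebra_simps)
  also have "\<dots> = pev (c' * a + c * a') x" unfolding * by simp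
  finally show ?case using *(1,3)
    by (intro exI[of _ "c' * a + c * a'"] exI[of _ "c * c'"]) simp
next
  case (eng_mult h1 h2)
  then obtain a c a' c' where *: "c \<noteq> 0" "pev c x * h1 = pev a x" "c' \<noteq> 0" "pev c' x * h2 = pev a' x"
    by blast
  have "pev (c * c') x * (h1 * h2) = (pev c x * h1) * (pev c' x * h2)"
    by (simp add: algebra_simps)
  also have "\<dots> = pev (a * a') x" unfolding * by simp
  finally show ?case using *(1,3)
    by (intro exI[of _ "a * a'"] exI[of _ "c * c'"]) simp
qed

lemma rational_span_of_dimension:
  assumes "ring.dimension class_ring m K E"
    and "\<And>k. k \<in> K \<Longrightarrow> \<exists>a c. c \<noteq> 0 \<and> pev c x * k = pev a x"
  shows "\<exists>U. finite U \<and> E \<subseteq> rational_span x U"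
  using assms
proof (induction rule: ring.dimension.induct[OF class_ring.ring_axioms, consumes 1, case_names zero_dim Suc_dim])
  case (zero_dim K)
  have "(0 :: 'f) \<in> rational_span x {}" by (rule rational_spanI[of 1]) simp_all
  then show ?case by (intro exI[of _ "{}"]) simp
next
  case (Suc_dim v E m K)
  obtain U where U: "finite U" "E \<subseteq> rational_span x U"
    using Suc_dim.IH[OF Suc_dim.prems] by blast
  have "f \<in> rational_span x (insert v U)"
    if "f \<in> ring.line_extension class_ring K v E" for f
  proof -
    from that obtain k e where ke: "k \<in> K" "e \<in> E"
      "f = k * v + e"
      by (auto simp: ring.line_extension_def[OF class_ring.ring_axioms] r_coset_def set_add_def set_mult_def)
    obtain a c where ac: "c \<noteq> 0" "pev c x * k = pev a x"
      using Suc_dim.prems ke(1) by blast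
    have "k * v \<in> rational_span x (insert v U)"
      using rational_span_mult[OF rational_span_base ac] U by blast
    moreover have "e \<in> rational_span x (insert v U)"
      using rational_span_mono[of U "insert v U"] U ke(2) by blast
    ultimately show ?thesis unfolding ke(3) by (rule rational_span_add)
  qed
  then show ?case using U by (intro exI[of _ "insert v U"]) auto
qed

text \<open>Cross-multiplication eliminates \<open>w\<close>: the new coefficient
  \<open>p w * q v - q w * p v\<close> vanishes at \<open>v = w\<close>.\<close>

lemma rational_span_remove:
  assumes "finite U" "w \<in> U" "p w \<noteq> 0" "(\<Sum>v\<in>U. pev (p v) x * v) = 0"
  shows "rational_span x U \<subseteq> rational_span x (U - {w})"
proof
  fix f assume "f \<in> rational_span x U"
  then obtain b q where b: "b \<noteq> 0" "pev b x * f = (\<Sum>v\<in>U. pev (q v) x * v)"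
    by (rule rational_spanE)
  show "f \<in> rational_span x (U - {w})"
  proof (rule rational_spanI[where b = "p w * b" and p = "\<lambda>v. p w * q v - q w * p v"])
    have "pev (p w * b) x * f = pev (p w) x * (\<Sum>v\<in>U. pev (q v) x * v)
        - pev (q w) x * (\<Sum>v\<in>U. pev (p v) x * v)"
      using b assms(4) by simp
    also have "\<dots> = (\<Sum>v\<in>U. pev (p w * q v - q w * p v) x * v)"
      by (simp add: sum_distrib_left sum_subtractf algebra_simps)
    also have "\<dots> = (\<Sum>v\<in>U - {w}. pev (p w * q v - q w * p v) x * v)"
      using assms(1,2) by (simp add: sum.remove)
    finally show "pev (p w * b) x * f = (\<Sum>v\<in>U - {w}. pev (p w * q v - q w * p v) x * v)" .
  qed (use assms b in simp)
qed

end

text \<open>A transcendental \<open>x\<close> and a basis \<open>U\<close> of F over K(x). After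
  clearing denominators, independence needs to be stated for polynomial coefficients only.
  \<open>card U\<close> is the degree [F : K(x)].\<close>

locale function_field_basis = function_field emb
  for emb :: "'q :: {field, finite} \<Rightarrow> 'f :: field" +
  fixes x :: 'f and U :: "'f set"
  assumes pev_x: "b \<noteq> 0 \<Longrightarrow> poly (map_poly emb b) x \<noteq> 0"
    and finite_basis: "finite U"
    and basis_span: "f \<in> function_field.rational_span emb x U"
    and basis_indep: "(\<Sum>v\<in>U. poly (map_poly emb (p v)) x * v) = 0 \<Longrightarrow> v \<in> U \<Longrightarrow> p v = 0"

text \<open>A spanning set of least cardinality is independent, since a nontrivial relation would
  allow one of its elements to be dropped.\<close>

lemma (in function_field) ex_function_field_basis:
  "\<exists>x U. function_field_basis emb x U"
proof -
  obtain x where x: "ring.transcendental class_ring (range emb) x"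
    "ring.finite_dimension class_ring (generate_field class_ring (insert x (range emb))) UNIV"
    using finite_over_rational by blast
  note tr = pev_nonzero_of_transcendental[OF x(1)]
  define Q where "Q V \<longleftrightarrow> finite V \<and> rational_span x V = UNIV" for V
  obtain m where "ring.dimension class_ring m (generate_field class_ring (insert x (range emb))) UNIV"
    using x(2) unfolding ring.finite_dimension_def[OF class_ring.ring_axioms] by blast
  from rational_span_of_dimension[OF this generate_field_fraction[OF _ tr]]
  obtain V where "Q V" unfolding Q_def by blast
  then have "\<exists>U. Q U \<and> (\<forall>V. Q V \<longrightarrow> card U \<le> card V)"
    by (rule ex_has_least_nat)
  then obtain U where QU: "Q U" and least: "\<And>V. Q V \<Longrightarrow> card U \<le> card V"
    by (elim exE conjE) simp
  have U: "finite U" "rational_span x U = UNIV" using QU unfolding Q_def by auto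
  have "function_field_basis emb x U"
  proof unfold_locales
    fix p v assume p: "(\<Sum>v\<in>U. pev (p v) x * v) = 0" "v \<in> U"
    show "p v = 0"
    proof (rule ccontr)
      assume nz: "p v \<noteq> 0"
      have "rational_span x (U - {v}) = UNIV"
        using rational_span_remove[OF U(1) p(2) nz p(1)] unfolding U(2) by (rule top.extremum_uniqueI)
      then have "Q (U - {v})" using U(1) by (simp add: Q_def)
      then have "card U \<le> card (U - {v})" by (rule least)
      then show False using U(1) p(2) by (metis card_Diff1_less linorder_not_less)
    qed
  qed (use tr U in auto)
  then show ?thesis by blast
qed

section \<open>Combinations of basis elements with polynomial coefficients of bounded degree\<close>

definition (in function_field) q :: nat where
  "q = card (range emb)"

lemma (in function_field) q_eq: "q = card (UNIV :: 'q set)"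
  unfolding q_def by (intro card_image) (simp add: inj_on_def)

lemma (in function_field) q_gt_1: "q > 1"
proof -
  have "card {0 :: 'q, 1} \<le> q" unfolding q_eq by (rule card_mono) simp_all
  then show ?thesis by simp
qed

context function_field_basis
begin

definition comb :: "nat \<Rightarrow> ('f \<times> nat \<Rightarrow> 'q) \<Rightarrow> 'f" where
  "comb d c = (\<Sum>(v, j)\<in>U \<times> {..<d}. emb (c (v, j)) * x ^ j * v)"

definition poly_span :: "nat \<Rightarrow> 'f set" where
  "poly_span d = range (comb d)"

lemma comb_restrict: "comb d (restrict c (U \<times> {..<d})) = comb d c"
  unfolding comb_def by (rule sum.cong) auto

lemma poly_span_eq_PiE: "poly_span d = comb d ` (U \<times> {..<d} \<rightarrow>\<^sub>E UNIV)"
proof -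
  have "comb d c \<in> comb d ` (U \<times> {..<d} \<rightarrow>\<^sub>E UNIV)" for c
    by (subst comb_restrict[symmetric]) (auto intro!: imageI simp: PiE_def extensional_def)
  then show ?thesis unfolding poly_span_def by auto
qed

lemma finite_poly_span: "finite (poly_span d)"
  unfolding poly_span_eq_PiE by (intro finite_imageI finite_PiE) (simp_all add: finite_basis)

lemma card_coeffs: "card (U \<times> {..<d} \<rightarrow>\<^sub>E (UNIV :: 'q set)) = q ^ (card U * d)"
  by (simp add: card_PiE finite_basis card_cartesian_product q_eq)

lemma card_poly_span_le: "card (poly_span d) \<le> q ^ (card U * d)"
  unfolding poly_span_eq_PiE card_coeffs[symmetric]
  by (intro card_image_le finite_PiE) (simp_all add: finite_basis)

lemma comb_diff: "comb d c - comb d c' = comb d (\<lambda>k. c k - c' k)"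
  unfolding comb_def sum_subtractf[symmetric]
  by (rule sum.cong) (auto simp: hom_distribs algebra_simps)

lemma add_subgroup_poly_span: "add_subgroup (poly_span d)"
  unfolding add_subgroup_def
proof (intro conjI ballI)
  have "comb d (\<lambda>_. 0) = 0" unfolding comb_def by (rule sum.neutral) auto
  then show "0 \<in> poly_span d" unfolding poly_span_def by (metis rangeI)
  fix y z assume "y \<in> poly_span d" "z \<in> poly_span d"
  then show "y - z \<in> poly_span d" unfolding poly_span_def by (auto simp: comb_diff)
qed

lemma poly_span_scale:
  assumes "m \<in> poly_span d" shows "emb a * m \<in> poly_span d"
proof -
  obtain c where c: "m = comb d c" using assms unfolding poly_span_def by blast
  have "emb a * comb d c = comb d (\<lambda>k. a * c k)"
    unfolding comb_def sum_distrib_left by (rule sum.cong) (auto simp: hom_distribs algebra_simps)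
  then show ?thesis unfolding c poly_span_def by blast
qed

lemma poly_span_gen:
  assumes "v \<in> U" "j < d" shows "x ^ j * v \<in> poly_span d"
proof -
  have "comb d (\<lambda>k. if k = (v, j) then 1 else 0)
      = (\<Sum>k\<in>U \<times> {..<d}. if k = (v, j) then x ^ j * v else 0)"
    unfolding comb_def by (rule sum.cong) (auto split: if_splits)
  also have "\<dots> = x ^ j * v" using assms finite_basis by simp
  finally show ?thesis unfolding poly_span_def by (metis rangeI)
qed

text \<open>Equivalently, the matrix of multiplication by \<open>z\<close> in the basis
  \<open>U\<close> has entries that are polynomials in \<open>x\<close> of degree at most
  \<open>d\<close>; the matrix itself is never formed.\<close>

definition degree_shift :: "'f \<Rightarrow> nat \<Rightarrow> bool" where
  "degree_shift z d \<longleftrightarrow> (\<forall>c. \<forall>m\<in>poly_span c. z * m \<in> poly_span (c + d))"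

lemma degree_shiftD: "degree_shift z d \<Longrightarrow> m \<in> poly_span c \<Longrightarrow> z * m \<in> poly_span (c + d)"
  unfolding degree_shift_def by blast

lemma degree_shiftI_gen:
  assumes "\<And>c v j. v \<in> U \<Longrightarrow> j < c \<Longrightarrow> z * (x ^ j * v) \<in> poly_span (c + d)"
  shows "degree_shift z d"
  unfolding degree_shift_def
proof (intro allI ballI)
  fix c m assume "m \<in> poly_span c"
  then obtain f where f: "m = comb c f" unfolding poly_span_def by blast
  have "z * m = (\<Sum>(v, j)\<in>U \<times> {..<c}. emb (f (v, j)) * (z * (x ^ j * v)))"
    unfolding f comb_def sum_distrib_left by (rule sum.cong) auto
  also have "\<dots> \<in> poly_span (c + d)"
    by (rule add_subgroup_sum[OF add_subgroup_poly_span])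
       (use assms in \<open>auto intro!: poly_span_scale\<close>)
  finally show "z * m \<in> poly_span (c + d)" .
qed

lemma degree_shift_x_power: "degree_shift (x ^ k) k"
proof (rule degree_shiftI_gen)
  fix c v j assume "v \<in> U" "j < (c :: nat)"
  then have "x ^ (k + j) * v \<in> poly_span (c + k)" by (intro poly_span_gen) auto
  then show "x ^ k * (x ^ j * v) \<in> poly_span (c + k)" by (simp add: power_add mult.assoc)
qed

lemma poly_span_mono:
  assumes "c \<le> d" shows "poly_span c \<subseteq> poly_span d"
proof -
  have "degree_shift 1 (d - c)"
    by (rule degree_shiftI_gen) (auto intro!: poly_span_gen)
  then show ?thesis using assms degree_shiftD[of 1 "d - c" _ c] by auto
qed

lemma degree_shift_mono: "degree_shift z c \<Longrightarrow> c \<le> d \<Longrightarrow> degree_shift z d"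
  unfolding degree_shift_def using poly_span_mono by (meson add_left_mono subsetD)

text \<open>It suffices to test basis elements, because powers of \<open>x\<close> commute past
  \<open>z\<close>. \<open>Suc d\<close> corresponds to degree at most \<open>d\<close>, as
  \<open>poly_span\<close> uses a strict bound.\<close>

lemma degree_shiftI:
  assumes "\<And>v. v \<in> U \<Longrightarrow> z * v \<in> poly_span (Suc d)"
  shows "degree_shift z d"
proof (rule degree_shiftI_gen)
  fix c v j assume v: "v \<in> U" and j: "j < (c :: nat)"
  have "x ^ j * (z * v) \<in> poly_span (Suc d + j)"
    by (rule degree_shiftD[OF degree_shift_x_power assms[OF v]])
  moreover have "poly_span (Suc d + j) \<subseteq> poly_span (c + d)" by (rule poly_span_mono) (use j in simp)
  ultimately show "z * (x ^ j * v) \<in> poly_span (c + d)" by (auto simp: mult.left_commute)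
qed

lemma pev_mult_basis:
  assumes "v \<in> U" shows "pev p x * v \<in> poly_span (Suc (degree p))"
proof -
  have "pev p x * v = (\<Sum>j\<le>degree p. emb (coeff p j) * (x ^ j * v))"
    by (simp add: poly_altdef sum_distrib_right mult.assoc)
  also have "\<dots> \<in> poly_span (Suc (degree p))"
    by (rule add_subgroup_sum[OF add_subgroup_poly_span])
       (use assms in \<open>auto intro!: poly_span_scale poly_span_gen\<close>)
  finally show ?thesis .
qed

lemma degree_shift_pev: "degree_shift (pev p x) (degree p)"
  by (rule degree_shiftI) (rule pev_mult_basis)

lemma degree_shift_mult:
  assumes "degree_shift z c" "degree_shift w d" shows "degree_shift (z * w) (c + d)"
  unfolding degree_shift_def
proof (intro allI ballI)
  fix e m assume "m \<in> poly_span e"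
  from degree_shiftD[OF assms(1) degree_shiftD[OF assms(2) this]]
  show "z * w * m \<in> poly_span (e + (c + d))" by (simp add: ac_simps)
qed

lemma ex_denominator: "\<exists>b d. b \<noteq> 0 \<and> pev b x * f \<in> poly_span d"
proof -
  obtain b p where b: "b \<noteq> 0" "pev b x * f = (\<Sum>v\<in>U. pev (p v) x * v)"
    using basis_span[of f] by (rule rational_spanE)
  define d where "d = (\<Sum>v\<in>U. Suc (degree (p v)))"
  have "pev (p v) x * v \<in> poly_span d" if "v \<in> U" for v
  proof -
    have "Suc (degree (p v)) \<le> d" unfolding d_def
      using member_le_sum[OF that, of "\<lambda>v. Suc (degree (p v))"] finite_basis by simp
    then show ?thesis using pev_mult_basis[OF that] poly_span_mono by blast
  qed
  then have "pev b x * f \<in> poly_span d"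
    unfolding b by (intro add_subgroup_sum[OF add_subgroup_poly_span])
  then show ?thesis using b by blast
qed

lemma ex_common_denominator:
  assumes "finite S"
  shows "\<exists>b d. b \<noteq> 0 \<and> (\<forall>f\<in>S. pev b x * f \<in> poly_span d)"
  using assms
proof (induction S rule: finite_induct)
  case empty
  show ?case by (rule exI[of _ 1]) simp
next
  case (insert f S)
  then obtain b d where b: "b \<noteq> 0" "\<And>f. f \<in> S \<Longrightarrow> pev b x * f \<in> poly_span d" by blast
  obtain c e where c: "c \<noteq> 0" "pev c x * f \<in> poly_span e" using ex_denominator by blast
  let ?d = "d + degree c + (e + degree b)"
  have "pev (b * c) x * h \<in> poly_span ?d" if "h \<in> insert f S" for h
  proof (cases "h = f")
    case True
    have "pev b x * (pev c x * f) \<in> poly_span (e + degree b)"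
      by (rule degree_shiftD[OF degree_shift_pev c(2)])
    moreover have "poly_span (e + degree b) \<subseteq> poly_span ?d" by (rule poly_span_mono) simp
    ultimately show ?thesis using True by (auto simp: mult.assoc)
  next
    case False
    then have "pev c x * (pev b x * h) \<in> poly_span (d + degree c)"
      using that by (intro degree_shiftD[OF degree_shift_pev b(2)]) simp
    moreover have "poly_span (d + degree c) \<subseteq> poly_span ?d" by (rule poly_span_mono) simp
    ultimately show ?thesis by (auto simp: ac_simps)
  qed
  moreover have "b * c \<noteq> 0" using b c by simp
  ultimately show ?case by blast
qed

text \<open>Multiplication by \<open>y\<close> may have denominators in the basis \<open>U\<close>.
  A polynomial \<open>Q\<close> in \<open>x\<close> clears them, and \<open>d\<close> is taken large
  enough for both \<open>Q\<close> and \<open>Q * y\<close>.\<close>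

lemma ex_degree_shift:
  "\<exists>Q d. Q \<noteq> 0 \<and> degree_shift Q d \<and> degree_shift (Q * y) d"
proof -
  obtain b d where b: "b \<noteq> 0" "\<And>f. f \<in> (*) y ` U \<Longrightarrow> pev b x * f \<in> poly_span d"
    using ex_common_denominator[of "(*) y ` U"] finite_basis by auto
  have "degree_shift (pev b x * y) d"
  proof (rule degree_shiftI)
    fix v assume "v \<in> U"
    then have "pev b x * (y * v) \<in> poly_span d" using b(2) by blast
    then show "pev b x * y * v \<in> poly_span (Suc d)"
      using poly_span_mono[of d "Suc d"] by (auto simp: mult.assoc)
  qed
  then have "degree_shift (pev b x * y) (d + degree b)" by (rule degree_shift_mono) simp
  moreover have "degree_shift (pev b x) (d + degree b)"
    by (rule degree_shift_mono[OF degree_shift_pev]) simp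
  ultimately show ?thesis using pev_x[OF b(1)] by blast
qed

section \<open>Counting digit sums: the index of y T in T\<close>

primrec digit_sum :: "'f \<Rightarrow> 'f list \<Rightarrow> 'f" where
  "digit_sum y [] = 0"
| "digit_sum y (t # ts) = t + y * digit_sum y ts"

lemma digit_sum_mem:
  assumes "add_subgroup T" "(*) y ` T \<subseteq> T" "set ts \<subseteq> T"
  shows "digit_sum y ts \<in> T"
  using assms(3)
  by (induction ts) (use assms(1,2) in \<open>auto simp: add_subgroup_zero intro!: add_subgroup_add\<close>)

text \<open>Reduction modulo y T determines the leading digit; cancelling \<open>y\<close> then
  passes to the remaining digits.\<close>

lemma digit_sum_inj:
  assumes "add_subgroup T" "(*) y ` T \<subseteq> T" "y \<noteq> 0" "D \<subseteq> T"
    and D: "\<And>r r'. r \<in> D \<Longrightarrow> r' \<in> D \<Longrightarrow> r - r' \<in> (*) y ` T \<Longrightarrow> r = r'"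
  shows "length ts = length ss \<Longrightarrow> set ts \<subseteq> D \<Longrightarrow> set ss \<subseteq> D \<Longrightarrow>
    digit_sum y ts = digit_sum y ss \<Longrightarrow> ts = ss"
proof (induction ts ss rule: list_induct2)
  case (Cons t ts s ss)
  have "digit_sum y ts \<in> T" "digit_sum y ss \<in> T"
    using Cons.prems assms(4) digit_sum_mem[OF assms(1,2)] by auto
  then have "y * (digit_sum y ss - digit_sum y ts) \<in> (*) y ` T"
    using assms(1) by (intro imageI add_subgroup_diff)
  moreover have "t - s = y * (digit_sum y ss - digit_sum y ts)"
    using Cons.prems(3) by (simp add: algebra_simps)
  ultimately have "t = s" using D[of t s] Cons.prems by simp
  then show ?case using Cons assms(3) by simp
qed simp

text \<open>Each factor \<open>y\<close> is paired with one factor \<open>Q\<close>, so a sum of e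
  digits costs e shifts by \<open>d\<close>; \<open>R\<close> clears the denominators of the
  digits.\<close>

lemma digit_sum_poly_span:
  assumes "degree_shift Q d" "degree_shift (Q * y) d" "\<And>t. t \<in> D \<Longrightarrow> R * t \<in> poly_span c"
  shows "set ts \<subseteq> D \<Longrightarrow> Q ^ length ts * R * digit_sum y ts \<in> poly_span (c + length ts * d)"
proof (induction ts)
  case Nil
  show ?case by (simp add: add_subgroup_zero[OF add_subgroup_poly_span])
next
  case (Cons t ts)
  have Q: "degree_shift (Q ^ k) (k * d)" for k
  proof (induction k)
    case 0
    show ?case by (simp add: degree_shift_def)
  next
    case (Suc k)
    show ?case using degree_shift_mult[OF assms(1) Suc] by simp
  qed
  have "Q ^ length (t # ts) * (R * t) \<in> poly_span (c + length (t # ts) * d)"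
    by (rule degree_shiftD[OF Q assms(3)]) (use Cons in simp)
  moreover have "(Q * y) * (Q ^ length ts * R * digit_sum y ts) \<in> poly_span (c + length ts * d + d)"
    by (rule degree_shiftD[OF assms(2) Cons.IH]) (use Cons in simp)
  then have "(Q * y) * (Q ^ length ts * R * digit_sum y ts) \<in> poly_span (c + length (t # ts) * d)"
    by (simp add: ac_simps)
  moreover have "Q ^ length (t # ts) * R * digit_sum y (t # ts)
     = Q ^ length (t # ts) * (R * t) + (Q * y) * (Q ^ length ts * R * digit_sum y ts)"
    by (simp add: algebra_simps)
  ultimately show ?case using add_subgroup_add[OF add_subgroup_poly_span] by metis
qed

text \<open>The sums \<open>t\<^sub>0 + t\<^sub>1 y + \<dots> + t\<^sub>e\<^sub>-\<^sub>1 y\<^bsup>e-1\<^esup>\<close> with digits from a set of representatives modulo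
  \<open>y T\<close> are distinct, and after clearing denominators they lie in a set of size at most
  \<open>q\<^bsup>n(c + e d)\<^esup>\<close>. Now let \<open>e\<close> tend to infinity.\<close>

lemma card_incongruent_le:
  assumes "degree_shift Q d" "degree_shift (Q * y) d" "Q \<noteq> 0" "y \<noteq> 0"
    and "add_subgroup T" "(*) y ` T \<subseteq> T" "D \<subseteq> T" "finite D"
    and D: "\<And>r r'. r \<in> D \<Longrightarrow> r' \<in> D \<Longrightarrow> r - r' \<in> (*) y ` T \<Longrightarrow> r = r'"
  shows "card D \<le> q ^ (card U * d)"
proof -
  obtain b c where b: "b \<noteq> 0" "\<And>t. t \<in> D \<Longrightarrow> pev b x * t \<in> poly_span c"
    using ex_common_denominator[OF assms(8)] by blast
  have R: "pev b x \<noteq> 0" by (rule pev_x[OF b(1)])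
  have "card D ^ e \<le> q ^ (card U * c) * (q ^ (card U * d)) ^ e" for e
  proof -
    let ?L = "{ts. set ts \<subseteq> D \<and> length ts = e}"
    let ?g = "\<lambda>ts. Q ^ e * pev b x * digit_sum y ts"
    have "inj_on ?g ?L"
    proof (rule inj_onI)
      fix ts ss assume *: "ts \<in> ?L" "ss \<in> ?L" "?g ts = ?g ss"
      then have "digit_sum y ts = digit_sum y ss" using R assms(3) by simp
      then show "ts = ss" using digit_sum_inj[OF assms(5,6,4,7) D] * by simp
    qed
    then have "card D ^ e = card (?g ` ?L)"
      by (simp add: card_image card_lists_length_eq[OF assms(8)])
    also have "?g ` ?L \<subseteq> poly_span (c + e * d)"
      using digit_sum_poly_span[OF assms(1,2) b(2)] by auto
    then have "card (?g ` ?L) \<le> card (poly_span (c + e * d))"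
      by (intro card_mono finite_poly_span)
    also have "\<dots> \<le> q ^ (card U * (c + e * d))" by (rule card_poly_span_le)
    also have "\<dots> = q ^ (card U * c) * (q ^ (card U * d)) ^ e"
      by (simp add: power_add[symmetric] power_mult[symmetric] algebra_simps)
    finally show ?thesis .
  qed
  then show ?thesis by (rule nat_power_growth)
qed

text \<open>All finite subsets of a transversal obey the digit bound, so the transversal is finite.
  That the bound does not involve \<open>T\<close> allows the same estimate for every finite set of
  places.\<close>

lemma idx_mult_le:
  assumes "degree_shift Q d" "degree_shift (Q * y) d" "Q \<noteq> 0" "y \<noteq> 0"
    and "add_subgroup T" "(*) y ` T \<subseteq> T"
  shows "idx ((*) y ` T) T \<noteq> 0 \<and> idx ((*) y ` T) T \<le> q ^ (card U * d)"
proof -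
  let ?A = "(*) y ` T"
  obtain R where R: "R \<subseteq> T" "inj_on (coset ?A) R" "coset ?A ` R = coset ?A ` T"
    by (rule coset_reps)
  have A: "add_subgroup ?A" using assms(5) by (rule add_subgroup_mult_image)
  have le: "card D \<le> q ^ (card U * d)" if D: "D \<subseteq> R" "finite D" for D
  proof (rule card_incongruent_le[OF assms, of D])
    show "D \<subseteq> T" using D R by blast
    fix r r' assume "r \<in> D" "r' \<in> D" "r - r' \<in> ?A"
    then show "r = r'" using inj_onD[OF R(2), of r r'] D coset_eq_iff[OF A, of r r'] by blast
  qed (rule D)
  have "finite R"
  proof (rule ccontr)
    assume "infinite R"
    then obtain D where "D \<subseteq> R" "finite D" "card D = Suc (q ^ (card U * d))"
      using infinite_arbitrarily_large[OF \<open>infinite R\<close>] by blast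
    then show False using le[of D] by simp
  qed
  have "coset ?A 0 \<in> coset ?A ` R"
    unfolding R(3) using add_subgroup_zero[OF assms(5)] by (rule imageI)
  then have "R \<noteq> {}" by blast
  then have "card R \<noteq> 0" using \<open>finite R\<close> by simp
  moreover have "card R \<le> q ^ (card U * d)" using \<open>finite R\<close> by (intro le) simp_all
  moreover have "idx ?A T = card R"
    unfolding idx_def R(3)[symmetric] using R(2) by (rule card_image)
  ultimately show ?thesis by (simp only: simp_thms)
qed

end

section \<open>Places and their valuations\<close>

context function_field
begin

definition places :: "'f set set" where
  "places = {P. is_place emb P}"

definition vring :: "'f set \<Rightarrow> 'f set" where
  "vring P = {z. z = 0 \<or> inverse z \<notin> P}"

lemma carrier_place_ring: "carrier (place_ring P) = vring P"
  by (simp add: place_ring_def vring_def)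

lemma valuation_ringD:
  assumes "valuation_ring emb A"
  shows "0 \<in> A" "1 \<in> A" "emb c \<in> A"
    "a \<in> A \<Longrightarrow> b \<in> A \<Longrightarrow> a + b \<in> A"
    "a \<in> A \<Longrightarrow> b \<in> A \<Longrightarrow> a - b \<in> A"
    "a \<in> A \<Longrightarrow> b \<in> A \<Longrightarrow> a * b \<in> A"
    "z \<in> A \<or> inverse z \<in> A"
proof -
  have A: "subring A class_ring" "range emb \<subset> A" and *: "\<forall>z. z \<in> A \<or> inverse z \<in> A"
    using assms by (simp_all add: valuation_ring_def)
  note sub = subringE[OF A(1), simplified]
  show "z \<in> A \<or> inverse z \<in> A" using * by blast
  show "emb c \<in> A" using A(2) by blast
  show "0 \<in> A" "1 \<in> A" using sub(2,3) by simp_all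
  show add: "a + b \<in> A" if "a \<in> A" "b \<in> A" for a b
    using sub(7)[OF that] by simp
  show "a * b \<in> A" if "a \<in> A" "b \<in> A"
    using sub(6)[OF that] by simp
  show "a - b \<in> A" if "a \<in> A" "b \<in> A"
    using add[OF that(1) sub(5)[OF that(2)]] by (simp add: class_ring_simps)
qed

text \<open>Closure under addition rests on the valuation property: a/b or b/a lies in
  \<open>A\<close>, and in the first case a + b = (1 + a/b) b is a multiple of a nonunit. An ideal
  with an element outside this set contains a unit.\<close>

lemma maximalideal_nonunits:
  assumes A: "valuation_ring emb A"
  shows "maximalideal {z \<in> A. z = 0 \<or> inverse z \<notin> A} (class_ring\<lparr>carrier := A\<rparr>)"
proof -
  let ?N = "{z \<in> A. z = 0 \<or> inverse z \<notin> A}" and ?R = "class_ring\<lparr>carrier := A\<rparr> :: 'f ring"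
  note AD = valuation_ringD[OF A]
  have sub: "subring A class_ring" using A by (simp add: valuation_ring_def)
  have R: "ring ?R" using ring.subring_is_ring[OF class_ring.ring_axioms sub] by simp
  have mult: "a * z \<in> ?N" if "a \<in> A" "z \<in> ?N" for a z
  proof (cases "a * z = 0")
    case False
    have "inverse (a * z) \<notin> A"
    proof
      assume "inverse (a * z) \<in> A"
      then have "a * inverse (a * z) \<in> A" using that by (intro AD(6))
      moreover have "a * inverse (a * z) = inverse z" using False by (simp add: field_simps)
      ultimately have "inverse z \<in> A" by (simp only:)
      then show False using that False by auto
    qed
    then show ?thesis using that AD by blast
  qed (use AD in auto)
  have add1: "a + b \<in> ?N" if "a \<in> ?N" "b \<in> ?N" "b \<noteq> 0" "a / b \<in> A" for a b
  proof -
    have "(1 + a / b) * b \<in> ?N" using that AD by (intro mult) auto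
    moreover have "(1 + a / b) * b = a + b" using that by (simp add: field_simps)
    ultimately show ?thesis by simp
  qed
  have add: "a + b \<in> ?N" if "a \<in> ?N" "b \<in> ?N" for a b
  proof -
    consider "a = 0" | "b = 0" | "a \<noteq> 0" "b \<noteq> 0" "a / b \<in> A" | "a \<noteq> 0" "b \<noteq> 0" "b / a \<in> A"
      using AD(7)[of "a / b"] by auto
    then show ?thesis
    proof cases
      case 3
      then show ?thesis using add1 that by blast
    next
      case 4
      then show ?thesis using add1[of b a] that by (simp add: add.commute)
    qed (use that in auto)
  qed
  have uminus: "- a \<in> ?N" if "a \<in> ?N" for a
    using mult[of "- 1" a] AD(5)[of 0 1] AD(1,2) that by simp
  have ideal: "ideal ?N ?R"
  proof (rule idealI[OF R])
    interpret R: ring ?R by (rule R)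
    show "subgroup ?N (add_monoid ?R)"
    proof (rule R.add.subgroupI)
      show "?N \<noteq> {}" using AD(1) by blast
      fix a assume a: "a \<in> ?N"
      have "\<ominus>\<^bsub>?R\<^esub> a = - a"
        by (rule R.minus_equality) (use a AD(5)[of 0 a] AD(1) in auto)
      then show "\<ominus>\<^bsub>?R\<^esub> a \<in> ?N" using uminus[OF a] by (simp only:)
    next
      fix a b assume "a \<in> ?N" "b \<in> ?N"
      then show "a \<oplus>\<^bsub>?R\<^esub> b \<in> ?N" using add[of a b] by simp
    qed auto
  next
    fix a z assume "a \<in> ?N" "z \<in> carrier ?R"
    then show "z \<otimes>\<^bsub>?R\<^esub> a \<in> ?N" "a \<otimes>\<^bsub>?R\<^esub> z \<in> ?N"
      using mult[of z a] by (simp_all add: mult.commute)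
  qed
  show ?thesis
  proof (rule maximalidealI[OF ideal])
    have "1 \<notin> ?N" using AD(2) by simp
    then show "carrier ?R \<noteq> ?N" using AD(2) by (auto simp del: mem_Collect_eq)
    fix J assume J: "ideal J ?R" "?N \<subseteq> J" "J \<subseteq> carrier ?R"
    show "J = ?N \<or> J = carrier ?R"
    proof (cases "J \<subseteq> ?N")
      case False
      then obtain z where z: "z \<in> J" "z \<noteq> 0" "inverse z \<in> A" using J(3) by auto
      have "w \<in> J" if "w \<in> A" for w
      proof -
        have "w * inverse z \<in> carrier ?R" using that z AD by simp
        from ideal.I_l_closed[OF J(1) z(1) this] show ?thesis using z by (simp add: mult.assoc)
      qed
      then show ?thesis using J(3) by auto
    qed (use J in auto)
  qed
qed

lemma place_of_valuation_ring:
  assumes "valuation_ring emb A"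
  shows "{z \<in> A. z = 0 \<or> inverse z \<notin> A} \<in> places"
  unfolding places_def is_place_def using assms maximalideal_nonunits by blast

text \<open>A proper ideal contains no unit, so \<open>P\<close> lies in the ideal of nonunits, and
  maximality of \<open>P\<close> forces equality.\<close>

lemma place_eq_nonunits:
  assumes A: "valuation_ring emb A" and P: "maximalideal P (class_ring\<lparr>carrier := A\<rparr>)"
  shows "P = {z \<in> A. z = 0 \<or> inverse z \<notin> A}"
proof -
  let ?N = "{z \<in> A. z = 0 \<or> inverse z \<notin> A}" and ?R = "class_ring\<lparr>carrier := A\<rparr> :: 'f ring"
  interpret P: maximalideal P ?R by (rule P)
  interpret N: maximalideal ?N ?R by (rule maximalideal_nonunits[OF A])
  have "P \<subseteq> ?N"
  proof
    fix z assume z: "z \<in> P"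
    then have "z \<in> A" using P.a_subset by auto
    moreover have "z = 0 \<or> inverse z \<notin> A"
    proof (rule ccontr)
      assume c: "\<not> (z = 0 \<or> inverse z \<notin> A)"
      have "w \<in> P" if "w \<in> A" for w
      proof -
        have "w * inverse z \<in> carrier ?R" using that c valuation_ringD[OF A] by simp
        from P.I_l_closed[OF z this] show ?thesis using c by (simp add: mult.assoc)
      qed
      then show False using P.I_notcarr P.a_subset by auto
    qed
    ultimately show "z \<in> ?N" by simp
  qed
  then have "?N = P \<or> ?N = A" using P.I_maximal[OF N.is_ideal] by auto
  moreover have "1 \<notin> ?N" using valuation_ringD(2)[OF A] by simp
  then have "?N \<noteq> A" using valuation_ringD(2)[OF A] by blast
  ultimately show ?thesis by auto
qed

lemma place_vring:
  assumes "P \<in> places"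
  shows "valuation_ring emb (vring P)" "P = {z \<in> vring P. z = 0 \<or> inverse z \<notin> vring P}"
proof -
  obtain A where A: "valuation_ring emb A" "maximalideal P (class_ring\<lparr>carrier := A\<rparr>)"
    using assms unfolding places_def is_place_def by blast
  note P = place_eq_nonunits[OF A]
  have "vring P = A"
    unfolding vring_def P using valuation_ringD(1,7)[OF A(1)] by auto
  then show "valuation_ring emb (vring P)" "P = {z \<in> vring P. z = 0 \<or> inverse z \<notin> vring P}"
    using A P by auto
qed

lemmas vring_closed = valuation_ringD[OF place_vring(1)]

lemma place_mem_iff: "P \<in> places \<Longrightarrow> z \<in> P \<longleftrightarrow> z \<in> vring P \<and> (z = 0 \<or> inverse z \<notin> vring P)"
  using place_vring(2) by blast

lemma add_subgroup_vring: "P \<in> places \<Longrightarrow> add_subgroup (vring P)"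
  unfolding add_subgroup_def using vring_closed by blast

definition vunit :: "'f set \<Rightarrow> 'f \<Rightarrow> bool" where
  "vunit P z \<longleftrightarrow> z \<noteq> 0 \<and> z \<in> vring P \<and> inverse z \<in> vring P"

lemma vunit_mult: "P \<in> places \<Longrightarrow> vunit P z \<Longrightarrow> vunit P w \<Longrightarrow> vunit P (z * w)"
  unfolding vunit_def using vring_closed(6) by simp

lemma vunit_inverse: "vunit P z \<Longrightarrow> vunit P (inverse z)"
  unfolding vunit_def by simp

lemma vunit_powi: "P \<in> places \<Longrightarrow> vunit P z \<Longrightarrow> vunit P (z powi k)"
proof -
  assume P: "P \<in> places" and z: "vunit P z"
  have nat: "vunit P (w ^ j)" if "vunit P w" for w j
    by (induction j) (use that vunit_mult[OF P] vring_closed(2)[OF P] in \<open>auto simp: vunit_def\<close>)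
  show ?thesis using nat[OF z] nat[OF vunit_inverse[OF z]] by (simp add: power_int_def)
qed

lemma Units_place_ring:
  assumes P: "P \<in> places" shows "u \<in> Units (place_ring P) \<longleftrightarrow> vunit P u"
proof
  assume "u \<in> Units (place_ring P)"
  then obtain w where w: "u \<in> vring P" "w \<in> vring P" "w * u = 1"
    by (auto simp: Units_def place_ring_def vring_def)
  then have "u \<noteq> 0" "inverse u = w" using inverse_unique[of u w] by (auto simp: mult.commute)
  then show "vunit P u" using w by (simp add: vunit_def)
next
  assume "vunit P u"
  then show "u \<in> Units (place_ring P)"
    unfolding Units_def vunit_def carrier_place_ring
    by (auto simp: place_ring_def intro!: bexI[of _ "inverse u"])
qed

lemma PIdl_place_ring: "PIdl\<^bsub>place_ring P\<^esub> t = (*) t ` vring P"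
  unfolding cgenideal_def carrier_place_ring by (auto simp: place_ring_def mult.commute)

end

context function_field_basis
begin

lemma idx_vring_mult:
  assumes P: "P \<in> places" and y: "y \<in> vring P" "y \<noteq> 0"
  shows "idx ((*) y ` vring P) (vring P) \<noteq> 0"
proof -
  obtain Q d where "Q \<noteq> 0" "degree_shift Q d" "degree_shift (Q * y) d"
    using ex_degree_shift by blast
  moreover have "(*) y ` vring P \<subseteq> vring P" using y vring_closed(6)[OF P] by auto
  ultimately show ?thesis using idx_mult_le add_subgroup_vring[OF P] y(2) by blast
qed

text \<open>The tower y z O \<le> y O \<le> O. The logarithm of this index serves as a valuation, up
  to a factor, before any valuation is available.\<close>

lemma idx_vring_mult_mult:
  assumes P: "P \<in> places" and "y \<in> vring P" "z \<in> vring P" "y \<noteq> 0"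
  shows "idx ((*) (y * z) ` vring P) (vring P)
    = idx ((*) y ` vring P) (vring P) * idx ((*) z ` vring P) (vring P)"
proof -
  let ?O = "vring P"
  note s = add_subgroup_vring[OF P]
  have img: "(*) (y * z) ` ?O = (*) y ` (*) z ` ?O" by (simp add: image_image mult.assoc)
  have "idx ((*) y ` (*) z ` ?O) ?O = idx ((*) y ` (*) z ` ?O) ((*) y ` ?O) * idx ((*) y ` ?O) ?O"
  proof (rule idx_trans)
    show "(*) y ` (*) z ` ?O \<subseteq> (*) y ` ?O" "(*) y ` ?O \<subseteq> ?O"
      using assms vring_closed(6)[OF P] by auto
  qed (intro add_subgroup_mult_image s)+
  also have "idx ((*) y ` (*) z ` ?O) ((*) y ` ?O) = idx ((*) z ` ?O) ?O"
    using assms by (intro idx_mult_image add_subgroup_mult_image s)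
  finally show ?thesis unfolding img by simp
qed

text \<open>A uniformizer is an element \<open>t\<close> of \<open>P\<close> for which the finite index of \<open>t O\<close> in \<open>O\<close> is minimal.\<close>

lemma ex_uniformizer:
  assumes P: "P \<in> places"
  obtains t where "t \<noteq> 0" "P = (*) t ` vring P"
proof -
  let ?O = "vring P"
  let ?i = "\<lambda>y. idx ((*) y ` ?O) ?O"
  have "vring P \<noteq> UNIV" using place_vring(1)[OF P] by (auto simp: valuation_ring_def)
  then obtain w where w: "w \<notin> ?O" by blast
  then have "inverse w \<in> ?O" "w \<noteq> 0"
    using vring_closed(1,7)[OF P] by auto
  then have "inverse w \<in> P \<and> inverse w \<noteq> 0" using w by (simp add: place_mem_iff[OF P])
  then obtain t where t: "t \<in> P" "t \<noteq> 0" and least: "\<And>y. y \<in> P \<Longrightarrow> y \<noteq> 0 \<Longrightarrow> ?i t \<le> ?i y"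
    using ex_has_least_nat[of "\<lambda>y. y \<in> P \<and> y \<noteq> 0" "inverse w" ?i] by auto
  have tO: "t \<in> ?O" using t place_mem_iff[OF P] by blast
  have "y \<in> (*) t ` ?O" if y: "y \<in> P" for y
  proof (cases "y / t \<in> ?O")
    case True
    then show ?thesis using t by (auto intro!: image_eqI[of _ _ "y / t"])
  next
    case False
    then have y0: "y \<noteq> 0" using vring_closed(1)[OF P] by auto
    have s: "t / y \<in> ?O" using False vring_closed(7)[OF P, of "y / t"] by simp
    have yO: "y \<in> ?O" using y place_mem_iff[OF P] by blast
    \<comment> \<open>Minimality of \<open>?i t\<close> leaves only index 1 for t/y. Hence t/y is a
      unit and y/t lies in the ring, against the case assumption.\<close>
    have "?i t = ?i y * ?i (t / y)"
      using idx_vring_mult_mult[OF P yO s y0] y0 by simp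
    moreover have "?i t \<le> ?i y" using least y y0 by blast
    moreover have "?i t \<noteq> 0" "?i y \<noteq> 0" using idx_vring_mult[OF P] tO yO t y0 by auto
    ultimately have "?i (t / y) = 1" by (cases "?i (t / y)") auto
    moreover have "(*) (t / y) ` ?O \<subseteq> ?O"
      using vring_closed(6)[OF P s] by blast
    ultimately have "(*) (t / y) ` ?O = ?O"
      by (intro idx_eq_one_imp add_subgroup_mult_image add_subgroup_vring[OF P])
    then have "1 \<in> (*) (t / y) ` ?O" using vring_closed(2)[OF P] by simp
    then obtain v where "v \<in> ?O" "1 = t / y * v" by blast
    then have "y / t = v" using t y0 by (simp add: field_simps)
    with False \<open>v \<in> ?O\<close> show ?thesis by simp
  qed
  moreover have "t * v \<in> P" if v: "v \<in> ?O" for v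
  proof (cases "t * v = 0")
    case True
    then show ?thesis using place_mem_iff[OF P, of 0] vring_closed(1)[OF P] by (simp only: simp_thms)
  next
    case False
    have "inverse (t * v) \<notin> ?O"
    proof
      assume "inverse (t * v) \<in> ?O"
      then have "v * inverse (t * v) \<in> ?O" using v vring_closed(6)[OF P] by blast
      moreover have "v * inverse (t * v) = inverse t" using False by (simp add: field_simps)
      ultimately have "inverse t \<in> ?O" by (simp only:)
      then show False using t place_mem_iff[OF P] by blast
    qed
    then show ?thesis using place_mem_iff[OF P] tO v vring_closed(6)[OF P] by blast
  qed
  ultimately have "P = (*) t ` ?O" by auto
  with t(2) show thesis by (rule that)
qed

lemma uniformizer_not_unit:
  assumes P: "P \<in> places" and t: "t \<noteq> 0" "P = (*) t ` vring P"
  shows "t \<in> P" "t \<in> vring P" "inverse t \<notin> vring P"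
proof -
  have "t * 1 \<in> (*) t ` vring P" using vring_closed(2)[OF P] by (rule imageI)
  then show "t \<in> P" using t(2) by simp
  then show "t \<in> vring P" "inverse t \<notin> vring P" using place_mem_iff[OF P] t(1) by auto
qed

text \<open>Dividing by \<open>t\<close> divides the finite index of z O by the index of t O, which
  exceeds 1; so \<open>t\<close> can be split off only finitely often.\<close>

lemma vring_factor:
  assumes P: "P \<in> places" and t: "t \<noteq> 0" "P = (*) t ` vring P"
  shows "z \<in> vring P \<Longrightarrow> z \<noteq> 0 \<Longrightarrow> \<exists>k u. vunit P u \<and> z = t ^ k * u"
proof (induction "idx ((*) z ` vring P) (vring P)" arbitrary: z rule: less_induct)
  case less
  let ?O = "vring P"
  show ?case
  proof (cases "inverse z \<in> ?O")
    case True
    then show ?thesis using less.prems by (intro exI[of _ 0] exI[of _ z]) (simp add: vunit_def)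
  next
    case False
    then have "z \<in> P" using less.prems place_mem_iff[OF P] by blast
    then obtain w where w: "w \<in> ?O" "z = t * w" using t(2) by blast
    note u = uniformizer_not_unit[OF P t]
    have w0: "w \<noteq> 0" using w less.prems by auto
    have "idx ((*) z ` ?O) ?O = idx ((*) t ` ?O) ?O * idx ((*) w ` ?O) ?O"
      unfolding w(2) using idx_vring_mult_mult[OF P u(2) w(1) t(1)] .
    moreover have "idx ((*) t ` ?O) ?O \<noteq> 1"
    proof
      assume "idx ((*) t ` ?O) ?O = 1"
      then have "(*) t ` ?O = ?O"
        using vring_closed(6)[OF P] u(2)
        by (intro idx_eq_one_imp add_subgroup_mult_image add_subgroup_vring[OF P]) auto
      then have "1 \<in> P" using t(2) vring_closed(2)[OF P] by simp
      then show False using place_mem_iff[OF P] vring_closed(2)[OF P] by simp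
    qed
    moreover have "idx ((*) t ` ?O) ?O \<noteq> 0" "idx ((*) w ` ?O) ?O \<noteq> 0"
      using idx_vring_mult[OF P] u(2) t(1) w(1) w0 by auto
    ultimately have "idx ((*) w ` ?O) ?O < idx ((*) z ` ?O) ?O"
      by (cases "idx ((*) t ` ?O) ?O") auto
    from less.hyps[OF this w(1) w0] obtain k v where "vunit P v" "w = t ^ k * v" by blast
    then show ?thesis unfolding w(2)
      by (intro exI[of _ "Suc k"] exI[of _ v]) (simp add: mult.assoc)
  qed
qed

lemma place_factor:
  assumes P: "P \<in> places" and t: "t \<noteq> 0" "P = (*) t ` vring P" and z: "z \<noteq> 0"
  shows "\<exists>k u. vunit P u \<and> z = t powi k * u"
proof (cases "z \<in> vring P")
  case True
  then obtain k u where "vunit P u" "z = t ^ k * u" using vring_factor[OF P t] z by blast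
  then show ?thesis by (intro exI[of _ "int k"] exI[of _ u]) simp
next
  case False
  then have "inverse z \<in> vring P" using vring_closed(7)[OF P] by blast
  then obtain k u where ku: "vunit P u" "inverse z = t ^ k * u" using vring_factor[OF P t] z by force
  have "z = inverse (inverse z)" by simp
  also have "\<dots> = t powi (- int k) * inverse u" unfolding ku(2) by (simp add: power_int_minus)
  finally show ?thesis using vunit_inverse[OF ku(1)] by blast
qed

lemma powi_uniformizer_unit:
  assumes P: "P \<in> places" and t: "t \<noteq> 0" "P = (*) t ` vring P" and u: "vunit P (t powi k)"
  shows "k = 0"
proof -
  note tu = uniformizer_not_unit[OF P t]
  have pos: "\<not> vunit P (t ^ Suc j)" for j
  proof
    assume *: "vunit P (t ^ Suc j)"
    have "t ^ j \<in> vring P" by (induction j) (use vring_closed(2,6)[OF P] tu(2) in auto)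
    then have "t ^ j * inverse (t ^ Suc j) \<in> vring P"
      using * vring_closed(6)[OF P] unfolding vunit_def by blast
    moreover have "t ^ j * inverse (t ^ Suc j) = inverse t" using t(1) by (simp add: field_simps)
    ultimately show False using tu(3) by (simp only: simp_thms)
  qed
  consider "k = 0" | "k > 0" | "k < 0" by linarith
  then show ?thesis
  proof cases
    case 2
    then have "nat k = Suc (nat (k - 1))" by simp
    then have "t powi k = t ^ Suc (nat (k - 1))" using 2 by (simp add: power_int_def)
    then show ?thesis using u pos by metis
  next
    case 3
    then have "k = - int (Suc (nat (- k - 1)))" by simp
    then have "inverse (t powi k) = t ^ Suc (nat (- k - 1))"
      by (metis inverse_inverse_eq power_int_minus power_int_of_nat)
    then show ?thesis using vunit_inverse[OF u] pos by metis
  qed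
qed

text \<open>The \<open>THE\<close> in \<open>place_val\<close> ranges over all generators of
  \<open>P\<close>. Uniqueness therefore has to compare \<open>t\<close> with an arbitrary generator
  \<open>s\<close>; the two differ by the unit \<open>a\<close>.\<close>

lemma place_val_eqI:
  assumes P: "P \<in> places" and t: "t \<noteq> 0" "P = (*) t ` vring P" and z: "z = t powi k * u" "vunit P u"
  shows "place_val P z = k"
  unfolding place_val_def
proof (rule the_equality)
  show "\<exists>t u. P = PIdl\<^bsub>place_ring P\<^esub> t \<and> u \<in> Units (place_ring P) \<and> z = t powi k * u"
    unfolding PIdl_place_ring Units_place_ring[OF P] using t(2) z by blast
next
  fix m assume "\<exists>t u. P = PIdl\<^bsub>place_ring P\<^esub> t \<and> u \<in> Units (place_ring P) \<and> z = t powi m * u"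
  then obtain s v where s: "P = (*) s ` vring P" "vunit P v" "z = s powi m * v"
    unfolding PIdl_place_ring Units_place_ring[OF P] by blast
  have s0: "s \<noteq> 0"
  proof
    assume "s = 0"
    then have "P \<subseteq> {0}" using s(1) by auto
    then show False using uniformizer_not_unit(1)[OF P t] t(1) by blast
  qed
  obtain a where a: "a \<in> vring P" "t = s * a"
    using uniformizer_not_unit(1)[OF P t] s(1) by blast
  obtain b where b: "b \<in> vring P" "s = t * b"
    using uniformizer_not_unit(1)[OF P s0 s(1)] t(2) by blast
  have "a * b = 1" using a(2) b(2) t(1) by (metis mult.assoc mult_cancel_left1)
  then have ab: "inverse a = b" "a \<noteq> 0" using inverse_unique by auto
  then have ua: "vunit P a" using a b by (simp add: vunit_def)
  have "s powi m * v = s powi k * a powi k * u" using z(1) s(3) a(2) by (simp add: power_int_mult_distrib)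
  then have "s powi (m - k) = a powi k * u * inverse v"
    using s(2) s0 by (simp add: power_int_diff vunit_def field_simps)
  moreover have "vunit P (a powi k * u * inverse v)"
    using ua z(2) s(2) P by (intro vunit_mult vunit_powi vunit_inverse)
  ultimately have "m - k = 0" using powi_uniformizer_unit[OF P s0 s(1)] by metis
  then show "m = k" by simp
qed

lemma place_val_factor:
  assumes P: "P \<in> places" and t: "t \<noteq> 0" "P = (*) t ` vring P" and z: "z \<noteq> 0"
  shows "\<exists>u. vunit P u \<and> z = t powi (place_val P z) * u"
proof -
  obtain k u where ku: "vunit P u" "z = t powi k * u" using place_factor[OF P t z] by blast
  have "place_val P z = k" by (rule place_val_eqI[OF P t ku(2,1)])
  then have "vunit P u \<and> z = t powi (place_val P z) * u" using ku by (simp only: simp_thms)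
  then show ?thesis by (rule exI)
qed

section \<open>Rules for valuations\<close>

lemma place_val_mult:
  assumes P: "P \<in> places" and "y \<noteq> 0" "z \<noteq> 0"
  shows "place_val P (y * z) = place_val P y + place_val P z"
proof -
  obtain t where t: "t \<noteq> 0" "P = (*) t ` vring P" using ex_uniformizer[OF P] by blast
  obtain u where u: "vunit P u" "y = t powi (place_val P y) * u"
    using place_val_factor[OF P t assms(2)] by blast
  obtain v where v: "vunit P v" "z = t powi (place_val P z) * v"
    using place_val_factor[OF P t assms(3)] by blast
  show ?thesis
  proof (rule place_val_eqI[OF P t])
    have "y * z = (t powi (place_val P y) * u) * (t powi (place_val P z) * v)" using u v by simp
    also have "\<dots> = t powi (place_val P y + place_val P z) * (u * v)"
      using t(1) by (simp add: power_int_add)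
    finally show "y * z = t powi (place_val P y + place_val P z) * (u * v)" .
  qed (use u v vunit_mult P in blast)
qed

lemma place_val_unit:
  assumes P: "P \<in> places" and "vunit P u" shows "place_val P u = 0"
proof -
  obtain t where t: "t \<noteq> 0" "P = (*) t ` vring P" using ex_uniformizer[OF P] by blast
  show ?thesis by (rule place_val_eqI[OF P t, of _ _ u]) (use assms in simp_all)
qed

lemma place_val_one: "P \<in> places \<Longrightarrow> place_val P 1 = 0"
  by (rule place_val_unit) (simp_all add: vunit_def vring_closed)

lemma place_val_emb: "P \<in> places \<Longrightarrow> c \<noteq> 0 \<Longrightarrow> place_val P (emb c) = 0"
  by (rule place_val_unit) (simp_all add: vunit_def vring_closed hom_distribs[symmetric])

lemma place_val_inverse:
  assumes P: "P \<in> places" and "z \<noteq> 0" shows "place_val P (inverse z) = - place_val P z"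
  using place_val_mult[OF P assms(2), of "inverse z"] assms place_val_one[OF P] by simp

lemma place_val_power:
  assumes P: "P \<in> places" and "z \<noteq> 0" shows "place_val P (z ^ k) = int k * place_val P z"
  by (induction k) (simp_all add: place_val_one[OF P] place_val_mult[OF P] assms algebra_simps)

lemma ex_place_val_one:
  assumes P: "P \<in> places"
  obtains t where "t \<noteq> 0" "place_val P t = 1"
proof -
  obtain t where t: "t \<noteq> 0" "P = (*) t ` vring P" using ex_uniformizer[OF P] by blast
  have "place_val P t = 1"
    by (rule place_val_eqI[OF P t, of _ _ 1]) (simp_all add: vunit_def vring_closed P)
  with t(1) show thesis by (rule that)
qed

lemma vring_iff_val:
  assumes P: "P \<in> places" and "z \<noteq> 0" shows "z \<in> vring P \<longleftrightarrow> place_val P z \<ge> 0"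
proof -
  obtain t where t: "t \<noteq> 0" "P = (*) t ` vring P" using ex_uniformizer[OF P] by blast
  have pos: "place_val P w \<ge> 0" if w: "w \<in> vring P" "w \<noteq> 0" for w
  proof -
    obtain k u where ku: "vunit P u" "w = t ^ k * u" using vring_factor[OF P t w] by blast
    then have "place_val P w = int k" by (intro place_val_eqI[OF P t, of _ _ u]) simp_all
    then show ?thesis by simp
  qed
  show ?thesis
  proof
    assume "place_val P z \<ge> 0"
    obtain u where u: "vunit P u" "z = t powi (place_val P z) * u"
      using place_val_factor[OF P t assms(2)] by blast
    have "t ^ j \<in> vring P" for j
      by (induction j) (use vring_closed(2,6)[OF P] uniformizer_not_unit(2)[OF P t] in auto)
    then have "t powi (place_val P z) \<in> vring P"
      using \<open>place_val P z \<ge> 0\<close> by (simp add: power_int_def)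
    then have "t powi (place_val P z) * u \<in> vring P"
      by (rule vring_closed(6)[OF P]) (use u(1) in \<open>simp add: vunit_def\<close>)
    then show "z \<in> vring P" by (subst u(2))
  qed (rule pos[OF _ assms(2)])
qed

lemma place_iff_val:
  assumes P: "P \<in> places" and "z \<noteq> 0" shows "z \<in> P \<longleftrightarrow> place_val P z > 0"
proof -
  have "inverse z \<in> vring P \<longleftrightarrow> - place_val P z \<ge> 0"
    using vring_iff_val[OF P, of "inverse z"] place_val_inverse[OF assms] assms(2) by simp
  then show ?thesis
    using place_mem_iff[OF P, of z] vring_iff_val[OF assms] assms(2) by auto
qed

text \<open>Zero counts as having infinite valuation; \<open>place_val P 0\<close> itself means
  nothing.\<close>

definition vge :: "'f set \<Rightarrow> 'f \<Rightarrow> int \<Rightarrow> bool" where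
  "vge P z m \<longleftrightarrow> z = 0 \<or> place_val P z \<ge> m"

lemma vge_zero [simp]: "vge P 0 m"
  by (simp add: vge_def)

lemma vge_mono: "vge P z m \<Longrightarrow> k \<le> m \<Longrightarrow> vge P z k"
  by (auto simp: vge_def)

lemma vge_zero_iff: "P \<in> places \<Longrightarrow> vge P z 0 \<longleftrightarrow> z \<in> vring P"
  using vring_iff_val[of P z] vring_closed(1)[of P] by (cases "z = 0") (auto simp: vge_def)

lemma vge_one_iff: "P \<in> places \<Longrightarrow> vge P z 1 \<longleftrightarrow> z \<in> P"
  using place_iff_val[of P z] place_mem_iff[of P 0] vring_closed(1)[of P]
  by (cases "z = 0") (auto simp: vge_def)

lemma vge_mult: "P \<in> places \<Longrightarrow> vge P y k \<Longrightarrow> vge P z m \<Longrightarrow> vge P (y * z) (k + m)"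
  using place_val_mult[of P y z] by (cases "y = 0 \<or> z = 0") (auto simp: vge_def)

lemma vge_mult_iff:
  assumes "P \<in> places" "y \<noteq> 0"
  shows "vge P (y * z) m \<longleftrightarrow> vge P z (m - place_val P y)"
  using place_val_mult[OF assms, of z] assms(2) by (cases "z = 0") (auto simp: vge_def)

text \<open>Dividing by an element of valuation exactly \<open>m\<close> turns the condition into
  membership in the valuation ring, which is closed under subtraction.\<close>

lemma vge_diff:
  assumes P: "P \<in> places" and "vge P y m" "vge P z m" shows "vge P (y - z) m"
proof -
  obtain t where t: "t \<noteq> 0" "place_val P t = 1" using ex_place_val_one[OF P] by blast
  have tm: "place_val P (t powi m) = m"
  proof (cases "m \<ge> 0")
    case True
    then show ?thesis using place_val_power[OF P t(1), of "nat m"] t by (simp add: power_int_def)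
  next
    case False
    then have "t powi m = inverse (t ^ nat (- m))" by (simp add: power_int_def power_inverse)
    then show ?thesis
      using place_val_power[OF P t(1), of "nat (- m)"] place_val_inverse[OF P, of "t ^ nat (- m)"] t False
      by simp
  qed
  have iff: "vge P w m \<longleftrightarrow> inverse (t powi m) * w \<in> vring P" for w
    using vge_mult_iff[OF P, of "inverse (t powi m)" w 0] place_val_inverse[OF P, of "t powi m"] tm t(1)
      vge_zero_iff[OF P] by simp
  show ?thesis
    using assms(2,3) vring_closed(5)[OF P] unfolding iff by (simp add: right_diff_distrib)
qed

lemma vge_add:
  assumes P: "P \<in> places" and "vge P y m" "vge P z m" shows "vge P (y + z) m"
  using vge_diff[OF P assms(2) vge_diff[OF P vge_zero assms(3)]] by simp

lemma vge_emb: "P \<in> places \<Longrightarrow> vge P (emb c) 0"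
  using vge_zero_iff vring_closed(3) by blast

lemma place_val_add_eq:
  assumes P: "P \<in> places" and "y \<noteq> 0" and z: "vge P z m" "place_val P y < m"
  shows "y + z \<noteq> 0" "place_val P (y + z) = place_val P y"
proof -
  have not: "\<not> vge P y (place_val P y + 1)" using assms(2) by (simp add: vge_def)
  have z1: "vge P z (place_val P y + 1)" using z vge_mono by force
  show nz: "y + z \<noteq> 0"
  proof
    assume "y + z = 0"
    then have "y = 0 - z" by (simp add: eq_neg_iff_add_eq_0)
    then show False using not vge_diff[OF P vge_zero z1] by simp
  qed
  have "vge P (y + z) (place_val P y)"
    using assms(2) by (intro vge_add[OF P] vge_mono[OF z1]) (auto simp: vge_def)
  moreover have "\<not> vge P (y + z) (place_val P y + 1)"
    using not vge_diff[OF P _ z1, of "y + z"] by auto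
  ultimately show "place_val P (y + z) = place_val P y" using nz by (simp add: vge_def)
qed

end

section \<open>Existence of places\<close>

context function_field
begin

definition power_span :: "'f set \<Rightarrow> nat \<Rightarrow> 'f \<Rightarrow> 'f set" where
  "power_span A n w = {\<Sum>i\<le>n. a i * w ^ i | a. \<forall>i. a i \<in> A}"

text \<open>The family to which Zorn's lemma is applied. Excluding \<open>inverse z\<close> keeps
  \<open>z\<close> a nonunit, so that it ends up in the maximal ideal.\<close>

definition ring_over :: "'f \<Rightarrow> 'f set \<Rightarrow> bool" where
  "ring_over z A \<longleftrightarrow> (\<forall>c. emb c \<in> A) \<and> (\<forall>a\<in>A. \<forall>b\<in>A. a - b \<in> A \<and> a * b \<in> A) \<and>
     z \<in> A \<and> inverse z \<notin> A"

context
  fixes z :: 'f and A :: "'f set"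
  assumes A: "ring_over z A"
begin

lemma ring_over_closed:
  "emb c \<in> A" "0 \<in> A" "1 \<in> A" "a \<in> A \<Longrightarrow> b \<in> A \<Longrightarrow> a - b \<in> A"
  "a \<in> A \<Longrightarrow> b \<in> A \<Longrightarrow> a + b \<in> A" "a \<in> A \<Longrightarrow> b \<in> A \<Longrightarrow> a * b \<in> A" "z \<in> A" "inverse z \<notin> A"
proof -
  have 1: "emb c \<in> A" "\<And>a b. a \<in> A \<Longrightarrow> b \<in> A \<Longrightarrow> a - b \<in> A \<and> a * b \<in> A" "z \<in> A" "inverse z \<notin> A" for c
    using A unfolding ring_over_def by blast+
  have 0: "0 \<in> A" using 1(1)[of 0] by simp
  show "emb c \<in> A" "0 \<in> A" "1 \<in> A" "a \<in> A \<Longrightarrow> b \<in> A \<Longrightarrow> a - b \<in> A"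
    "a \<in> A \<Longrightarrow> b \<in> A \<Longrightarrow> a * b \<in> A" "z \<in> A" "inverse z \<notin> A"
    using 1(1)[of 1] 1 0 by simp_all
  show "a + b \<in> A" if "a \<in> A" "b \<in> A"
    using 1(2)[OF that(1), of "0 - b"] 1(2)[OF 0 that(2)] by simp
qed

lemma power_span_add:
  assumes "f \<in> power_span A n w" "g \<in> power_span A n w" shows "f + g \<in> power_span A n w"
proof -
  obtain a b where "f = (\<Sum>i\<le>n. a i * w ^ i)" "\<forall>i. a i \<in> A" "g = (\<Sum>i\<le>n. b i * w ^ i)" "\<forall>i. b i \<in> A"
    using assms unfolding power_span_def by blast
  then show ?thesis unfolding power_span_def
    by (auto intro!: exI[of _ "\<lambda>i. a i + b i"] simp: sum.distrib distrib_right ring_over_closed)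
qed

lemma power_span_scale:
  assumes "c \<in> A" "f \<in> power_span A n w" shows "c * f \<in> power_span A n w"
proof -
  obtain a where "f = (\<Sum>i\<le>n. a i * w ^ i)" "\<forall>i. a i \<in> A"
    using assms unfolding power_span_def by blast
  then show ?thesis unfolding power_span_def using assms(1)
    by (auto intro!: exI[of _ "\<lambda>i. c * a i"] simp: sum_distrib_left mult.assoc ring_over_closed)
qed

lemma power_span_power:
  assumes "i \<le> n" shows "w ^ i \<in> power_span A n w"
proof -
  have "(\<Sum>j\<le>n. (if j = i then 1 else 0) * w ^ j) = (\<Sum>j\<le>n. if j = i then w ^ i else 0)"
    by (rule sum.cong) auto
  also have "\<dots> = w ^ i" using assms by simp
  finally show ?thesis unfolding power_span_def
    by (auto intro!: exI[of _ "\<lambda>j. if j = i then 1 else 0"] simp: ring_over_closed)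
qed

lemma power_span_const: "c \<in> A \<Longrightarrow> c \<in> power_span A n w"
  using power_span_scale[OF _ power_span_power[of 0 n w], of c] by simp

lemma power_span_sum:
  assumes "\<And>i. i \<in> I \<Longrightarrow> f i \<in> power_span A n w" shows "sum f I \<in> power_span A n w"
  using assms
  by (induction I rule: infinite_finite_induct)
     (auto intro: power_span_add power_span_const ring_over_closed)

lemma power_spanE:
  assumes "f \<in> power_span A n w"
  obtains a where "\<forall>i. a i \<in> A" "f = (\<Sum>i\<le>n. a i * w ^ i)"
  using assms unfolding power_span_def by blast

lemma power_span_mono: "n \<le> m \<Longrightarrow> power_span A n w \<subseteq> power_span A m w"
  by (auto elim!: power_spanE intro!: power_span_sum power_span_scale power_span_power)

lemma power_span_mult:
  assumes "f \<in> power_span A n w" "g \<in> power_span A m w"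
  shows "f * g \<in> power_span A (n + m) w"
proof -
  obtain a where a: "\<forall>i. a i \<in> A" "f = (\<Sum>i\<le>n. a i * w ^ i)" using assms(1) by (rule power_spanE)
  obtain b where b: "\<forall>i. b i \<in> A" "g = (\<Sum>i\<le>m. b i * w ^ i)" using assms(2) by (rule power_spanE)
  have "f * g = (\<Sum>i\<le>n. \<Sum>j\<le>m. (a i * b j) * w ^ (i + j))"
    unfolding a(2) b(2) sum_product by (simp add: power_add algebra_simps)
  also have "\<dots> \<in> power_span A (n + m) w"
    using a(1)[rule_format] b(1)[rule_format]
    by (intro power_span_sum power_span_scale power_span_power ring_over_closed) auto
  finally show ?thesis .
qed

text \<open>Put e = 1 - z b_0. By the second relation e is z times a combination of negative powers
  of \<open>w\<close> down to -m, so w^n e involves only exponents from n - m to n - 1. In 1/z = b_0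
  + e (1/z), expanding the last factor by the first relation therefore lowers the degree. This form
  of the identity avoids inverting e.\<close>

lemma power_span_reduce:
  assumes nm: "m \<le> n" "1 \<le> m" and w: "w \<noteq> 0"
    and "inverse z \<in> power_span A n w" "inverse z \<in> power_span A m (inverse w)"
  shows "inverse z \<in> power_span A (n - 1) w"
proof -
  have z: "z \<noteq> 0" using ring_over_closed(2,8) by auto
  obtain a where a: "\<forall>i. a i \<in> A" "inverse z = (\<Sum>i\<le>n. a i * w ^ i)"
    using assms(4) by (rule power_spanE)
  obtain b where b: "\<forall>i. b i \<in> A" "inverse z = (\<Sum>i\<le>m. b i * inverse w ^ i)"
    using assms(5) by (rule power_spanE)
  define e where "e = 1 - z * b 0"
  have eA: "e \<in> A" unfolding e_def using b(1) by (intro ring_over_closed) blast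
  have "inverse z = b 0 + (\<Sum>i\<in>{1..m}. b i * inverse w ^ i)"
    unfolding b(2) by (simp add: atMost_atLeast0 sum.atLeast_Suc_atMost)
  then have "z * inverse z = z * b 0 + z * (\<Sum>i\<in>{1..m}. b i * inverse w ^ i)"
    by (simp only: distrib_left)
  then have e: "e = z * (\<Sum>i\<in>{1..m}. b i * inverse w ^ i)"
    unfolding e_def using z by (simp add: algebra_simps)
  have n: "{..n} = insert n {..n - 1}" "n \<notin> {..n - 1}" using nm by auto
  have top: "inverse z = a n * w ^ n + (\<Sum>i\<le>n - 1. a i * w ^ i)"
    unfolding a(2) n(1) using n(2) by (intro sum.insert) simp
  have "inverse z = b 0 + e * inverse z" unfolding e_def using z by (simp add: algebra_simps)
  also have "e * inverse z = a n * (w ^ n * e) + e * (\<Sum>i\<le>n - 1. a i * w ^ i)"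
    unfolding top by (simp add: algebra_simps)
  also have "w ^ n * e = (\<Sum>i\<in>{1..m}. (z * b i) * w ^ (n - i))"
    unfolding e sum_distrib_left
  proof (rule sum.cong)
    fix i assume "i \<in> {1..m}"
    then have "w ^ n = w ^ (n - i) * w ^ i" using nm by (simp flip: power_add)
    then show "w ^ n * (z * (b i * inverse w ^ i)) = (z * b i) * w ^ (n - i)"
      using w by (simp add: power_inverse)
  qed simp
  finally have "inverse z = b 0 + (a n * (\<Sum>i\<in>{1..m}. (z * b i) * w ^ (n - i))
      + e * (\<Sum>i\<le>n - 1. a i * w ^ i))" .
  also have "\<dots> \<in> power_span A (n - 1) w"
    using a(1)[rule_format] b(1)[rule_format] eA
    by (intro power_span_add power_span_scale power_span_sum power_span_power power_span_const
        ring_over_closed) auto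
  finally show ?thesis .
qed

text \<open>Descent on the sum of the degrees, reducing the larger one each time, with
  \<open>w\<close> and \<open>inverse w\<close> exchanging roles. Degree 0 would put
  \<open>inverse z\<close> into \<open>A\<close>.\<close>

lemma power_span_False:
  "w \<noteq> 0 \<Longrightarrow> inverse z \<in> power_span A n w \<Longrightarrow> inverse z \<in> power_span A m (inverse w) \<Longrightarrow> False"
proof (induction "n + m" arbitrary: n m rule: less_induct)
  case less
  have 0: "power_span A 0 v = A" for v
    using power_span_const by (auto elim!: power_spanE)
  have "n \<noteq> 0" "m \<noteq> 0" using less.prems ring_over_closed(8) 0 by metis+
  show False
  proof (cases "m \<le> n")
    case True
    have "inverse z \<in> power_span A (n - 1) w"
      using power_span_reduce[OF True _ less.prems(1-3)] \<open>m \<noteq> 0\<close> by simp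
    then show False using less.hyps[of "n - 1" m] less.prems \<open>n \<noteq> 0\<close> by simp
  next
    case False
    have "inverse z \<in> power_span A (m - 1) (inverse w)"
      using power_span_reduce[of n m "inverse w"] less.prems False \<open>n \<noteq> 0\<close> by simp
    then show False using less.hyps[of n "m - 1"] less.prems \<open>m \<noteq> 0\<close> by simp
  qed
qed

text \<open>The ring A[w] is strictly larger than \<open>A\<close>, so by maximality it can only
  fail the condition on \<open>inverse z\<close>.\<close>

lemma ring_over_adjoin:
  assumes maximal: "\<And>B. ring_over z B \<Longrightarrow> A \<subseteq> B \<Longrightarrow> B = A" and w: "w \<notin> A"
  shows "\<exists>n. inverse z \<in> power_span A n w"
proof (rule ccontr)
  assume no: "\<nexists>n. inverse z \<in> power_span A n w"
  let ?B = "\<Union>n. power_span A n w"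
  have AB: "A \<subseteq> ?B" using power_span_const by blast
  have "ring_over z ?B"
    unfolding ring_over_def
  proof (intro conjI allI ballI)
    fix f g assume "f \<in> ?B" "g \<in> ?B"
    then obtain n m where f: "f \<in> power_span A n w" and g: "g \<in> power_span A m w" by blast
    show "f * g \<in> ?B" using power_span_mult[OF f g] by blast
    have "f \<in> power_span A (n + m) w" "g \<in> power_span A (n + m) w"
      using f g power_span_mono[of n "n + m" w] power_span_mono[of m "n + m" w] by auto
    moreover have "- 1 \<in> A" using ring_over_closed(4)[OF ring_over_closed(2,3)] by simp
    ultimately have "f + (- 1) * g \<in> power_span A (n + m) w"
      by (intro power_span_add power_span_scale)
    then show "f - g \<in> ?B" by auto
  qed (use no AB ring_over_closed in blast)+
  then have "?B = A" using maximal AB by blast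
  moreover have "w \<in> ?B" using power_span_power[of 1 1 w] by auto
  ultimately show False using w by simp
qed

end

text \<open>A subring of \<open>F\<close> that is maximal among those containing \<open>K\<close> and \<open>z\<close> but not \<open>1/z\<close> is a
  valuation ring.\<close>

lemma ex_place_containing:
  assumes z: "z \<notin> range emb"
  obtains P where "P \<in> places" "z \<in> P"
proof -
  let ?S = "{A. ring_over z A}"
  have "range (\<lambda>p. pev p z) \<in> ?S"
    unfolding mem_Collect_eq ring_over_def
  proof (intro conjI allI ballI)
    show "emb c \<in> range (\<lambda>p. pev p z)" for c by (rule range_eqI[of _ _ "[:c:]"]) simp
    show "z \<in> range (\<lambda>p. pev p z)" by (rule range_eqI[of _ _ "[:0, 1:]"]) simp
    show "inverse z \<notin> range (\<lambda>p. pev p z)"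
    proof
      assume "inverse z \<in> range (\<lambda>p. pev p z)"
      then obtain p where p: "inverse z = pev p z" by blast
      have "z \<noteq> 0" using z hom_zero by (metis rangeI)
      \<comment> \<open>\<open>pCons 0 p - 1\<close> is X p(X) - 1, a nonzero polynomial because its
        constant coefficient is -1.\<close>
      then have "pev (pCons 0 p - 1) z = 0" using p by (simp flip: p)
      then have "pCons 0 p - 1 = 0" using pev_nonzero[OF z] by blast
      then have "coeff (pCons 0 p - 1) 0 = 0" by simp
      then show False by simp
    qed
    fix f g assume "f \<in> range (\<lambda>p. pev p z)" "g \<in> range (\<lambda>p. pev p z)"
    then obtain a b where ab: "f = pev a z" "g = pev b z" by blast
    show "f - g \<in> range (\<lambda>p. pev p z)" by (rule range_eqI[of _ _ "a - b"]) (simp add: ab)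
    show "f * g \<in> range (\<lambda>p. pev p z)" by (rule range_eqI[of _ _ "a * b"]) (simp add: ab)
  qed
  then have "?S \<noteq> {}" by blast
  moreover have "\<Union>C \<in> ?S" if C: "C \<noteq> {}" "subset.chain ?S C" for C
  proof -
    have CS: "\<And>A. A \<in> C \<Longrightarrow> ring_over z A" using C(2) by (auto simp: subset.chain_def)
    obtain A where A: "A \<in> C" using C(1) by blast
    have "ring_over z (\<Union>C)"
      unfolding ring_over_def
    proof (intro conjI allI ballI)
      show "emb c \<in> \<Union>C" for c using A CS ring_over_closed(1) by blast
      show "z \<in> \<Union>C" using A CS ring_over_closed(7) by blast
      show "inverse z \<notin> \<Union>C" using CS ring_over_closed(8) by blast
      fix f g assume "f \<in> \<Union>C" "g \<in> \<Union>C"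
      then obtain A B where AB: "A \<in> C" "B \<in> C" "f \<in> A" "g \<in> B" by blast
      then have "A \<subseteq> B \<or> B \<subseteq> A" using C(2) unfolding subset.chain_def by blast
      then obtain D where "D \<in> C" "f \<in> D" "g \<in> D" using AB by blast
      then show "f - g \<in> \<Union>C" "f * g \<in> \<Union>C"
        using CS ring_over_closed(4,6) by blast+
    qed
    then show ?thesis by simp
  qed
  ultimately have "\<exists>M\<in>?S. \<forall>B\<in>?S. M \<subseteq> B \<longrightarrow> B = M" by (rule subset_Zorn_nonempty)
  then obtain M where M: "ring_over z M" and maximal: "\<And>B. ring_over z B \<Longrightarrow> M \<subseteq> B \<Longrightarrow> B = M"
    by blast
  note cl = ring_over_closed[OF M]
  have "w \<in> M \<or> inverse w \<in> M" for w
  proof (rule ccontr)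
    assume w: "\<not> (w \<in> M \<or> inverse w \<in> M)"
    then have "w \<noteq> 0" using cl(2) by auto
    moreover obtain n where "inverse z \<in> power_span M n w"
      using ring_over_adjoin[OF M maximal, of w] w by blast
    moreover obtain m where "inverse z \<in> power_span M m (inverse w)"
      using ring_over_adjoin[OF M maximal, of "inverse w"] w by blast
    ultimately show False by (rule power_span_False[OF M])
  qed
  moreover have "subring M class_ring"
  proof (rule ring.subringI[OF class_ring.ring_axioms])
    show "\<ominus>\<^bsub>class_ring\<^esub> h \<in> M" if "h \<in> M" for h
      using cl(4)[OF cl(2) that] by (simp add: class_ring_simps)
  qed (use cl in auto)
  moreover have "range emb \<subset> M" using cl(1,7) z by blast
  moreover have "M \<subset> UNIV" using cl(8) by blast
  ultimately have "valuation_ring emb M" unfolding valuation_ring_def by blast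
  from place_of_valuation_ring[OF this] show thesis
    by (rule that) (use cl(7,8) in blast)
qed

end

section \<open>Weak approximation\<close>

context function_field_basis
begin

text \<open>A discrete valuation ring is a maximal proper subring. If \<open>w\<close> lies in the
  larger ring but has a pole at \<open>P\<close>, division by a high power of \<open>w\<close>
  brings any \<open>y\<close> into the smaller ring, and multiplying back puts \<open>y\<close> into
  the larger one, which would then be all of F.\<close>

lemma vring_subset_imp_eq:
  assumes P: "P \<in> places" and Q: "Q \<in> places" and sub: "vring P \<subseteq> vring Q"
  shows "P = Q"
proof (rule ccontr)
  assume "P \<noteq> Q"
  then have "vring P \<noteq> vring Q" using place_vring(2)[OF P] place_vring(2)[OF Q] by metis
  then obtain w where w: "w \<in> vring Q" "w \<notin> vring P" using sub by blast
  have w0: "w \<noteq> 0" using w vring_closed(1)[OF P] by auto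
  then have vw: "place_val P w < 0" using w vring_iff_val[OF P] by force
  have "y \<in> vring Q" for y
  proof (cases "y = 0")
    case False
    let ?k = "nat \<bar>place_val P y\<bar>"
    have "int ?k * place_val P w \<le> - int ?k" using vw mult_left_mono[of "place_val P w" "- 1" "int ?k"] by simp
    then have "int ?k * place_val P w \<le> place_val P y" by linarith
    then have "place_val P (y * inverse (w ^ ?k)) \<ge> 0"
      using place_val_mult[OF P False, of "inverse (w ^ ?k)"] place_val_inverse[OF P, of "w ^ ?k"]
        place_val_power[OF P w0, of ?k] w0 by simp
    then have "y * inverse (w ^ ?k) \<in> vring Q"
      using vring_iff_val[OF P, of "y * inverse (w ^ ?k)"] False w0 sub by auto
    moreover have "w ^ k \<in> vring Q" for k
      by (induction k) (use w(1) vring_closed(2,6)[OF Q] in auto)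
    ultimately have "y * inverse (w ^ ?k) * w ^ ?k \<in> vring Q" by (rule vring_closed(6)[OF Q])
    then show ?thesis using w0 by (simp add: mult.assoc)
  qed (use vring_closed(1)[OF Q] in simp)
  then show False using place_vring(1)[OF Q] by (auto simp: valuation_ring_def)
qed

lemma ex_separating_two:
  assumes P: "P \<in> places" and Q: "Q \<in> places" and "P \<noteq> Q"
  obtains y where "y \<noteq> 0" "place_val P y > 0" "place_val Q y < 0"
proof -
  obtain a where a: "a \<in> vring P" "a \<notin> vring Q" using vring_subset_imp_eq[OF P Q] assms(3) by blast
  obtain b where b: "b \<in> vring Q" "b \<notin> vring P" using vring_subset_imp_eq[OF Q P] assms(3) by blast
  have "a \<noteq> 0" "b \<noteq> 0" using a b vring_closed(1) P Q by auto
  then have "place_val P (a * inverse b) > 0" "place_val Q (a * inverse b) < 0"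
    using a b vring_iff_val[OF P, of a] vring_iff_val[OF Q, of a] vring_iff_val[OF P, of b]
      vring_iff_val[OF Q, of b] place_val_mult[OF P, of a "inverse b"]
      place_val_mult[OF Q, of a "inverse b"] place_val_inverse[OF P, of b] place_val_inverse[OF Q, of b]
    by auto
  with \<open>a \<noteq> 0\<close> \<open>b \<noteq> 0\<close> show thesis by (intro that[of "a * inverse b"]) simp_all
qed

lemma ex_separating:
  assumes "finite S" and P: "P \<in> places" and "S \<subseteq> places - {P}"
  shows "\<exists>z. z \<noteq> 0 \<and> place_val P z > 0 \<and> (\<forall>Q\<in>S. place_val Q z < 0)"
  using assms(1,3)
proof (induction S rule: finite_induct)
  case empty
  obtain t where "t \<noteq> 0" "place_val P t = 1" using ex_place_val_one[OF P] by blast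
  then show ?case by (intro exI[of _ t]) simp
next
  case (insert Q S)
  then have Q: "Q \<in> places" "Q \<noteq> P" and S: "S \<subseteq> places" by auto
  obtain z where z: "z \<noteq> 0" "place_val P z > 0" "\<And>R. R \<in> S \<Longrightarrow> place_val R z < 0"
    using insert by auto
  show ?case
  proof (cases "place_val Q z < 0")
    case True
    then show ?thesis using z by (intro exI[of _ z]) auto
  next
    case False
    obtain y where y: "y \<noteq> 0" "place_val P y > 0" "place_val Q y < 0"
      using ex_separating_two[OF P Q(1) Q(2)[symmetric]] by blast
    \<comment> \<open>At R in S, either \<open>y\<close> has valuation 0 while \<open>z\<close> has
      a pole, or the valuation of y^r exceeds that of \<open>z\<close> in absolute value. The two
      summands of y^r + z thus never have equal valuations on S, and nothing cancels.\<close>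
    define r where "r = nat (1 + (\<Sum>R\<in>S. \<bar>place_val R z\<bar>))"
    have r: "int r \<ge> 1 + \<bar>place_val R z\<bar>" if "R \<in> S" for R
      using member_le_sum[OF that, of "\<lambda>R. \<bar>place_val R z\<bar>"] insert(1) unfolding r_def by simp
    have "(\<Sum>R\<in>S. \<bar>place_val R z\<bar>) \<ge> 0" by (rule sum_nonneg) simp
    then have r1: "r \<ge> 1" unfolding r_def by linarith
    have yr: "y ^ r \<noteq> 0" using y by simp
    have valr: "place_val R (y ^ r) = int r * place_val R y" if "R \<in> places" for R
      using place_val_power[OF that y(1)] by simp
    have Qr: "place_val Q (y ^ r) < 0" using valr[OF Q(1)] y(3) r1 by (simp add: mult_pos_neg)
    have atQ: "y ^ r + z \<noteq> 0" "place_val Q (y ^ r + z) < 0"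
      using place_val_add_eq[OF Q(1) yr, of z 0] Qr False z(1) by (auto simp: vge_def)
    moreover have "place_val P (y ^ r + z) > 0"
    proof -
      have "place_val P (y ^ r) > 0" using valr[OF P] y(2) r1 by simp
      then have "vge P (y ^ r + z) 1" using z by (intro vge_add[OF P]) (auto simp: vge_def)
      then show ?thesis using atQ(1) by (simp add: vge_def)
    qed
    moreover have "place_val R (y ^ r + z) < 0" if R: "R \<in> S" for R
    proof -
      have Rp: "R \<in> places" using R S by blast
      have "place_val R y = 0 \<or> \<bar>place_val R z\<bar> < \<bar>int r * place_val R y\<bar>"
      proof (cases "place_val R y = 0")
        case False
        then have "int r * 1 \<le> int r * \<bar>place_val R y\<bar>" by (intro mult_left_mono) auto
        then show ?thesis using r[OF R] by (simp add: abs_mult)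
      qed simp
      then consider "place_val R (y ^ r) < place_val R z" | "place_val R z < place_val R (y ^ r)"
        using valr[OF Rp] z(3)[OF R] by force
      then show ?thesis
      proof cases
        case 1
        then show ?thesis
          using place_val_add_eq(2)[OF Rp yr, of z "place_val R z"] z(3)[OF R] by (simp add: vge_def)
      next
        case 2
        then show ?thesis
          using place_val_add_eq(2)[OF Rp z(1), of "y ^ r" "place_val R (y ^ r)"] z(3)[OF R]
          by (simp add: vge_def add.commute)
      qed
    qed
    ultimately have "y ^ r + z \<noteq> 0 \<and> place_val P (y ^ r + z) > 0 \<and>
        (\<forall>R\<in>insert Q S. place_val R (y ^ r + z) < 0)"
      by blast
    then show ?thesis by (rule exI)
  qed
qed

text \<open>With \<open>z\<close> vanishing at \<open>P\<close> and having poles on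
  \<open>S\<close>, the element 1/(1 + z^k) is close to 1 at \<open>P\<close> and close to 0 on
  \<open>S\<close>.\<close>

lemma ex_approx_one:
  assumes "finite S" and P: "P \<in> places" and "S \<subseteq> places - {P}"
  obtains e where "vge P (e - 1) N" "\<And>Q. Q \<in> S \<Longrightarrow> vge Q e N"
proof -
  obtain z where z: "z \<noteq> 0" "place_val P z > 0" "\<And>Q. Q \<in> S \<Longrightarrow> place_val Q z < 0"
    using ex_separating[OF assms] by blast
  define k where "k = Suc (nat N)"
  have k: "int k \<ge> N" "int k \<ge> 1" unfolding k_def by auto
  have zk: "z ^ k \<noteq> 0" using z by simp
  have Pk: "place_val P (z ^ k) \<ge> int k" 
    using place_val_power[OF P z(1), of k] z(2) mult_left_mono[of 1 "place_val P z" "int k"] by simp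
  have P1: "1 + z ^ k \<noteq> 0" "place_val P (1 + z ^ k) = 0"
    using place_val_add_eq[OF P, of 1 "z ^ k" 1] place_val_one[OF P] Pk k by (auto simp: vge_def)
  define e where "e = inverse (1 + z ^ k)"
  have "e - 1 = (- (z ^ k)) * e" unfolding e_def using P1(1) by (simp add: field_simps)
  moreover have "vge P (- (z ^ k)) N" using vge_diff[OF P vge_zero, of "z ^ k" N] Pk k by (simp add: vge_def)
  moreover have "vge P e 0" using place_val_inverse[OF P P1(1)] P1(2) unfolding e_def vge_def by simp
  ultimately have "vge P (e - 1) N" using vge_mult[OF P, of "- (z ^ k)" N e 0] by simp
  moreover have "vge Q e N" if Q: "Q \<in> S" for Q
  proof -
    have Qp: "Q \<in> places" using Q assms(3) by blast
    have Qk: "place_val Q (z ^ k) \<le> - int k"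
      using place_val_power[OF Qp z(1), of k] z(3)[OF Q] mult_left_mono[of "place_val Q z" "- 1" "int k"] by simp
    have "place_val Q (z ^ k + 1) = place_val Q (z ^ k)"
      using place_val_add_eq(2)[OF Qp zk, of 1 0] place_val_one[OF Qp] Qk k by (simp add: vge_def)
    then have "place_val Q e \<ge> int k"
      using place_val_inverse[OF Qp P1(1)] Qk unfolding e_def by (simp add: add.commute)
    then show ?thesis using k by (simp add: vge_def)
  qed
  ultimately show thesis by (rule that)
qed

text \<open>Take w e with e close to 1 at \<open>P\<close> and to 0 on \<open>S\<close>;
  \<open>N\<close> absorbs the valuations of \<open>w\<close>. Prescribing a value at a single place
  suffices, because divisors will be changed one place at a time.\<close>

lemma ex_approx:
  assumes "finite S" and P: "P \<in> places" and "S \<subseteq> places - {P}"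
  obtains f where "vge P (f - w) m" "\<And>Q. Q \<in> S \<Longrightarrow> vge Q f (b Q)"
proof (cases "w = 0")
  case True
  then show thesis using that[of 0] by simp
next
  case False
  define N where "N = \<bar>m - place_val P w\<bar> + (\<Sum>Q\<in>S. \<bar>b Q - place_val Q w\<bar>)"
  have NP: "N \<ge> m - place_val P w" unfolding N_def
    by (rule order_trans[OF abs_ge_self]) (simp add: sum_nonneg)
  have NQ: "N \<ge> b Q - place_val Q w" if "Q \<in> S" for Q
    unfolding N_def using member_le_sum[OF that, of "\<lambda>Q. \<bar>b Q - place_val Q w\<bar>"] assms(1) by simp
  obtain e where e: "vge P (e - 1) N" "\<And>Q. Q \<in> S \<Longrightarrow> vge Q e N"
    using ex_approx_one[OF assms, where N = N] by blast
  show thesis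
  proof (rule that)
    have "vge P (w * (e - 1)) m"
      unfolding vge_mult_iff[OF P False] by (rule vge_mono[OF e(1) NP])
    then show "vge P (w * e - w) m" by (simp add: algebra_simps)
    fix Q assume Q: "Q \<in> S"
    then have "Q \<in> places" using assms(3) by blast
    then show "vge Q (w * e) (b Q)"
      unfolding vge_mult_iff[OF \<open>Q \<in> places\<close> False] by (intro vge_mono[OF e(2)[OF Q] NQ[OF Q]])
  qed
qed

end

section \<open>Dimensions as logarithms of cardinalities\<close>

text \<open>Coordinates with respect to a basis give a bijection with functions from the basis to
  the scalars. Finiteness is assumed first, since \<open>dim\<close> is meaningful only in finite
  dimension.\<close>

lemma card_vectorspace:
  fixes V :: "('q :: {field, finite}, 'v) module"
  assumes vs: "vectorspace class_ring V" and fin: "finite (carrier V)"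
  shows "card (carrier V) = card (UNIV :: 'q set) ^ vectorspace.dim class_ring V"
proof -
  interpret V: vectorspace "class_ring :: 'q ring" V by (rule vs)
  have "V.span (carrier V) = carrier V"
    using V.in_own_span[of "carrier V"] V.span_is_subset2[of "carrier V"] by blast
  then have "V.fin_dim" unfolding V.fin_dim_def using fin by blast
  then obtain \<beta> where \<beta>: "finite \<beta>" "V.basis \<beta>" using V.finite_basis_exists by blast
  have \<beta>V: "\<beta> \<subseteq> carrier V" using \<beta>(2) unfolding V.basis_def by blast
  have dim: "V.dim = card \<beta>" by (rule V.dim_basis[OF \<beta>])
  have ex1: "\<exists>!a. a \<in> \<beta> \<rightarrow>\<^sub>E UNIV \<and> V.lincomb a \<beta> = v" if "v \<in> carrier V" for v
    using V.basis_criterion[OF \<beta>(1) \<beta>V] \<beta>(2) that by simp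
  have "bij_betw (\<lambda>a. V.lincomb a \<beta>) (\<beta> \<rightarrow>\<^sub>E UNIV) (carrier V)"
    unfolding bij_betw_def
  proof
    have cl: "V.lincomb a \<beta> \<in> carrier V" for a by (rule V.lincomb_closed[OF \<beta>V]) simp
    show "inj_on (\<lambda>a. V.lincomb a \<beta>) (\<beta> \<rightarrow>\<^sub>E UNIV)"
    proof (rule inj_onI)
      fix a b assume ab: "a \<in> \<beta> \<rightarrow>\<^sub>E UNIV" "b \<in> \<beta> \<rightarrow>\<^sub>E UNIV" "V.lincomb a \<beta> = V.lincomb b \<beta>"
      show "a = b" by (rule ex1E[OF ex1[OF cl[of a]]]) (use ab in metis)
    qed
    show "(\<lambda>a. V.lincomb a \<beta>) ` (\<beta> \<rightarrow>\<^sub>E UNIV) = carrier V"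
    proof
      show "carrier V \<subseteq> (\<lambda>a. V.lincomb a \<beta>) ` (\<beta> \<rightarrow>\<^sub>E UNIV)"
      proof
        fix v assume "v \<in> carrier V"
        from ex1_implies_ex[OF ex1[OF this]]
        show "v \<in> (\<lambda>a. V.lincomb a \<beta>) ` (\<beta> \<rightarrow>\<^sub>E UNIV)" by (auto intro: rev_image_eqI)
      qed
      show "(\<lambda>a. V.lincomb a \<beta>) ` (\<beta> \<rightarrow>\<^sub>E UNIV) \<subseteq> carrier V"
        using cl by (rule image_subsetI)
    qed
  qed
  then have "card (carrier V) = card (\<beta> \<rightarrow>\<^sub>E (UNIV :: 'q set))" by (rule bij_betw_same_card[symmetric])
  then show ?thesis unfolding dim using \<beta>(1) by (simp add: card_PiE)
qed

context function_field
begin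

lemma vectorspace_field_space:
  assumes "add_subgroup W" "\<And>c w. w \<in> W \<Longrightarrow> emb c * w \<in> W"
  shows "vectorspace class_ring ((field_space emb)\<lparr>carrier := W\<rparr>)"
proof (rule vectorspace.intro)
  show "module class_ring ((field_space emb)\<lparr>carrier := W\<rparr>)"
  proof (rule moduleI)
    show "abelian_group ((field_space emb)\<lparr>carrier := W\<rparr>)"
    proof (rule abelian_groupI)
      fix y assume "y \<in> carrier ((field_space emb)\<lparr>carrier := W\<rparr>)"
      then show "\<exists>z\<in>carrier ((field_space emb)\<lparr>carrier := W\<rparr>).
          z \<oplus>\<^bsub>(field_space emb)\<lparr>carrier := W\<rparr>\<^esub> y = \<zero>\<^bsub>(field_space emb)\<lparr>carrier := W\<rparr>\<^esub>"
        using add_subgroup_minus[OF assms(1), of y]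
        by (intro bexI[of _ "- y"]) (auto simp: field_space_def)
    qed (use assms(1) in \<open>auto simp: field_space_def add_subgroup_zero algebra_simps intro: add_subgroup_add\<close>)
  qed (use assms(2) in \<open>auto simp: field_space_def hom_distribs algebra_simps fieldE(1)[OF class_field]\<close>)
qed (rule class_field)

lemma residue_eq_coset: "residue P f = coset P f"
proof -
  have "residue P f = {p + f | p. p \<in> P}"
    by (auto simp: residue_def place_ring_def a_r_coset_def r_coset_def)
  also have "\<dots> = coset P f"
    unfolding coset_def by (auto intro!: exI[of _ "_ - f"])
  finally show ?thesis .
qed

lemma carrier_residue_field: "carrier (residue_field P) = coset P ` vring P"
  unfolding residue_eq_coset[symmetric]
  by (auto simp: residue_field_def FactRing_def A_RCOSETS_def RCOSETS_def residue_def
      a_r_coset_def carrier_place_ring)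

lemma ideal_place:
  assumes P: "P \<in> places" shows "ideal P (place_ring P)"
proof -
  have "place_ring P = class_ring\<lparr>carrier := vring P\<rparr>" by (simp add: place_ring_def vring_def)
  moreover have "maximalideal P (class_ring\<lparr>carrier := vring P\<rparr>)"
    using maximalideal_nonunits[OF place_vring(1)[OF P]] place_vring(2)[OF P] by simp
  ultimately show ?thesis using maximalideal.axioms(1) by metis
qed

lemma residue_field_ops:
  assumes P: "P \<in> places" and "f \<in> vring P" "h \<in> vring P"
  shows "coset P f \<oplus>\<^bsub>residue_field P\<^esub> coset P h = coset P (f + h)"
    "coset P f \<otimes>\<^bsub>residue_field P\<^esub> coset P h = coset P (f * h)"
proof -
  interpret I: ideal P "place_ring P" by (rule ideal_place[OF P])
  have ops: "f \<oplus>\<^bsub>place_ring P\<^esub> h = f + h" "f \<otimes>\<^bsub>place_ring P\<^esub> h = f * h"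
    by (simp_all add: place_ring_def)
  show "coset P f \<oplus>\<^bsub>residue_field P\<^esub> coset P h = coset P (f + h)"
    using I.a_rcos_sum[of f h] assms(2,3) unfolding residue_eq_coset[symmetric] residue_def ops
    by (simp add: residue_field_def FactRing_def carrier_place_ring)
  show "coset P f \<otimes>\<^bsub>residue_field P\<^esub> coset P h = coset P (f * h)"
    using I.rcoset_mult_add[of f h] assms(2,3) unfolding residue_eq_coset[symmetric] residue_def ops
    by (simp add: residue_field_def FactRing_def carrier_place_ring)
qed

lemma zero_residue_field: "\<zero>\<^bsub>residue_field P\<^esub> = coset P 0"
  by (simp add: residue_field_def FactRing_def coset_def)

lemma add_subgroup_place: 
  assumes P: "P \<in> places" shows "add_subgroup P"
proof -
  interpret I: ideal P "place_ring P" by (rule ideal_place[OF P])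
  have "0 \<in> P" using place_mem_iff[OF P, of 0] vring_closed(1)[OF P] by simp
  moreover have "a - b \<in> P" if "a \<in> P" "b \<in> P" for a b
  proof -
    have "- 1 \<in> vring P" using vring_closed(5)[OF P vring_closed(1,2)[OF P]] by simp
    then have "(- 1) * b \<in> P"
      using I.I_l_closed[OF that(2), of "- 1"] unfolding carrier_place_ring by (simp add: place_ring_def)
    then show ?thesis using additive_subgroup.a_closed[OF ideal.axioms(1)[OF ideal_place[OF P]] that(1), of "(- 1) * b"] by (simp add: place_ring_def)
  qed
  ultimately show ?thesis by (simp add: add_subgroup_def)
qed

lemma residue_space_ops:
  assumes P: "P \<in> places"
  shows "carrier (residue_space emb P) = coset P ` vring P"
    "\<zero>\<^bsub>residue_space emb P\<^esub> = coset P 0"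
    "f \<in> vring P \<Longrightarrow> h \<in> vring P \<Longrightarrow> coset P f \<oplus>\<^bsub>residue_space emb P\<^esub> coset P h = coset P (f + h)"
    "f \<in> vring P \<Longrightarrow> c \<odot>\<^bsub>residue_space emb P\<^esub> coset P f = coset P (emb c * f)"
  using residue_field_ops[OF P] vring_closed(3)[OF P]
  by (simp_all add: residue_space_def carrier_residue_field residue_eq_coset zero_residue_field)

lemma vectorspace_residue_space:
  assumes P: "P \<in> places" shows "vectorspace class_ring (residue_space emb P)"
proof (rule vectorspace.intro)
  note ops = residue_space_ops[OF P] and cl = vring_closed[OF P]
  have "abelian_group (residue_space emb P)"
  proof (rule abelian_groupI)
    fix y assume "y \<in> carrier (residue_space emb P)"
    then obtain f where f: "f \<in> vring P" "y = coset P f" unfolding ops by blast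
    have "0 - f \<in> vring P" using cl(5)[OF cl(1) f(1)] .
    then have "coset P (0 - f) \<oplus>\<^bsub>residue_space emb P\<^esub> y = \<zero>\<^bsub>residue_space emb P\<^esub>"
      unfolding f(2) using ops(2,3) f(1) by simp
    then show "\<exists>z\<in>carrier (residue_space emb P). z \<oplus>\<^bsub>residue_space emb P\<^esub> y = \<zero>\<^bsub>residue_space emb P\<^esub>"
      using \<open>0 - f \<in> vring P\<close> unfolding ops(1) by blast
  qed (auto simp: ops cl algebra_simps)
  then show "module class_ring (residue_space emb P)"
    by (rule moduleI[OF fieldE(1)[OF class_field]])
       (auto simp: ops cl hom_distribs algebra_simps)
qed (rule class_field)

end

context function_field_basis
begin

text \<open>As P = t O, the digit bound makes the residue field finite; this is what gives
  \<open>place_degree\<close> its meaning. The degree is positive because 1 is not in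
  \<open>P\<close>.\<close>

lemma idx_place:
  assumes P: "P \<in> places"
  shows "idx P (vring P) = q ^ place_degree emb P" "place_degree emb P > 0"
proof -
  obtain t where t: "t \<noteq> 0" "P = (*) t ` vring P" using ex_uniformizer[OF P] by blast
  have "idx P (vring P) \<noteq> 0"
    using idx_vring_mult[OF P uniformizer_not_unit(2)[OF P t] t(1)] t(2) by simp
  then have "finite (carrier (residue_space emb P))"
    unfolding residue_space_ops(1)[OF P] by (rule finite_cosets)
  from card_vectorspace[OF vectorspace_residue_space[OF P] this]
  show *: "idx P (vring P) = q ^ place_degree emb P"
    by (simp add: residue_space_ops(1)[OF P] idx_def place_degree_def q_eq)
  have "P \<subseteq> vring P" "1 \<in> vring P" "1 \<notin> P" using place_mem_iff[OF P] vring_closed(2)[OF P] by auto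
  then have "idx P (vring P) \<noteq> 1"
    using idx_eq_one_imp[OF add_subgroup_place[OF P] add_subgroup_vring[OF P]] by metis
  then show "place_degree emb P > 0" using * by (cases "place_degree emb P") auto
qed

section \<open>Spaces of functions with bounded poles\<close>

definition LS :: "'f set set \<Rightarrow> ('f set \<Rightarrow> int) \<Rightarrow> 'f set" where
  "LS S A = {f. \<forall>P\<in>S. vge P f (- A P)}"

text \<open>The value 0 off the places gives finite support; \<open>place_val\<close> is not
  controlled there.\<close>

definition divisor_of :: "'f \<Rightarrow> 'f set \<Rightarrow> int" where
  "divisor_of y P = (if P \<in> places then place_val P y else 0)"

lemma add_subgroup_LS: "S \<subseteq> places \<Longrightarrow> add_subgroup (LS S A)"
  unfolding add_subgroup_def LS_def by (auto intro: vge_diff)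

lemma LS_scale: "S \<subseteq> places \<Longrightarrow> f \<in> LS S A \<Longrightarrow> emb c * f \<in> LS S A"
  unfolding LS_def using vge_mult[OF _ vge_emb] by fastforce

lemma LS_mono: "(\<And>P. P \<in> S \<Longrightarrow> A P \<le> B P) \<Longrightarrow> LS S A \<subseteq> LS S B"
  unfolding LS_def by (auto intro: vge_mono)

lemma LS_cong: "(\<And>P. P \<in> S \<Longrightarrow> A P = B P) \<Longrightarrow> LS S A = LS S B"
  unfolding LS_def by auto

lemma LS_mult:
  assumes S: "S \<subseteq> places" and y: "y \<noteq> 0"
  shows "(*) y ` LS S A = LS S (\<lambda>P. A P - divisor_of y P)"
proof -
  have iff: "y * f \<in> LS S (\<lambda>P. A P - divisor_of y P) \<longleftrightarrow> f \<in> LS S A" for f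
  proof -
    have "vge P (y * f) (- (A P - divisor_of y P)) \<longleftrightarrow> vge P f (- A P)" if "P \<in> S" for P
      using vge_mult_iff[of P y f] S y that by (auto simp: divisor_of_def)
    then show ?thesis by (simp add: LS_def)
  qed
  have "f \<in> (*) y ` LS S A" if "f \<in> LS S (\<lambda>P. A P - divisor_of y P)" for f
  proof -
    have "y * (f / y) \<in> LS S (\<lambda>P. A P - divisor_of y P)" using that y by simp
    then have "f / y \<in> LS S A" by (simp only: iff)
    then show ?thesis using y by (intro image_eqI[of _ _ "f / y"]) simp_all
  qed
  then show ?thesis using iff by blast
qed

text \<open>Multiplication by an element \<open>s\<close> of valuation \<open>B P\<close> carries
  \<open>LS S B\<close> into the valuation ring and exactly the elements of \<open>LS S A\<close>
  into \<open>P\<close>. Surjectivity onto the residue field is weak approximation.\<close>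

lemma idx_LS_step:
  assumes S: "finite S" "S \<subseteq> places" and P: "P \<in> S" and AB: "\<And>Q. Q \<in> S \<Longrightarrow> Q \<noteq> P \<Longrightarrow> A Q = B Q"
    and BP: "B P = A P + 1"
  shows "idx (LS S A) (LS S B) = q ^ place_degree emb P"
proof -
  have Pp: "P \<in> places" using P S by blast
  obtain t where t: "t \<noteq> 0" "place_val P t = 1" using ex_place_val_one[OF Pp] by blast
  obtain s where s: "s \<noteq> 0" "place_val P s = B P"
  proof (cases "B P \<ge> 0")
    case True
    then show ?thesis using that[of "t ^ nat (B P)"] place_val_power[OF Pp t(1)] t by simp
  next
    case False
    then show ?thesis
      using that[of "inverse (t ^ nat (- B P))"] place_val_power[OF Pp t(1)] t
        place_val_inverse[OF Pp, of "t ^ nat (- B P)"] by simp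
  qed
  have sO: "vge P (s * f) m \<longleftrightarrow> vge P f (m - B P)" for f m
    using vge_mult_iff[OF Pp s(1)] s(2) by simp
  have "idx (LS S A) (LS S B) = idx P (vring P)"
  proof (rule idx_eq_of_map[where f = "(*) s"])
    show "(*) s ` LS S B \<subseteq> vring P"
      using P by (auto simp: LS_def vge_zero_iff[OF Pp, symmetric] sO)
    fix f h assume fh: "f \<in> LS S B" "h \<in> LS S B"
    then have d: "f - h \<in> LS S B" by (rule add_subgroup_diff[OF add_subgroup_LS[OF S(2)]])
    have "f - h \<in> LS S A \<longleftrightarrow> vge P (f - h) (1 - B P)"
    proof
      assume "f - h \<in> LS S A"
      then show "vge P (f - h) (1 - B P)" using P BP by (auto simp: LS_def)
    next
      assume *: "vge P (f - h) (1 - B P)"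
      have "vge Q (f - h) (- A Q)" if "Q \<in> S" for Q
        using * BP d AB[OF that] that by (cases "Q = P") (auto simp: LS_def)
      then show "f - h \<in> LS S A" by (simp add: LS_def)
    qed
    then show "s * f - s * h \<in> P \<longleftrightarrow> f - h \<in> LS S A"
      by (simp add: vge_one_iff[OF Pp, symmetric] right_diff_distrib[symmetric] sO)
  next
    fix y assume y: "y \<in> vring P"
    obtain f where f: "vge P (f - inverse s * y) (1 - B P)" "\<And>Q. Q \<in> S - {P} \<Longrightarrow> vge Q f (- B Q)"
      using ex_approx[of "S - {P}" P "inverse s * y" "1 - B P" "\<lambda>Q. - B Q"] S Pp by blast
    have yv: "vge P (inverse s * y) (- B P)"
      using sO[of "inverse s * y" 0] s(1) y vge_zero_iff[OF Pp] by (simp add: mult.assoc[symmetric])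
    have fP: "vge P (inverse s * y + (f - inverse s * y)) (- B P)"
      by (rule vge_add[OF Pp yv vge_mono[OF f(1)]]) simp
    have "f \<in> LS S B" unfolding LS_def
    proof (intro CollectI ballI)
      fix Q assume "Q \<in> S"
      then show "vge Q f (- B Q)" using f(2)[of Q] fP by (cases "Q = P") simp_all
    qed
    moreover have "y - s * f \<in> P"
    proof -
      have "vge P (s * (f - inverse s * y)) 1" unfolding sO by (rule f(1))
      then have "s * (f - inverse s * y) \<in> P" by (simp only: vge_one_iff[OF Pp])
      moreover have "s * (f - inverse s * y) = s * f - y" using s(1) by (simp add: algebra_simps)
      ultimately show ?thesis
        using add_subgroup_minus[OF add_subgroup_place[OF Pp], of "s * f - y"] by simp
    qed
    ultimately show "\<exists>f\<in>LS S B. y - s * f \<in> P" by blast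
  qed (intro add_subgroup_LS S add_subgroup_place Pp)+
  then show ?thesis using idx_place(1)[OF Pp] by simp
qed

lemma idx_LS:
  assumes S: "finite S" "S \<subseteq> places"
  shows "(\<And>P. P \<in> S \<Longrightarrow> A P \<le> B P) \<Longrightarrow>
    idx (LS S A) (LS S B) = q ^ (\<Sum>P\<in>S. nat (B P - A P) * place_degree emb P)"
proof (induction "\<Sum>P\<in>S. nat (B P - A P)" arbitrary: B)
  case 0
  then have eq: "B P = A P" if "P \<in> S" for P
    using S that by force
  then have "LS S B = LS S A" by (rule LS_cong)
  then show ?case using eq by (simp add: idx_refl add_subgroup_LS[OF S(2)])
next
  case (Suc m)
  have "\<exists>P\<in>S. A P < B P"
  proof (rule ccontr)
    assume "\<not> (\<exists>P\<in>S. A P < B P)"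
    then have "nat (B P - A P) = 0" if "P \<in> S" for P using that by force
    then have "(\<Sum>P\<in>S. nat (B P - A P)) = 0" by (simp only: sum.neutral_const cong: sum.cong)
    with Suc.hyps(2) show False by simp
  qed
  then obtain P where P: "P \<in> S" "A P < B P" by blast
  define C where "C = B(P := B P - 1)"
  \<comment> \<open>The weight \<open>w\<close> is 1 for the induction measure and the degree of the
    place for the exponent.\<close>
  have split: "(\<Sum>R\<in>S. nat (B R - A R) * w R) = (\<Sum>R\<in>S. nat (C R - A R) * w R) + w P" for w :: "_ \<Rightarrow> nat"
  proof -
    have "(\<Sum>R\<in>S - {P}. nat (B R - A R) * w R) = (\<Sum>R\<in>S - {P}. nat (C R - A R) * w R)"
      by (rule sum.cong) (auto simp: C_def)
    moreover have "nat (B P - A P) = Suc (nat (C P - A P))" using P by (simp add: C_def)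
    ultimately show ?thesis using S(1) P(1) by (simp add: sum.remove)
  qed
  have AC: "A R \<le> C R" if "R \<in> S" for R using Suc.prems[OF that] P by (auto simp: C_def)
  have "m = (\<Sum>R\<in>S. nat (C R - A R))" using Suc.hyps(2) split[of "\<lambda>_. 1"] by simp
  from Suc.hyps(1)[OF this AC]
  have IH: "idx (LS S A) (LS S C) = q ^ (\<Sum>R\<in>S. nat (C R - A R) * place_degree emb R)" .
  have "idx (LS S A) (LS S B) = idx (LS S A) (LS S C) * idx (LS S C) (LS S B)"
    by (intro idx_trans add_subgroup_LS S LS_mono AC) (auto simp: C_def)
  also have "idx (LS S C) (LS S B) = q ^ place_degree emb P"
    by (rule idx_LS_step[OF S P(1)]) (auto simp: C_def)
  finally show ?case by (simp only: IH split[of "place_degree emb"] power_add)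
qed

text \<open>For \<open>T\<close> the functions regular on \<open>S\<close>, the index of y T in T is
  q to the degree of the zeros of \<open>y\<close> in \<open>S\<close>, and the digit bound limits
  it uniformly in \<open>S\<close>.\<close>

lemma degree_zeros_le:
  assumes "degree_shift Q d" "degree_shift (Q * y) d" "Q \<noteq> 0" "y \<noteq> 0"
    and S: "finite S" "S \<subseteq> places" "\<And>P. P \<in> S \<Longrightarrow> place_val P y \<ge> 0"
  shows "(\<Sum>P\<in>S. nat (place_val P y) * place_degree emb P) \<le> card U * d"
proof -
  let ?T = "LS S (\<lambda>_. 0)"
  have img: "(*) y ` ?T = LS S (\<lambda>P. - place_val P y)"
    unfolding LS_mult[OF S(2) assms(4)] using S(2) by (intro LS_cong) (auto simp: divisor_of_def)
  have "(*) y ` ?T \<subseteq> ?T" unfolding img using S(3) by (intro LS_mono) auto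
  then have "idx ((*) y ` ?T) ?T \<le> q ^ (card U * d)"
    using idx_mult_le[OF assms(1-4) add_subgroup_LS[OF S(2)]] by blast
  moreover have "idx ((*) y ` ?T) ?T = q ^ (\<Sum>P\<in>S. nat (place_val P y) * place_degree emb P)"
    unfolding img using idx_LS[OF S(1,2), of "\<lambda>P. - place_val P y" "\<lambda>_. 0"] S(3) by simp
  ultimately show ?thesis using q_gt_1 by (simp add: power_increasing_iff)
qed

lemma finite_zeros:
  assumes "y \<noteq> 0" shows "finite {P \<in> places. place_val P y > 0}" (is "finite ?Z")
proof (rule ccontr)
  assume inf: "infinite ?Z"
  obtain Q d where Q: "Q \<noteq> 0" "degree_shift Q d" "degree_shift (Q * y) d"
    using ex_degree_shift by blast
  obtain S where S: "S \<subseteq> ?Z" "finite S" "card S = Suc (card U * d)"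
    using infinite_arbitrarily_large[OF inf] by blast
  have "card S = (\<Sum>P\<in>S. 1)" by simp
  also have "\<dots> \<le> (\<Sum>P\<in>S. nat (place_val P y) * place_degree emb P)"
  proof (rule sum_mono)
    fix P assume "P \<in> S"
    then have "nat (place_val P y) \<noteq> 0" "place_degree emb P \<noteq> 0"
      using S(1) idx_place(2)[of P] by auto
    then show "1 \<le> nat (place_val P y) * place_degree emb P" by (simp add: Suc_le_eq)
  qed
  also have "\<dots> \<le> card U * d" using S by (intro degree_zeros_le[OF Q(2,3,1) assms]) auto
  finally show False using S(3) by simp
qed

lemma finite_support:
  assumes "y \<noteq> 0" shows "finite {P \<in> places. place_val P y \<noteq> 0}"
proof -
  have "{P \<in> places. place_val P y \<noteq> 0} \<subseteq>
      {P \<in> places. place_val P y > 0} \<union> {P \<in> places. place_val P (inverse y) > 0}"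
    using place_val_inverse[OF _ assms] by auto
  moreover have "finite \<dots>" using finite_zeros[of y] finite_zeros[of "inverse y"] assms by simp
  ultimately show ?thesis by (rule finite_subset)
qed

end

section \<open>Divisors and Riemann's inequality\<close>

lemma idx_nonzero_of_map:
  assumes "add_subgroup A" "add_subgroup A'" "f ` B \<subseteq> B'" "idx A' B' \<noteq> 0" "B \<noteq> {}"
    and "\<And>x y. x \<in> B \<Longrightarrow> y \<in> B \<Longrightarrow> f x - f y \<in> A' \<longleftrightarrow> x - y \<in> A"
  shows "idx A B \<noteq> 0"
proof -
  have "idx A' (f ` B) \<noteq> 0"
    by (rule idx_nonzero_subset[OF assms(3,4)]) (use assms(5) in simp)
  then show ?thesis using idx_image[OF assms(1,2), of B f] assms(6) by (simp add: idx_def)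
qed

context function_field_basis
begin

text \<open>Plain functions allow sums, multiples and absolute values of divisors to be written
  pointwise; \<open>Poly_Mapping.lookup\<close> connects them with the given divisors.\<close>

definition divisor :: "('f set \<Rightarrow> int) \<Rightarrow> bool" where
  "divisor A \<longleftrightarrow> finite {P. A P \<noteq> 0} \<and> {P. A P \<noteq> 0} \<subseteq> places"

definition deg :: "('f set \<Rightarrow> int) \<Rightarrow> int" where
  "deg A = (\<Sum>P | A P \<noteq> 0. A P * int (place_degree emb P))"

definition RR :: "('f set \<Rightarrow> int) \<Rightarrow> 'f set" where
  "RR A = LS places A"

definition ell :: "('f set \<Rightarrow> int) \<Rightarrow> nat" where
  "ell A = vectorspace.dim class_ring ((field_space emb)\<lparr>carrier := RR A\<rparr>)"

text \<open>\<open>chi A + 1\<close> is the quantity maximised in \<open>genus\<close>, so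
  \<open>genus emb - 1 - chi A\<close> is the index of speciality i(A).\<close>

definition chi :: "('f set \<Rightarrow> int) \<Rightarrow> int" where
  "chi A = deg A - int (ell A)"

lemma divisorI: "finite S \<Longrightarrow> S \<subseteq> places \<Longrightarrow> (\<And>P. P \<notin> S \<Longrightarrow> A P = 0) \<Longrightarrow> divisor A"
  unfolding divisor_def by (auto intro: finite_subset[of _ S])

lemma divisorD: "divisor A \<Longrightarrow> finite {P. A P \<noteq> 0}" "divisor A \<Longrightarrow> {P. A P \<noteq> 0} \<subseteq> places"
  by (simp_all add: divisor_def)

lemma deg_eq_sum:
  assumes "finite S" "\<And>P. P \<notin> S \<Longrightarrow> A P = 0"
  shows "deg A = (\<Sum>P\<in>S. A P * int (place_degree emb P))"
  unfolding deg_def by (rule sum.mono_neutral_left) (use assms in auto)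

lemma divisor_combine:
  assumes "divisor A" "divisor B" "f 0 0 = 0" shows "divisor (\<lambda>P. f (A P) (B P))"
  by (rule divisorI[of "{P. A P \<noteq> 0} \<union> {P. B P \<noteq> 0}"]) (use assms divisorD in auto)

lemma divisor_map:
  assumes "divisor A" "f 0 = 0" shows "divisor (\<lambda>P. f (A P))"
  by (rule divisorI[of "{P. A P \<noteq> 0}"]) (use assms divisorD in auto)

lemma deg_add:
  assumes "divisor A" "divisor B" shows "deg (\<lambda>P. A P + B P) = deg A + deg B"
proof -
  let ?S = "{P. A P \<noteq> 0} \<union> {P. B P \<noteq> 0}"
  have S: "finite ?S" using assms divisorD by auto
  show ?thesis
    by (subst (1 2 3) deg_eq_sum[OF S]) (auto simp: sum.distrib distrib_right)
qed

lemma deg_scale: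
  assumes "divisor A" shows "deg (\<lambda>P. c * A P) = c * deg A"
proof -
  let ?S = "{P. A P \<noteq> 0}"
  have S: "finite ?S" using assms divisorD by auto
  show ?thesis
    by (subst (1 2) deg_eq_sum[OF S]) (auto simp: sum_distrib_left mult.assoc)
qed

lemma deg_diff:
  assumes "divisor A" "divisor B" shows "deg (\<lambda>P. A P - B P) = deg A - deg B"
  using deg_add[OF assms(1) divisor_map[OF assms(2), of "\<lambda>b. (- 1) * b"]] deg_scale[OF assms(2), of "- 1"]
  by simp

lemma deg_nonneg: "(\<And>P. A P \<ge> 0) \<Longrightarrow> deg A \<ge> 0"
  unfolding deg_def by (intro sum_nonneg) simp

lemma divisor_zero: "divisor (\<lambda>_. 0)"
  by (simp add: divisor_def)

lemma deg_zero: "deg (\<lambda>_. 0) = 0"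
  by (simp add: deg_def)

lemma divisor_divisor_of: "y \<noteq> 0 \<Longrightarrow> divisor (divisor_of y)"
  by (rule divisorI[OF finite_support]) (auto simp: divisor_of_def)

lemma add_subgroup_RR: "add_subgroup (RR A)"
  unfolding RR_def by (rule add_subgroup_LS) simp

lemma RR_mono: "(\<And>P. P \<in> places \<Longrightarrow> A P \<le> B P) \<Longrightarrow> RR A \<subseteq> RR B"
  unfolding RR_def by (rule LS_mono)

lemma RR_mult: "y \<noteq> 0 \<Longrightarrow> (*) y ` RR A = RR (\<lambda>P. A P - divisor_of y P)"
  unfolding RR_def by (rule LS_mult) simp_all

lemma LS_Int_RR:
  assumes AB: "\<And>P. P \<in> S \<Longrightarrow> A P \<le> B P" "\<And>P. P \<in> places - S \<Longrightarrow> A P = B P" and S: "S \<subseteq> places"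
  shows "LS S A \<inter> RR B = RR A"
proof
  show "LS S A \<inter> RR B \<subseteq> RR A" using AB(2) by (auto simp: LS_def RR_def) 
  have "RR A \<subseteq> RR B" using AB by (intro RR_mono) (metis Diff_iff order_refl)
  moreover have "RR A \<subseteq> LS S A" using S by (auto simp: LS_def RR_def)
  ultimately show "RR A \<subseteq> LS S A \<inter> RR B" by blast
qed

lemma idx_LS_deg:
  assumes S: "finite S" "S \<subseteq> places" and AB: "\<And>P. A P \<le> B P"
    and supp: "\<And>P. P \<notin> S \<Longrightarrow> A P = 0" "\<And>P. P \<notin> S \<Longrightarrow> B P = 0"
  shows "idx (LS S A) (LS S B) = q ^ nat (deg B - deg A)" "deg A \<le> deg B"
proof -
  have "deg B - deg A = (\<Sum>P\<in>S. (B P - A P) * int (place_degree emb P))"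
    using deg_eq_sum[OF S(1), of A] deg_eq_sum[OF S(1), of B] supp
    by (simp add: sum_subtractf left_diff_distrib)
  also have "\<dots> = int (\<Sum>P\<in>S. nat (B P - A P) * place_degree emb P)"
    unfolding of_nat_sum by (rule sum.cong) (use AB in \<open>auto simp: diff_ge_0_iff_ge\<close>)
  finally have d: "deg B - deg A = int (\<Sum>P\<in>S. nat (B P - A P) * place_degree emb P)" .
  then show "deg A \<le> deg B" by (metis diff_ge_0_iff_ge of_nat_0_le_iff)
  have "nat (deg B - deg A) = (\<Sum>P\<in>S. nat (B P - A P) * place_degree emb P)"
    unfolding d by (rule nat_int)
  then show "idx (LS S A) (LS S B) = q ^ nat (deg B - deg A)"
    using idx_LS[OF S, of A B] AB by simp
qed

text \<open>For a finite \<open>S\<close> containing both supports, \<open>RR B\<close> modulo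
  \<open>RR A\<close> embeds into \<open>LS S B\<close> modulo \<open>LS S A\<close>, since the
  conditions off \<open>S\<close> agree.\<close>

lemma idx_RR:
  assumes "divisor A" "divisor B" "\<And>P. A P \<le> B P"
  shows "idx (RR A) (RR B) \<noteq> 0" "idx (RR A) (RR B) \<le> q ^ nat (deg B - deg A)" "deg A \<le> deg B"
proof -
  let ?S = "{P. A P \<noteq> 0} \<union> {P. B P \<noteq> 0}"
  have S: "finite ?S" "?S \<subseteq> places" using assms(1,2) divisorD by auto
  note i = idx_LS_deg[OF S assms(3)]
  have d: "deg A \<le> deg B" and idx: "idx (LS ?S A) (LS ?S B) = q ^ nat (deg B - deg A)"
    using i by auto
  then show "deg A \<le> deg B" by simp
  have nz: "idx (LS ?S A) (LS ?S B) \<noteq> 0" unfolding idx using q_gt_1 by simp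
  have int: "LS ?S A \<inter> RR B = RR A" using assms(3) S(2) by (intro LS_Int_RR) auto
  have sub: "(\<lambda>f. f) ` RR B \<subseteq> LS ?S B" using S(2) by (auto simp: LS_def RR_def)
  have iff: "f - h \<in> LS ?S A \<longleftrightarrow> f - h \<in> RR A" if "f \<in> RR B" "h \<in> RR B" for f h
    using int add_subgroup_diff[OF add_subgroup_RR that] by blast
  show "idx (RR A) (RR B) \<noteq> 0"
    using add_subgroup_RR[of B] add_subgroup_zero
    by (intro idx_nonzero_of_map[OF add_subgroup_RR add_subgroup_LS[OF S(2)] sub nz _ iff]) blast+
  show "idx (RR A) (RR B) \<le> q ^ nat (deg B - deg A)"
    unfolding idx[symmetric]
    by (intro idx_le_of_map[OF add_subgroup_RR add_subgroup_LS[OF S(2)] sub nz iff])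
qed

section \<open>Poles of nonconstant functions and finiteness of Riemann-Roch spaces\<close>

lemma x_not_constant: "x \<notin> range emb"
proof
  assume "x \<in> range emb"
  then obtain c where "x = emb c" by blast
  then have "pev [:- c, 1:] x = 0" by (simp add: hom_distribs)
  then show False using pev_x[of "[:- c, 1:]"] by simp
qed

lemma ex_pole:
  assumes "f \<notin> range emb"
  obtains P where "P \<in> places" "place_val P f < 0"
proof -
  have f0: "f \<noteq> 0" using assms hom_zero by (metis rangeI)
  have "inverse f \<notin> range emb"
  proof
    assume "inverse f \<in> range emb"
    then obtain c where "inverse f = emb c" by blast
    then have "f = emb (inverse c)" by (metis hom_inverse inverse_inverse_eq)
    with assms show False by simp
  qed
  then obtain P where P: "P \<in> places" "inverse f \<in> P" by (rule ex_place_containing)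
  then have "place_val P f < 0"
    using place_iff_val[OF P(1), of "inverse f"] place_val_inverse[OF P(1) f0] f0 by simp
  with P(1) show thesis by (rule that)
qed

text \<open>Lower \<open>B\<close> to a divisor \<open>A\<close> that is at most 0 and negative at
  \<open>Q\<close>. A nonzero function in \<open>RR A\<close> would have no pole, hence be constant,
  and yet vanish at \<open>Q\<close>. So \<open>RR A\<close> is zero, and the finite index gives the
  size of \<open>RR B\<close>.\<close>

lemma finite_RR:
  assumes B: "divisor B" shows "finite (RR B)"
proof -
  obtain Q where Q: "Q \<in> places" using ex_pole[OF x_not_constant] by blast
  define A where "A P = min (B P) (if P = Q then - 1 else 0)" for P
  have A: "divisor A"
    by (rule divisorI[of "insert Q {P. B P \<noteq> 0}"]) (use B Q divisorD in \<open>auto simp: A_def\<close>)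
  have "RR A \<subseteq> {0}"
  proof
    fix f assume f: "f \<in> RR A"
    show "f \<in> {0}"
    proof (rule ccontr)
      assume "f \<notin> {0}"
      then have f0: "f \<noteq> 0" by simp
      have ge: "place_val P f \<ge> (if P = Q then 1 else 0)" if "P \<in> places" for P
      proof -
        have "- A P \<le> place_val P f" using f f0 that by (auto simp: RR_def LS_def vge_def)
        moreover have "A P \<le> (if P = Q then - 1 else 0)" unfolding A_def by (rule min.cobounded2)
        ultimately show ?thesis by (auto split: if_splits)
      qed
      have "f \<notin> range emb"
      proof
        assume "f \<in> range emb"
        then obtain c where "f = emb c" by blast
        then show False using ge[OF Q] place_val_emb[OF Q, of c] f0 by (cases "c = 0") auto
      qed
      then obtain P where "P \<in> places" "place_val P f < 0" by (rule ex_pole)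
      then show False using ge[of P] by (simp split: if_splits)
    qed
  qed
  then have "RR A = {0}" using add_subgroup_zero[OF add_subgroup_RR] by blast
  then have "card (RR B) = idx (RR A) (RR B)"
    using card_eq_card_mult_idx[OF add_subgroup_RR add_subgroup_RR, of A B] RR_mono[of A B]
    by (simp add: A_def)
  also have "\<dots> \<noteq> 0" by (rule idx_RR(1)[OF A B]) (simp add: A_def)
  finally show ?thesis using card.infinite by force
qed

lemma card_RR:
  assumes "divisor A" shows "card (RR A) = q ^ ell A"
proof -
  have "vectorspace class_ring ((field_space emb)\<lparr>carrier := RR A\<rparr>)"
    by (rule vectorspace_field_space[OF add_subgroup_RR]) (simp add: RR_def LS_scale)
  from card_vectorspace[OF this] show ?thesis
    using finite_RR[OF assms] by (simp add: ell_def q_eq)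
qed

lemma ell_mult:
  assumes "divisor A" "y \<noteq> 0"
  shows "ell (\<lambda>P. A P - divisor_of y P) = ell A"
proof -
  have D: "divisor (\<lambda>P. A P - divisor_of y P)"
    by (rule divisor_combine[OF assms(1) divisor_divisor_of[OF assms(2)], of "(-)"]) simp
  have "q ^ ell (\<lambda>P. A P - divisor_of y P) = card ((*) y ` RR A)"
    unfolding card_RR[OF D, symmetric] RR_mult[OF assms(2)] ..
  also have "\<dots> = card (RR A)" using assms(2) by (intro card_image inj_onI) simp
  also have "\<dots> = q ^ ell A" by (rule card_RR[OF assms(1)])
  finally show ?thesis using q_gt_1 by (simp add: power_inject_exp)
qed

lemma card_RR_mult_idx:
  assumes "divisor A" "divisor B" "\<And>P. A P \<le> B P"
  shows "q ^ ell B = q ^ ell A * idx (RR A) (RR B)"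
  unfolding card_RR[OF assms(1), symmetric] card_RR[OF assms(2), symmetric]
  by (intro card_eq_card_mult_idx add_subgroup_RR RR_mono assms)

lemma chi_mono:
  assumes "divisor A" "divisor B" "\<And>P. A P \<le> B P"
  shows "chi A \<le> chi B"
proof -
  note i = idx_RR[OF assms]
  have "q ^ ell B \<le> q ^ ell A * q ^ nat (deg B - deg A)"
    unfolding card_RR_mult_idx[OF assms] using i(2) by simp
  then have "ell B \<le> ell A + nat (deg B - deg A)"
    using q_gt_1 by (simp add: power_add[symmetric] power_increasing_iff)
  then show ?thesis using i(3) unfolding chi_def by simp
qed

lemma ell_zero: "ell (\<lambda>_. 0) = 1"
proof -
  have "RR (\<lambda>_. 0) = range emb"
  proof
    show "range emb \<subseteq> RR (\<lambda>_. 0)" by (auto simp: RR_def LS_def vge_emb)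
    show "RR (\<lambda>_. 0) \<subseteq> range emb"
    proof
      fix f assume f: "f \<in> RR (\<lambda>_. 0)"
      show "f \<in> range emb"
      proof (rule ccontr)
        assume nf: "f \<notin> range emb"
        then obtain P where P: "P \<in> places" "place_val P f < 0" by (rule ex_pole)
        have "f \<noteq> 0" using nf hom_zero by (metis rangeI)
        moreover have "vge P f 0" using f P(1) by (auto simp: RR_def LS_def)
        ultimately show False using P(2) by (simp add: vge_def)
      qed
    qed
  qed
  then have "q ^ ell (\<lambda>_. 0) = q ^ 1" using card_RR[OF divisor_zero] by (simp add: q_def)
  then show ?thesis using q_gt_1 by (simp only: power_inject_exp)
qed

lemma chi_zero: "chi (\<lambda>_. 0) = - 1"
  by (simp add: chi_def ell_zero deg_zero)

section \<open>The pole divisor of x\<close>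

definition x_poles :: "'f set \<Rightarrow> int" where
  "x_poles P = (if P \<in> places \<and> place_val P x < 0 then - place_val P x else 0)"

lemma x_nonzero: "x \<noteq> 0"
  using x_not_constant hom_zero by (metis rangeI)

lemma divisor_x_poles: "divisor x_poles"
  by (rule divisorI[OF finite_support[OF x_nonzero]]) (auto simp: x_poles_def)

text \<open>Independence of \<open>U\<close> over K(x) turns the upper bound into an equality: the
  coefficients of two equal combinations differ, for each \<open>v\<close>, by a polynomial
  \<open>p v\<close> that must vanish.\<close>

lemma card_poly_span: "card (poly_span d) = q ^ (card U * d)"
proof -
  have "inj_on (comb d) (U \<times> {..<d} \<rightarrow>\<^sub>E UNIV)"
  proof (rule inj_onI)
    fix c c' assume c: "c \<in> U \<times> {..<d} \<rightarrow>\<^sub>E UNIV" "c' \<in> U \<times> {..<d} \<rightarrow>\<^sub>E UNIV" "comb d c = comb d c'"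
    define p where "p v = (\<Sum>j<d. monom (c (v, j) - c' (v, j)) j)" for v
    have "(\<Sum>v\<in>U. pev (p v) x * v) = comb d (\<lambda>k. c k - c' k)"
      by (simp add: comb_def sum.cartesian_product[symmetric] p_def pev_sum sum_distrib_right poly_monom)
    also have "\<dots> = 0" unfolding comb_diff[symmetric] using c(3) by simp
    finally have p0: "p v = 0" if "v \<in> U" for v using basis_indep that by blast
    have "c (v, j) = c' (v, j)" if "v \<in> U" "j < d" for v j
    proof -
      have "coeff (p v) j = (\<Sum>i<d. if i = j then c (v, j) - c' (v, j) else 0)"
        unfolding p_def coeff_sum by (rule sum.cong) auto
      also have "\<dots> = c (v, j) - c' (v, j)" using that by simp
      finally show ?thesis using p0[OF that(1)] by simp
    qed
    then show "c = c'" using c(1,2) by (intro PiE_ext[OF c(1,2)]) auto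
  qed
  then show ?thesis unfolding poly_span_eq_PiE by (simp add: card_image card_coeffs)
qed

lemma ex_divisor_basis:
  "\<exists>C. divisor C \<and> (\<forall>P. C P \<ge> 0) \<and> (\<forall>v\<in>U. v \<in> RR C)"
proof -
  define C where "C P = (\<Sum>v\<in>U - {0}. \<bar>divisor_of v P\<bar>)" for P
  have "divisor C"
  proof (rule divisorI[of "\<Union>v\<in>U - {0}. {P \<in> places. place_val P v \<noteq> 0}"])
    show "finite (\<Union>v\<in>U - {0}. {P \<in> places. place_val P v \<noteq> 0})"
      using finite_basis finite_support by simp
    fix P assume P: "P \<notin> (\<Union>v\<in>U - {0}. {P \<in> places. place_val P v \<noteq> 0})"
    show "C P = 0" unfolding C_def by (rule sum.neutral) (use P in \<open>auto simp: divisor_of_def\<close>)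
  qed auto
  moreover have "C P \<ge> 0" for P unfolding C_def by (rule sum_nonneg) simp
  moreover have "v \<in> RR C" if v: "v \<in> U" for v
  proof (cases "v = 0")
    case False
    have "vge P v (- C P)" if "P \<in> places" for P
    proof -
      have "\<bar>divisor_of v P\<bar> \<le> C P" unfolding C_def
        by (rule member_le_sum) (use v False finite_basis in auto)
      then show ?thesis using that False by (auto simp: vge_def divisor_of_def)
    qed
    then show ?thesis by (simp add: RR_def LS_def)
  qed (simp add: add_subgroup_zero[OF add_subgroup_RR])
  ultimately show ?thesis by blast
qed

lemma poly_span_subset_RR:
  assumes C: "\<And>v. v \<in> U \<Longrightarrow> v \<in> RR C"
  shows "poly_span (Suc l) \<subseteq> RR (\<lambda>P. int l * x_poles P + C P)"
proof -
  let ?D = "\<lambda>P. int l * x_poles P + C P"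
  have gen: "x ^ j * v \<in> RR ?D" if v: "v \<in> U" and j: "j \<le> l" for v j
  proof -
    have "vge P (x ^ j * v) (- ?D P)" if P: "P \<in> places" for P
    proof -
      have "int l * x_poles P \<ge> - (int j * place_val P x)"
      proof (cases "place_val P x < 0")
        case True
        then show ?thesis using P j by (simp add: x_poles_def mult_right_mono)
      next
        case False
        then show ?thesis by (simp add: x_poles_def)
      qed
      moreover have "vge P v (- C P)" using C[OF v] P by (auto simp: RR_def LS_def)
      ultimately show ?thesis
        using vge_mult_iff[OF P, of "x ^ j" v "- ?D P"] place_val_power[OF P x_nonzero, of j] x_nonzero
        by (auto intro: vge_mono)
    qed
    then show ?thesis by (simp add: RR_def LS_def)
  qed
  have "comb (Suc l) c \<in> RR ?D" for c
    unfolding comb_def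
  proof (rule add_subgroup_sum[OF add_subgroup_RR])
    fix k assume "k \<in> U \<times> {..<Suc l}"
    then have "emb (c k) * (x ^ snd k * fst k) \<in> RR ?D"
      using gen[of "fst k" "snd k"] unfolding RR_def by (intro LS_scale) auto
    then show "(case k of (v, j) \<Rightarrow> emb (c (v, j)) * x ^ j * v) \<in> RR ?D"
      by (simp add: case_prod_beta mult.assoc)
  qed
  then show ?thesis by (auto simp: poly_span_def)
qed

lemma ell_x_poles:
  assumes C: "divisor C" "\<And>v. v \<in> U \<Longrightarrow> v \<in> RR C"
  shows "card U * Suc l \<le> ell (\<lambda>P. int l * x_poles P + C P)"
proof -
  have D: "divisor (\<lambda>P. int l * x_poles P + C P)"
    by (rule divisor_combine[OF divisor_x_poles C(1), of "\<lambda>a b. int l * a + b"]) simp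
  have "q ^ (card U * Suc l) \<le> q ^ ell (\<lambda>P. int l * x_poles P + C P)"
    unfolding card_poly_span[symmetric] card_RR[OF D, symmetric]
    by (rule card_mono[OF finite_RR[OF D] poly_span_subset_RR[OF C(2)]])
  then show ?thesis using q_gt_1 by (simp only: power_increasing_iff)
qed

text \<open>The upper bound is the degree bound for the zeros of 1/x with Q = x: both Q and Q (1/x)
  = 1 shift degrees by at most 1. For the lower bound, the combinations of \<open>U\<close> with
  coefficients of degree at most l lie in L(l (x)_inf + C), whose dimension grows by at most l times
  the degree of the pole divisor.\<close>

lemma deg_x_poles: "deg x_poles = int (card U)"
proof (rule antisym)
  let ?S = "{P \<in> places. place_val P (inverse x) > 0}"
  have S: "finite ?S" by (rule finite_zeros) (simp add: x_nonzero)
  have "degree_shift x 1" using degree_shift_x_power[of 1] by simp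
  moreover have "degree_shift (x * inverse x) 1"
    using degree_shift_mono[OF degree_shift_pev[of 1], of 1] x_nonzero by simp
  ultimately have "(\<Sum>P\<in>?S. nat (place_val P (inverse x)) * place_degree emb P) \<le> card U * 1"
    by (rule degree_zeros_le) (use S x_nonzero in auto)
  then have "int (\<Sum>P\<in>?S. nat (place_val P (inverse x)) * place_degree emb P) \<le> int (card U)"
    by (simp only: of_nat_le_iff mult_1_right)
  moreover have "deg x_poles = int (\<Sum>P\<in>?S. nat (place_val P (inverse x)) * place_degree emb P)"
  proof -
    have "deg x_poles = (\<Sum>P\<in>?S. x_poles P * int (place_degree emb P))"
      by (rule deg_eq_sum[OF S]) (auto simp: x_poles_def place_val_inverse[OF _ x_nonzero])
    also have "\<dots> = int (\<Sum>P\<in>?S. nat (place_val P (inverse x)) * place_degree emb P)"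
      unfolding of_nat_sum
      by (rule sum.cong) (auto simp: x_poles_def place_val_inverse[OF _ x_nonzero])
    finally show ?thesis .
  qed
  ultimately show "deg x_poles \<le> int (card U)" by (simp only:)
next
  obtain C where C: "divisor C" "\<forall>P. C P \<ge> 0" "\<forall>v\<in>U. v \<in> RR C" using ex_divisor_basis by blast
  have *: "int (card U) * int l \<le> int l * deg x_poles + int (ell C)" for l
  proof -
    have D: "divisor (\<lambda>P. int l * x_poles P + C P)"
      by (rule divisor_combine[OF divisor_x_poles C(1), of "\<lambda>a b. int l * a + b"]) simp
    have "C P \<le> int l * x_poles P + C P" for P by (simp add: x_poles_def)
    from chi_mono[OF C(1) D this]
    have "int (ell (\<lambda>P. int l * x_poles P + C P)) \<le> int l * deg x_poles + int (ell C)"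
      using deg_add[OF divisor_map[OF divisor_x_poles, of "\<lambda>a. int l * a"] C(1)]
        deg_scale[OF divisor_x_poles, of "int l"] unfolding chi_def by simp
    moreover have "int (card U * Suc l) \<le> int (ell (\<lambda>P. int l * x_poles P + C P))"
      using ell_x_poles[OF C(1)] C(3) by (simp only: of_nat_le_iff)
    moreover have "int (card U) * int l \<le> int (card U * Suc l)" by simp
    ultimately show ?thesis by linarith
  qed
  show "int (card U) \<le> deg x_poles"
  proof (rule ccontr)
    assume "\<not> int (card U) \<le> deg x_poles"
    then have "deg x_poles + 1 \<le> int (card U)" by simp
    \<comment> \<open>The choice l = \<open>ell C\<close> + 1 makes a gain of at least 1 per step
      exceed the constant \<open>ell C\<close>.\<close>
    then have "int (Suc (ell C)) * (deg x_poles + 1) \<le> int (Suc (ell C)) * int (card U)"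
      by (intro mult_left_mono) simp_all
    then show False using *[of "Suc (ell C)"] by (simp add: algebra_simps)
  qed
qed

text \<open>The leading term dominates at a pole: in each Horner step a constant is added to
  something of negative valuation.\<close>

lemma place_val_pev_pole:
  assumes P: "P \<in> places" and "place_val P x < 0" and "p \<noteq> 0"
  shows "place_val P (pev p x) = int (degree p) * place_val P x"
  using assms(3)
proof (induction p)
  case (pCons a p)
  show ?case
  proof (cases "p = 0")
    case True
    then show ?thesis using pCons place_val_emb[OF P, of a] by simp
  next
    case False
    then have p0: "pev p x \<noteq> 0" by (rule pev_x)
    have val: "place_val P (x * pev p x) = int (Suc (degree p)) * place_val P x"
      using place_val_mult[OF P x_nonzero p0] pCons.IH[OF False] by (simp add: algebra_simps)
    moreover have "int (Suc (degree p)) * place_val P x < 0"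
      using assms(2) by (simp add: mult_less_0_iff)
    ultimately have "place_val P (x * pev p x + emb a) = place_val P (x * pev p x)"
      using x_nonzero p0 vge_emb[OF P] by (intro place_val_add_eq(2)[OF P]) auto
    then show ?thesis using val False by (simp add: add.commute)
  qed
qed simp

lemma place_val_pev_nonneg:
  assumes P: "P \<in> places" and x: "place_val P x \<ge> 0" and "p \<noteq> 0"
  shows "place_val P (pev p x) \<ge> 0"
proof -
  have "vge P x 0" using x by (simp add: vge_def)
  then have "vge P (pev p x) 0"
  proof (induction p)
    case (pCons a p)
    then have "vge P (x * pev p x) 0" using vge_mult[OF P, of x 0 "pev p x" 0] by simp
    then show ?case using vge_add[OF P vge_emb[OF P]] by simp
  qed simp
  then show ?thesis using pev_x[OF assms(3)] by (simp add: vge_def)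
qed

text \<open>The zeros of p(x) have total degree at most \<open>card U * degree p\<close> by the
  digit bound, while its poles contribute \<open>degree p\<close> times the pole divisor of
  \<open>x\<close>, of degree \<open>card U\<close>.\<close>

lemma deg_divisor_of_pev:
  assumes "p \<noteq> 0" shows "deg (divisor_of (pev p x)) \<le> 0"
proof -
  let ?y = "pev p x"
  let ?S = "{P \<in> places. place_val P ?y > 0}"
  have y0: "?y \<noteq> 0" by (rule pev_x[OF assms])
  have S: "finite ?S" by (rule finite_zeros[OF y0])
  define Z where "Z P = (if P \<in> ?S then place_val P ?y else 0)" for P
  have Z: "divisor Z" by (rule divisorI[OF S]) (auto simp: Z_def)
  have "degree_shift 1 (degree p)"
    using degree_shift_mono[OF degree_shift_pev[of 1], of "degree p"] by simp
  then have "(\<Sum>P\<in>?S. nat (place_val P ?y) * place_degree emb P) \<le> card U * degree p"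
    by (rule degree_zeros_le) (use S y0 degree_shift_pev in auto)
  then have "int (\<Sum>P\<in>?S. nat (place_val P ?y) * place_degree emb P) \<le> int (card U) * int (degree p)"
    by (simp only: of_nat_le_iff flip: of_nat_mult)
  moreover have "deg Z = int (\<Sum>P\<in>?S. nat (place_val P ?y) * place_degree emb P)"
  proof -
    have "deg Z = (\<Sum>P\<in>?S. Z P * int (place_degree emb P))"
      by (rule deg_eq_sum[OF S]) (auto simp: Z_def)
    also have "\<dots> = int (\<Sum>P\<in>?S. nat (place_val P ?y) * place_degree emb P)"
      unfolding of_nat_sum by (rule sum.cong) (auto simp: Z_def)
    finally show ?thesis .
  qed
  ultimately have "deg Z \<le> int (card U) * int (degree p)" by (simp only:)
  moreover have "divisor_of ?y P \<le> Z P + - int (degree p) * x_poles P" for P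
  proof (cases "P \<in> places")
    case P: True
    show ?thesis
    proof (cases "place_val P x < 0")
      case True
      then show ?thesis using P place_val_pev_pole[OF P True assms]
        by (auto simp: divisor_of_def Z_def x_poles_def)
    next
      case False
      then show ?thesis using P place_val_pev_nonneg[OF P _ assms]
        by (auto simp: divisor_of_def Z_def x_poles_def)
    qed
  qed (simp add: divisor_of_def Z_def x_poles_def)
  then have "deg (divisor_of ?y) \<le> deg (\<lambda>P. Z P + - int (degree p) * x_poles P)"
    by (intro idx_RR(3) divisor_divisor_of y0
        divisor_combine[OF Z divisor_x_poles, of "\<lambda>a b. a + - int (degree p) * b"]) simp_all
  then have "deg (divisor_of ?y) \<le> deg Z - int (degree p) * deg x_poles"
    using deg_add[OF Z divisor_map[OF divisor_x_poles, of "\<lambda>a. - int (degree p) * a"]]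
      deg_scale[OF divisor_x_poles, of "- int (degree p)"] by simp
  ultimately show ?thesis unfolding deg_x_poles by (simp add: mult.commute)
qed

text \<open>Two different powers of \<open>x\<close> coincide in the finite residue field; their
  difference X^i - X^j is the required polynomial.\<close>

lemma ex_poly_in_place:
  assumes P: "P \<in> places" and x: "place_val P x \<ge> 0"
  obtains p where "p \<noteq> 0" "place_val P (pev p x) > 0"
proof -
  have xO: "x \<in> vring P" using vring_iff_val[OF P x_nonzero] x by simp
  have pow: "x ^ k \<in> vring P" for k
    by (induction k) (use xO vring_closed(2,6)[OF P] in auto)
  have "idx P (vring P) \<noteq> 0" using idx_place(1)[OF P] q_gt_1 by simp
  then have "finite (coset P ` vring P)" by (rule finite_cosets)
  moreover have "range (\<lambda>k. coset P (x ^ k)) \<subseteq> coset P ` vring P" using pow by blast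
  ultimately have "finite (range (\<lambda>k :: nat. coset P (x ^ k)))" by (rule finite_subset[rotated])
  then have "\<not> inj (\<lambda>k :: nat. coset P (x ^ k))" using finite_imageD by blast
  then obtain i j where ij: "i \<noteq> (j :: nat)" "coset P (x ^ i) = coset P (x ^ j)"
    unfolding inj_def by blast
  define p :: "'q poly" where "p = monom 1 i - monom 1 j"
  have "coeff p i = 1" using ij(1) by (simp add: p_def)
  then have p: "p \<noteq> 0" by auto
  have "pev p x \<in> P" using ij(2) coset_eq_iff[OF add_subgroup_place[OF P]] by (simp add: p_def poly_monom)
  then have "place_val P (pev p x) > 0" using place_iff_val[OF P pev_x[OF p]] by simp
  with p show thesis by (rule that)
qed

lemma ex_poly_dominating:
  assumes A: "divisor A"
  obtains p where "p \<noteq> 0" "\<And>P. P \<in> places \<Longrightarrow> place_val P x \<ge> 0 \<Longrightarrow> A P \<le> place_val P (pev p x)"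
proof -
  let ?S = "{P. A P \<noteq> 0 \<and> place_val P x \<ge> 0}"
  have S: "finite ?S" using divisorD(1)[OF A] by (rule finite_subset[rotated]) auto
  have Sp: "P \<in> places" if "P \<in> ?S" for P using divisorD(2)[OF A] that by auto
  have "\<forall>P\<in>?S. \<exists>p. p \<noteq> 0 \<and> place_val P (pev p x) > 0"
    using ex_poly_in_place Sp by (metis (mono_tags, lifting) mem_Collect_eq)
  then obtain f where f: "\<And>P. P \<in> ?S \<Longrightarrow> f P \<noteq> 0 \<and> place_val P (pev (f P) x) > 0"
    by metis
  define p where "p = (\<Prod>P\<in>?S. f P ^ nat \<bar>A P\<bar>)"
  have p0: "p \<noteq> 0" unfolding p_def using S f by simp
  show thesis
  proof (rule that[OF p0])
    fix P assume P: "P \<in> places" "place_val P x \<ge> 0"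
    show "A P \<le> place_val P (pev p x)"
    proof (cases "P \<in> ?S")
      case False
      then show ?thesis using P place_val_pev_nonneg[OF P p0] by simp
    next
      case True
      define r where "r = (\<Prod>R\<in>?S - {P}. f R ^ nat \<bar>A R\<bar>)"
      have pr: "p = f P ^ nat \<bar>A P\<bar> * r" unfolding p_def r_def using S True by (simp add: prod.remove)
      have r0: "r \<noteq> 0" and fP0: "f P \<noteq> 0" using p0 pr f[OF True] by auto
      have pw: "pev (f P ^ k) x = pev (f P) x ^ k" for k by (induction k) simp_all
      have "place_val P (pev p x) = int (nat \<bar>A P\<bar>) * place_val P (pev (f P) x) + place_val P (pev r x)"
        using place_val_mult[OF P(1), of "pev (f P) x ^ nat \<bar>A P\<bar>" "pev r x"]
          place_val_power[OF P(1) pev_x[OF fP0]] pev_x[OF fP0] pev_x[OF r0] by (simp add: pr pw)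
      moreover have "int (nat \<bar>A P\<bar>) * 1 \<le> int (nat \<bar>A P\<bar>) * place_val P (pev (f P) x)"
        using f[OF True] by (intro mult_left_mono) auto
      moreover have "place_val P (pev r x) \<ge> 0" by (rule place_val_pev_nonneg[OF P r0])
      ultimately show ?thesis by linarith
    qed
  qed
qed

text \<open>Riemann's argument: \<open>\<chi>\<close> is bounded along the multiples of the pole divisor of \<open>x\<close>, and every
  divisor is equivalent to a divisor of no smaller degree below such a multiple.\<close>

lemma chi_bounded: "\<exists>c. \<forall>A. divisor A \<longrightarrow> chi A \<le> c"
proof -
  obtain C where C: "divisor C" "\<forall>P. C P \<ge> 0" "\<forall>v\<in>U. v \<in> RR C" using ex_divisor_basis by blast
  have chi_l: "chi (\<lambda>P. int l * x_poles P) \<le> deg C" for l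
  proof -
    have B: "divisor (\<lambda>P. int l * x_poles P)"
      by (rule divisor_map[OF divisor_x_poles]) simp
    have D: "divisor (\<lambda>P. int l * x_poles P + C P)"
      by (rule divisor_combine[OF divisor_x_poles C(1), of "\<lambda>a b. int l * a + b"]) simp
    have ell: "int (card U * Suc l) \<le> int (ell (\<lambda>P. int l * x_poles P + C P))"
      using ell_x_poles[OF C(1)] C(3) by (simp only: of_nat_le_iff)
    have "chi (\<lambda>P. int l * x_poles P) \<le> chi (\<lambda>P. int l * x_poles P + C P)"
      by (rule chi_mono[OF B D]) (use C in simp)
    \<comment> \<open>The term l \<open>card U\<close> cancels because the degree of the pole
      divisor equals the rank of \<open>U\<close>; hence a bound independent of l.\<close>
    also have "\<dots> \<le> int l * int (card U) + deg C - int (card U * Suc l)"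
      using ell deg_add[OF B C(1)] deg_scale[OF divisor_x_poles, of "int l"]
      unfolding chi_def deg_x_poles by linarith
    also have "\<dots> \<le> deg C" by (simp add: algebra_simps)
    finally show ?thesis .
  qed
  have "chi A \<le> deg C" if A: "divisor A" for A
  proof -
    obtain p where p: "p \<noteq> 0"
      "\<And>P. P \<in> places \<Longrightarrow> place_val P x \<ge> 0 \<Longrightarrow> A P \<le> place_val P (pev p x)"
      using ex_poly_dominating[OF A] by blast
    let ?y = "pev p x"
    have y0: "?y \<noteq> 0" by (rule pev_x[OF p(1)])
    let ?A = "\<lambda>P. A P - divisor_of ?y P"
    have A': "divisor ?A" by (rule divisor_combine[OF A divisor_divisor_of[OF y0], of "(-)"]) simp
    \<comment> \<open>Large enough at the finitely many poles of \<open>x\<close>; at the other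
      places the choice of \<open>p\<close> has already made \<open>?A\<close> nonpositive.\<close>
    define l where "l = nat (\<Sum>P | x_poles P \<noteq> 0. \<bar>?A P\<bar>)"
    have "?A P \<le> int l * x_poles P" for P
    proof (cases "x_poles P = 0")
      case True
      show ?thesis
      proof (cases "P \<in> places")
        case P: True
        then have "place_val P x \<ge> 0" using True by (auto simp: x_poles_def split: if_splits)
        then show ?thesis using p(2)[OF P] P True by (simp add: divisor_of_def)
      next
        case False
        then have "A P = 0" using divisorD(2)[OF A] by auto
        then show ?thesis using False True by (simp add: divisor_of_def)
      qed
    next
      case False
      then have pos: "x_poles P \<ge> 1" by (auto simp: x_poles_def split: if_splits)
      have "\<bar>?A P\<bar> \<le> (\<Sum>P | x_poles P \<noteq> 0. \<bar>?A P\<bar>)"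
        by (rule member_le_sum) (use False divisorD(1)[OF divisor_x_poles] in auto)
      then have "\<bar>?A P\<bar> \<le> int l" unfolding l_def by simp
      moreover have "int l * 1 \<le> int l * x_poles P" using pos by (intro mult_left_mono) auto
      ultimately show ?thesis by linarith
    qed
    then have "chi ?A \<le> chi (\<lambda>P. int l * x_poles P)"
      by (intro chi_mono A' divisor_map[OF divisor_x_poles]) simp_all
    \<comment> \<open>Replacing A by A - (y) keeps \<open>ell\<close>. At this point only deg (y)
      \<le> 0 is known for y = p(x), and it points in the right direction.\<close>
    moreover have "chi A \<le> chi ?A"
      using ell_mult[OF A y0] deg_diff[OF A divisor_divisor_of[OF y0]] deg_divisor_of_pev[OF p(1)]
      unfolding chi_def by simp
    ultimately show ?thesis using chi_l[of l] by linarith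
  qed
  then show ?thesis by blast
qed

text \<open>The divisor of y^l has \<open>ell\<close> equal to 1 for every l, so boundedness of
  \<open>chi\<close> bounds l deg (y) for all l. A positive degree is refuted by l = c + 2.\<close>

lemma deg_divisor_of_le: 
  assumes y: "y \<noteq> 0" shows "deg (divisor_of y) \<le> 0"
proof -
  obtain c where c: "\<And>A. divisor A \<Longrightarrow> chi A \<le> c" using chi_bounded by blast
  have D: "divisor (divisor_of y)" by (rule divisor_divisor_of[OF y])
  have *: "int l * deg (divisor_of y) \<le> c + 1" for l
  proof -
    have yl: "y ^ l \<noteq> 0" using y by simp
    have B: "divisor (\<lambda>P. int l * divisor_of y P)" by (rule divisor_map[OF D]) simp
    have "(\<lambda>P. int l * divisor_of y P - divisor_of (y ^ l) P) = (\<lambda>_. 0)"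
      by (rule ext) (simp add: divisor_of_def place_val_power y)
    then have "ell (\<lambda>P. int l * divisor_of y P) = 1"
      using ell_mult[OF B yl] ell_zero by simp
    then show ?thesis using c[OF B] deg_scale[OF D, of "int l"] unfolding chi_def by simp
  qed
  show ?thesis
  proof (rule ccontr)
    assume "\<not> deg (divisor_of y) \<le> 0"
    moreover have c2: "c + 2 \<ge> 0" using *[of 0] by simp
    ultimately have "(c + 2) * 1 \<le> (c + 2) * deg (divisor_of y)"
      by (intro mult_left_mono) auto
    also have "\<dots> \<le> c + 1" using *[of "nat (c + 2)"] c2 by simp
    finally show False by simp
  qed
qed

lemma deg_divisor_of:
  assumes y: "y \<noteq> 0" shows "deg (divisor_of y) = 0"
proof -
  have "divisor_of (inverse y) = (\<lambda>P. (- 1) * divisor_of y P)"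
    by (rule ext) (simp add: divisor_of_def place_val_inverse y)
  then have "deg (divisor_of (inverse y)) = - deg (divisor_of y)"
    using deg_scale[OF divisor_divisor_of[OF y], of "- 1"] by simp
  then show ?thesis using deg_divisor_of_le[OF y] deg_divisor_of_le[of "inverse y"] y by simp
qed

lemma RR_eq_zero:
  assumes A: "divisor A" "deg A < 0" and f: "f \<in> RR A" shows "f = 0"
proof (rule ccontr)
  assume f0: "f \<noteq> 0"
  have "A P + divisor_of f P \<ge> 0" for P
  proof (cases "P \<in> places")
    case True
    then show ?thesis using f f0 by (force simp: RR_def LS_def vge_def divisor_of_def)
  next
    case False
    then have "A P = 0" using divisorD(2)[OF A(1)] by blast
    then show ?thesis using False by (simp add: divisor_of_def)
  qed
  then have "deg (\<lambda>P. A P + divisor_of f P) \<ge> 0" by (rule deg_nonneg)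
  then show False
    using deg_add[OF A(1) divisor_divisor_of[OF f0]] deg_divisor_of[OF f0] A(2) by simp
qed

section \<open>Translation to the given divisors and the genus\<close>

lemma RR_space_eq: "RR_space emb G = RR (Poly_Mapping.lookup G)"
  by (auto simp: RR_space_def RR_def LS_def vge_def places_def)

lemma RR_dim_eq: "RR_dim emb G = ell (Poly_Mapping.lookup G)"
  by (simp add: RR_dim_def ell_def RR_space_eq)

lemma divisor_lookup: "is_divisor emb G \<longleftrightarrow> divisor (Poly_Mapping.lookup G)"
  by (auto simp: is_divisor_def divisor_def places_def in_keys_iff)

lemma div_degree_eq: "div_degree emb G = deg (Poly_Mapping.lookup G)"
  by (simp add: div_degree_def deg_def keys.rep_eq)

text \<open>\<open>GREATEST\<close> requires an attained maximum. The zero divisor gives the value 0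
  and all values are bounded, so the maximum is that of a finite nonempty set of nonnegative
  integers.\<close>

lemma genus_greatest:
  obtains A where "divisor A" "chi A = genus emb - 1" "\<And>B. divisor B \<Longrightarrow> chi B \<le> genus emb - 1"
proof -
  obtain c where c: "\<And>A. divisor A \<Longrightarrow> chi A \<le> c" using chi_bounded by blast
  let ?Q = "\<lambda>k. \<exists>A. divisor A \<and> k = chi A + 1"
  have "(\<exists>G. is_divisor emb G \<and> k = div_degree emb G - int (RR_dim emb G) + 1) \<longleftrightarrow> ?Q k" for k
  proof
    assume "\<exists>G. is_divisor emb G \<and> k = div_degree emb G - int (RR_dim emb G) + 1"
    then show "?Q k"
      by (auto simp: divisor_lookup div_degree_eq RR_dim_eq chi_def)
  next
    assume "?Q k"
    then obtain A where A: "divisor A" "k = chi A + 1" by blast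
    have "Poly_Mapping.lookup (Abs_poly_mapping A) = A"
      using divisorD(1)[OF A(1)] by (simp add: Abs_poly_mapping_inverse)
    then show "\<exists>G. is_divisor emb G \<and> k = div_degree emb G - int (RR_dim emb G) + 1"
      using A by (intro exI[of _ "Abs_poly_mapping A"])
        (simp add: divisor_lookup div_degree_eq RR_dim_eq chi_def)
  qed
  then have g: "genus emb = (GREATEST k. ?Q k)" unfolding genus_def by simp
  have bd: "k \<le> c + 1" if k: "?Q k" for k
  proof -
    obtain A where "divisor A" "k = chi A + 1" using k by blast
    then show ?thesis using c[of A] by simp
  qed
  define T where "T = {k. ?Q k \<and> k \<ge> 0}"
  have "0 \<in> T" unfolding T_def using divisor_zero chi_zero by force
  moreover have "T \<subseteq> {0..c + 1}"
  proof
    fix k assume "k \<in> T"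
    then have "?Q k" "0 \<le> k" unfolding T_def by blast+
    then show "k \<in> {0..c + 1}" using bd[of k] by simp
  qed
  then have "finite T" by (rule finite_subset) simp
  ultimately have "Max T \<in> T" "\<And>k. k \<in> T \<Longrightarrow> k \<le> Max T" by (auto intro: Max_in)
  then have "?Q (Max T)" "\<And>k. ?Q k \<Longrightarrow> k \<le> Max T" unfolding T_def by force+
  then have "?Q (genus emb)" "\<And>k. ?Q k \<Longrightarrow> k \<le> genus emb"
    unfolding g by (simp_all only: Greatest_equality[of ?Q "Max T"])
  then show thesis using that by force
qed

end

section \<open>The index of speciality\<close>

text \<open>Count the pairs \<open>(f, w)\<close> with \<open>f w \<in> Y\<^sub>0\<close>, where \<open>f \<in> L\<close> and \<open>w\<close> runs through representatives
  of \<open>W\<close> modulo \<open>W\<^sub>0\<close>, once by \<open>f\<close> and once by \<open>w\<close>. This replaces the argument with Weil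
  differentials, which would need the dual of \<open>W / W\<^sub>0\<close>.\<close>

lemma card_le_idx_of_pairing:
  fixes L W W0 Y Y0 :: "'f :: field set"
  assumes sub: "add_subgroup L" "add_subgroup W" "add_subgroup W0" "add_subgroup Y" "add_subgroup Y0"
    and "finite L" "W0 \<subseteq> W" and V: "idx W0 W \<noteq> 0" and M: "idx Y0 Y > 1"
    and WY: "\<And>f v. f \<in> L \<Longrightarrow> v \<in> W \<Longrightarrow> f * v \<in> Y"
    and WY0: "\<And>f v. f \<in> L \<Longrightarrow> v \<in> W0 \<Longrightarrow> f * v \<in> Y0"
    and surj: "\<And>f y. f \<in> L \<Longrightarrow> f \<noteq> 0 \<Longrightarrow> y \<in> Y \<Longrightarrow> \<exists>v\<in>W. y - f * v \<in> Y0"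
  shows "card L \<le> idx W0 W"
proof -
  let ?M = "idx Y0 Y" and ?V = "idx W0 W"
  obtain R where R: "finite R" "R \<subseteq> W" "card R = ?V"
    "\<And>b. b \<in> W \<Longrightarrow> \<exists>r\<in>R. b - r \<in> W0"
    "\<And>r r'. r \<in> R \<Longrightarrow> r' \<in> R \<Longrightarrow> r - r' \<in> W0 \<Longrightarrow> r = r'"
    using idx_reps[OF sub(3) V] by blast
  define N where "N = (\<Sum>f\<in>L. card {v \<in> R. f * v \<in> Y0})"
  have zL: "0 \<in> L" and z0: "0 \<in> Y0" "0 \<in> W0" "0 \<in> W"
    using sub by (simp_all add: add_subgroup_zero)
  \<comment> \<open>For nonzero \<open>f\<close>, multiplication maps W/W0 onto Y/Y0, so its kernel
    has index \<open>?M\<close>; the counted \<open>v\<close> represent this kernel modulo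
    \<open>W0\<close>.\<close>
  have fibre_f: "card {v \<in> R. f * v \<in> Y0} * ?M = ?V" if f: "f \<in> L" "f \<noteq> 0" for f
  proof -
    define Wf where "Wf = {v \<in> W. f * v \<in> Y0}"
    have Wf: "add_subgroup Wf"
      unfolding add_subgroup_def Wf_def
      using z0 add_subgroup_diff[OF sub(2)] add_subgroup_diff[OF sub(5)]
      by (auto simp: right_diff_distrib)
    have inc: "W0 \<subseteq> Wf" "Wf \<subseteq> W" using assms(7) WY0[OF f(1)] by (auto simp: Wf_def)
    have "idx Wf W = ?M"
    proof (rule idx_eq_of_map[OF Wf sub(5), where f = "(*) f"])
      fix u v assume "u \<in> W" "v \<in> W"
      then show "f * u - f * v \<in> Y0 \<longleftrightarrow> u - v \<in> Wf"
        using add_subgroup_diff[OF sub(2)] by (simp add: Wf_def right_diff_distrib)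
    qed (use WY[OF f(1)] surj[OF f] in auto)
    moreover have "idx W0 Wf = card {v \<in> R. f * v \<in> Y0}"
    proof -
      have RW: "{v \<in> R. f * v \<in> Y0} = R \<inter> Wf" using R(2) by (auto simp: Wf_def)
      have inj: "inj_on (coset W0) (R \<inter> Wf)"
        by (rule inj_onI) (use R(5) coset_eq_iff[OF sub(3)] in blast)
      have "coset W0 ` Wf \<subseteq> coset W0 ` (R \<inter> Wf)"
      proof (rule image_subsetI)
        fix v assume v: "v \<in> Wf"
        then obtain r where r: "r \<in> R" "v - r \<in> W0" using R(4) inc(2) by blast
        have "v - (v - r) \<in> Wf" by (rule add_subgroup_diff[OF Wf v subsetD[OF inc(1) r(2)]])
        then have "r \<in> R \<inter> Wf" using r(1) by simp
        moreover have "coset W0 v = coset W0 r" using r(2) coset_eq_iff[OF sub(3)] by simp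
        ultimately show "coset W0 v \<in> coset W0 ` (R \<inter> Wf)" by (rule rev_image_eqI)
      qed
      then have "coset W0 ` Wf = coset W0 ` (R \<inter> Wf)" by auto
      then show ?thesis unfolding idx_def RW using inj by (simp add: card_image)
    qed
    ultimately show ?thesis using idx_trans[OF sub(3) Wf sub(2) inc] by simp
  qed
  have "N * ?M = (\<Sum>f\<in>L. card {v \<in> R. f * v \<in> Y0} * ?M)" unfolding N_def sum_distrib_right ..
  also have "\<dots> = card {v \<in> R. 0 * v \<in> Y0} * ?M + (\<Sum>f\<in>L - {0}. card {v \<in> R. f * v \<in> Y0} * ?M)"
    using assms(6) zL by (rule sum.remove)
  also have "(\<Sum>f\<in>L - {0}. card {v \<in> R. f * v \<in> Y0} * ?M) = (\<Sum>f\<in>L - {0}. ?V)"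
    by (rule sum.cong) (use fibre_f in auto)
  also have "card {v \<in> R. 0 * v \<in> Y0} = ?V" using z0 R(3) by simp
  also have "(\<Sum>f\<in>L - {0}. ?V) = (card L - 1) * ?V" using zL assms(6) by simp
  finally have upper: "N * ?M = ?V * ?M + (card L - 1) * ?V" .
  have "N = (\<Sum>v\<in>R. card {f \<in> L. f * v \<in> Y0})"
  proof -
    have "N = (\<Sum>f\<in>L. \<Sum>v\<in>R. if f * v \<in> Y0 then 1 else 0)"
      unfolding N_def by (rule sum.cong) (use R(1) in \<open>auto simp: sum.If_cases Int_def\<close>)
    also have "\<dots> = (\<Sum>v\<in>R. \<Sum>f\<in>L. if f * v \<in> Y0 then 1 else 0)" by (rule sum.swap)
    also have "\<dots> = (\<Sum>v\<in>R. card {f \<in> L. f * v \<in> Y0})"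
      by (rule sum.cong) (use assms(6) in \<open>auto simp: sum.If_cases Int_def\<close>)
    finally show ?thesis .
  qed
  then have e1: "N * ?M = (\<Sum>v\<in>R. card {f \<in> L. f * v \<in> Y0} * ?M)" by (simp add: sum_distrib_right)
  obtain r0 where r0: "r0 \<in> R" "0 - r0 \<in> W0" using R(4)[OF z0(3)] by blast
  have e2: "(\<Sum>v\<in>R. card {f \<in> L. f * v \<in> Y0} * ?M)
      = card {f \<in> L. f * r0 \<in> Y0} * ?M + (\<Sum>v\<in>R - {r0}. card {f \<in> L. f * v \<in> Y0} * ?M)"
    using R(1) r0(1) by (rule sum.remove)
  have e3: "card {f \<in> L. f * r0 \<in> Y0} = card L"
  proof -
    have "r0 \<in> W0" using add_subgroup_minus[OF sub(3) r0(2)] by simp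
    then have "{f \<in> L. f * r0 \<in> Y0} = L" using WY0 by blast
    then show ?thesis by simp
  qed
  \<comment> \<open>For \<open>v\<close> not representing zero only an inequality is available: the
    kernel of f \<mapsto> f v modulo \<open>Y0\<close> has index at most \<open>?M\<close> in
    \<open>L\<close>.\<close>
  have ge: "(\<Sum>v\<in>R - {r0}. card {f \<in> L. f * v \<in> Y0} * ?M) \<ge> (\<Sum>v\<in>R - {r0}. card L)"
  proof (rule sum_mono)
    fix v assume "v \<in> R - {r0}"
    then have v: "v \<in> W" using R(2) by blast
    define Lv where "Lv = {f \<in> L. f * v \<in> Y0}"
    have Lv: "add_subgroup Lv"
      unfolding add_subgroup_def Lv_def
      using z0 zL add_subgroup_diff[OF sub(1)] add_subgroup_diff[OF sub(5)]
      by (auto simp: left_diff_distrib)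
    have "idx Lv L \<le> ?M"
    proof (rule idx_le_of_map[OF Lv sub(5), where f = "\<lambda>f. f * v"])
      fix f h assume "f \<in> L" "h \<in> L"
      then show "f * v - h * v \<in> Y0 \<longleftrightarrow> f - h \<in> Lv"
        using add_subgroup_diff[OF sub(1)] by (simp add: Lv_def left_diff_distrib)
    qed (use WY v M in auto)
    then have "card Lv * idx Lv L \<le> card Lv * ?M" by (rule mult_left_mono) simp
    moreover have "card L = card Lv * idx Lv L"
      by (rule card_eq_card_mult_idx[OF Lv sub(1)]) (auto simp: Lv_def)
    ultimately show "card L \<le> card {f \<in> L. f * v \<in> Y0} * ?M" by (simp add: Lv_def)
  qed
  have e4: "(\<Sum>v\<in>R - {r0}. card L) = (?V - 1) * card L" using r0(1) R(1,3) by simp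
  have lower: "N * ?M \<ge> card L * ?M + (?V - 1) * card L"
    unfolding e1 e2 e3 e4[symmetric] using ge by (rule add_left_mono)
  have "card L \<noteq> 0" using zL assms(6) by auto
  then obtain l where l: "card L = Suc l" by (cases "card L") auto
  obtain v where v: "?V = Suc v" using V by (cases ?V) auto
  obtain m where m: "?M = Suc (Suc m)" using M by (cases ?M; cases "?M - 1") auto
  \<comment> \<open>Cancelling the common term |L| V leaves |L| (M - 1) \<le> V (M - 1), where M > 1
    permits division.\<close>
  have "Suc l * Suc (Suc m) + v * Suc l \<le> Suc v * Suc (Suc m) + l * Suc v"
    using lower unfolding upper unfolding l v m by simp
  then have "Suc l * Suc m \<le> Suc v * Suc m" by (simp add: algebra_simps)
  then show ?thesis unfolding l v by (simp only: mult_le_cancel2)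
qed

context function_field_basis
begin

text \<open>The exponent is i(A) - i(B): the full index accounts for deg B - deg A, and by the
  second isomorphism theorem the part generated by \<open>RR B\<close> accounts for
  \<open>ell B - ell A\<close>. When \<open>B\<close> maximises \<open>chi\<close>, the index is
  q^i(A), the size of the adelic quotient.\<close>

lemma idx_sumset_LS_RR:
  assumes S: "finite S" "S \<subseteq> places" and AB: "\<And>P. A P \<le> B P"
    and supp: "\<And>P. P \<notin> S \<Longrightarrow> A P = 0" "\<And>P. P \<notin> S \<Longrightarrow> B P = 0"
  shows "idx (sumset (LS S A) (RR B)) (LS S B) = q ^ nat (chi B - chi A)"
proof -
  have A: "divisor A" and B: "divisor B" using S supp by (auto intro: divisorI)
  have sA: "add_subgroup (LS S A)" and sB: "add_subgroup (LS S B)" using add_subgroup_LS[OF S(2)] by auto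
  have RB: "RR B \<subseteq> LS S B" using S(2) by (auto simp: LS_def RR_def)
  have AB': "LS S A \<subseteq> LS S B" by (rule LS_mono) (rule AB)
  note d = idx_LS_deg[of S A B, OF S AB supp]
  have ss: "sumset (LS S A) (RR B) \<subseteq> LS S B" by (rule sumset_least[OF sB AB' RB])
  have "q ^ nat (deg B - deg A) = idx (LS S A) (LS S B)" using d by simp
  also have "\<dots> = idx (LS S A) (sumset (LS S A) (RR B)) * idx (sumset (LS S A) (RR B)) (LS S B)"
    by (intro idx_trans sA sB add_subgroup_sumset add_subgroup_RR ss subset_sumset1)
  also have "idx (LS S A) (sumset (LS S A) (RR B)) = idx (RR A) (RR B)"
    using idx_sumset[OF sA add_subgroup_RR] LS_Int_RR[of S A B] AB S(2) supp by simp
  finally have "q ^ ell A * q ^ nat (deg B - deg A)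
      = (q ^ ell A * idx (RR A) (RR B)) * idx (sumset (LS S A) (RR B)) (LS S B)"
    by simp
  also have "q ^ ell A * idx (RR A) (RR B) = q ^ ell B" using card_RR_mult_idx[OF A B AB] by simp
  finally have *: "q ^ (ell A + nat (deg B - deg A)) = q ^ ell B * idx (sumset (LS S A) (RR B)) (LS S B)"
    by (simp add: power_add)
  have "ell A + nat (deg B - deg A) = ell B + nat (chi B - chi A)"
    using d chi_mono[OF A B AB] unfolding chi_def by simp
  then have "q ^ ell B * q ^ nat (chi B - chi A) = q ^ ell B * idx (sumset (LS S A) (RR B)) (LS S B)"
    using * by (simp add: power_add)
  then show ?thesis using q_gt_1 by simp
qed

text \<open>If \<open>A\<close> is special, multiplication pairs \<open>L(A)\<close> with a space of dimension \<open>i(0) = g\<close> and takes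
  values in a nonzero space of dimension \<open>i(A)\<close>; each nonzero \<open>f \<in> L(A)\<close> acts surjectively.\<close>

lemma ell_le_genus_of_special:
  assumes A: "divisor A" and special: "chi A < genus emb - 1"
  shows "int (ell A) \<le> genus emb"
proof -
  obtain A0 where A0: "divisor A0" "chi A0 = genus emb - 1"
    and max: "\<And>B. divisor B \<Longrightarrow> chi B \<le> genus emb - 1"
    using genus_greatest by blast
  \<comment> \<open>Both \<open>E\<close> and B = E + A dominate \<open>A0\<close>, so both attain
    the maximum of \<open>chi\<close>, that is, have i = 0. The absolute values also give E \<ge> 0
    and B \<ge> A.\<close>
  define E where "E P = \<bar>A0 P\<bar> + \<bar>A P\<bar>" for P
  define B where "B = (\<lambda>P. E P + A P)"
  have E: "divisor E" unfolding E_def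
    by (rule divisor_combine[OF A0(1) A, of "\<lambda>a b. \<bar>a\<bar> + \<bar>b\<bar>"]) simp
  have B: "divisor B" unfolding B_def by (rule divisor_combine[OF E A]) simp
  have chiE: "chi E = genus emb - 1" and chiB: "chi B = genus emb - 1"
    using chi_mono[OF A0(1) E] chi_mono[OF A0(1) B] max[OF E] max[OF B] A0(2)
    by (force simp: E_def B_def)+
  have E0: "E P \<ge> 0" and EB: "A P \<le> B P" for P by (simp_all add: E_def B_def)
  \<comment> \<open>\<open>S\<close> also contains the supports of all nonzero f in L(A), finitely
    many functions, so that every E - (f) is supported in \<open>S\<close>.\<close>
  define S where "S = {P. A P \<noteq> 0} \<union> {P. E P \<noteq> 0} \<union> {P. B P \<noteq> 0} \<union>
      (\<Union>f\<in>RR A - {0}. {P. divisor_of f P \<noteq> 0})"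
  have S: "finite S" "S \<subseteq> places"
    unfolding S_def using divisorD[OF A] divisorD[OF E] divisorD[OF B] finite_RR[OF A]
      divisorD[OF divisor_divisor_of] by (auto simp: divisor_of_def split: if_splits)
  have suppA: "A P = 0" and suppE: "E P = 0" and suppB: "B P = 0" if "P \<notin> S" for P
    using that by (auto simp: S_def)
  let ?W = "LS S E" and ?Wz = "sumset (LS S (\<lambda>_. 0)) (RR E)"
  let ?Y = "LS S B" and ?Yz = "sumset (LS S A) (RR B)"
  note sLS = add_subgroup_LS[OF S(2)]
  have idxW: "idx ?Wz ?W = q ^ nat (genus emb)"
    using idx_sumset_LS_RR[OF S, of "\<lambda>_. 0" E] E0 suppE chiE chi_zero by simp
  have idxY: "idx ?Yz ?Y = q ^ nat (genus emb - 1 - chi A)"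
    using idx_sumset_LS_RR[OF S, of A B] EB suppA suppB chiB by simp
  have le: "E P - divisor_of f P \<le> B P" if "f \<in> RR A" "f \<noteq> 0" for f P
  proof (cases "P \<in> places")
    case True
    then have "vge P f (- A P)" using that(1) by (auto simp: RR_def LS_def)
    then show ?thesis using that(2) True by (simp add: vge_def divisor_of_def B_def)
  next
    case False
    then have "A P = 0" using divisorD(2)[OF A] by blast
    then show ?thesis using False by (simp add: divisor_of_def B_def)
  qed
  have mult: "f * v \<in> LS S' (\<lambda>P. D P + A P)" if "f \<in> RR A" "v \<in> LS S' D" "S' \<subseteq> places" for f v D S'
  proof -
    have "vge P (f * v) (- (D P + A P))" if "P \<in> S'" for P
    proof -
      have "P \<in> places" "vge P f (- A P)" "vge P v (- D P)"
        using that \<open>f \<in> RR A\<close> \<open>v \<in> LS S' D\<close> \<open>S' \<subseteq> places\<close> by (auto simp: RR_def LS_def)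
      from vge_mult[OF this] show ?thesis by (simp add: add.commute)
    qed
    then show ?thesis by (simp add: LS_def)
  qed
  have "card (RR A) \<le> idx ?Wz ?W"
  proof (rule card_le_idx_of_pairing[where Y = ?Y and Y0 = ?Yz])
    show "?Wz \<subseteq> ?W"
      using S(2) E0 by (intro sumset_least sLS LS_mono) (auto simp: LS_def RR_def)
    show "idx ?Wz ?W \<noteq> 0" unfolding idxW using q_gt_1 by simp
    have "nat (genus emb - 1 - chi A) \<noteq> 0" using special by simp
    then show "idx ?Yz ?Y > 1" unfolding idxY using one_less_power[OF q_gt_1] by blast
    show "f * v \<in> ?Y" if "f \<in> RR A" "v \<in> ?W" for f v
      using mult[OF that S(2)] by (simp add: B_def)
    show "f * v \<in> ?Yz" if f: "f \<in> RR A" and v: "v \<in> ?Wz" for f v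
    proof -
      obtain a b where ab: "v = a + b" "a \<in> LS S (\<lambda>_. 0)" "b \<in> RR E" using v by (rule sumsetE)
      have "f * a \<in> LS S A" using mult[OF f ab(2) S(2)] by simp
      moreover have "f * b \<in> RR B"
        using mult[OF f, of b places E] ab(3) by (simp add: RR_def B_def)
      ultimately have "f * a + f * b \<in> ?Yz" by (rule sumsetI)
      then show ?thesis by (simp add: ab(1) distrib_left)
    qed
    show "\<exists>v\<in>?W. y - f * v \<in> ?Yz" if f: "f \<in> RR A" "f \<noteq> 0" and y: "y \<in> ?Y" for f y
    proof -
      let ?D = "\<lambda>P. E P - divisor_of f P"
      have D: "divisor ?D" by (rule divisor_combine[OF E divisor_divisor_of[OF f(2)], of "(-)"]) simp
      have "divisor_of f P = 0" if "P \<notin> S" for P using that f by (auto simp: S_def)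
      then have suppD: "?D P = 0" if "P \<notin> S" for P using that suppE by simp
      \<comment> \<open>E - (f) is equivalent to \<open>E\<close>, hence again maximal for
        \<open>chi\<close>; the index below is q^0, so f \<open>?W\<close> together with
        \<open>RR B\<close> fills \<open>?Y\<close>. This is the surjectivity of multiplication by
        \<open>f\<close>.\<close>
      have "chi ?D = chi E"
        using ell_mult[OF E f(2)] deg_diff[OF E divisor_divisor_of[OF f(2)]] deg_divisor_of[OF f(2)]
        by (simp add: chi_def)
      then have "idx (sumset (LS S ?D) (RR B)) ?Y = 1"
        using idx_sumset_LS_RR[OF S, of ?D B] le[OF f] suppD suppB chiE chiB by simp
      moreover have "sumset (LS S ?D) (RR B) \<subseteq> ?Y"
        using S(2) le[OF f] by (intro sumset_least sLS LS_mono) (auto simp: LS_def RR_def)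
      ultimately have "sumset (LS S ?D) (RR B) = ?Y"
        by (intro idx_eq_one_imp add_subgroup_sumset sLS add_subgroup_RR)
      then have "y \<in> sumset (LS S ?D) (RR B)" using y by (simp only:)
      then obtain a b where ab: "y = a + b" "a \<in> LS S ?D" "b \<in> RR B" by (rule sumsetE)
      obtain v where v: "v \<in> ?W" "a = f * v" using ab(2) LS_mult[OF S(2) f(2), of E] by blast
      have "y - f * v \<in> ?Yz"
        using ab v subset_sumset2[OF sLS[of A], of "RR B"] by auto
      then show ?thesis using v(1) by blast
    qed
  qed (use sLS add_subgroup_RR finite_RR[OF A] in \<open>auto intro: add_subgroup_sumset\<close>)
  then have "q ^ ell A \<le> q ^ nat (genus emb)" unfolding card_RR[OF A] idxW .
  then have "ell A \<le> nat (genus emb)" using q_gt_1 by (simp only: power_increasing_iff)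
  moreover have "genus emb \<ge> 0" using max[OF divisor_zero] chi_zero by simp
  ultimately show ?thesis by simp
qed

text \<open>A special \<open>A\<close> would have chi A \<le> g - 2 and \<open>ell A\<close> \<le>
  g, so deg A = chi A + ell A \<le> 2 g - 2.\<close>

lemma Riemann_Roch_nonspecial:
  assumes A: "divisor A" and deg: "deg A \<ge> 2 * genus emb - 1"
  shows "int (ell A) = deg A + 1 - genus emb"
proof -
  have "chi A \<le> genus emb - 1" using genus_greatest A by metis
  moreover have "\<not> chi A < genus emb - 1"
    using ell_le_genus_of_special[OF A] deg unfolding chi_def by linarith
  ultimately show ?thesis unfolding chi_def by linarith
qed

end

section \<open>Codes\<close>

lemma finite_carrier_vec: "finite (carrier_vec n :: 'q :: finite vec set)"
proof -
  have "carrier_vec n \<subseteq> vec_of_list ` {xs :: 'q list. set xs \<subseteq> UNIV \<and> length xs = n}"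
  proof
    fix v :: "'q vec" assume "v \<in> carrier_vec n"
    then show "v \<in> vec_of_list ` {xs. set xs \<subseteq> UNIV \<and> length xs = n}"
      by (intro image_eqI[of _ _ "list_of_vec v"]) (auto simp: vec_list)
  qed
  then show ?thesis by (rule finite_subset) (intro finite_imageI finite_lists_length_eq finite)
qed

lemma linear_codeI:
  fixes C :: "'q :: field vec set"
  assumes "C \<subseteq> carrier_vec n" "0\<^sub>v n \<in> C" "\<And>c c'. c \<in> C \<Longrightarrow> c' \<in> C \<Longrightarrow> c + c' \<in> C"
    "\<And>a c. c \<in> C \<Longrightarrow> a \<cdot>\<^sub>v c \<in> C"
  shows "linear_code n C"
proof -
  have vs: "vectorspace class_ring (module_vec TYPE('q) n)" by (rule vec_vs)
  have "LinearCombinations.submodule class_ring C (module_vec TYPE('q) n)"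
    using assms by (intro LinearCombinations.submodule.intro vectorspace.axioms(1)[OF vs])
      (simp_all add: module_vec_simps)
  then show ?thesis unfolding linear_code_def using vs by (intro VectorSpace.subspace.intro)
qed

lemma card_linear_code:
  fixes C :: "'q :: {field, finite} vec set"
  assumes "linear_code n C"
  shows "card C = card (UNIV :: 'q set) ^ code_dim n C"
proof -
  have sub: "VectorSpace.subspace class_ring C (module_vec TYPE('q) n)"
    using assms by (simp add: linear_code_def)
  have "vectorspace class_ring ((module_vec TYPE('q) n)\<lparr>carrier := C\<rparr>)"
    by (rule vectorspace.subspace_is_vs[OF vec_vs sub])
  moreover have "C \<subseteq> carrier_vec n"
    using LinearCombinations.submodule.subset[OF subspace.submod[OF sub]] by (simp add: module_vec_simps)
  then have "finite C" using finite_carrier_vec by (rule finite_subset)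
  ultimately show ?thesis using card_vectorspace[of "(module_vec TYPE('q) n)\<lparr>carrier := C\<rparr>"]
    by (simp add: code_dim_def)
qed

section \<open>The single parity check code\<close>

lemma parity_codeD:
  "c \<in> parity_code r \<Longrightarrow> dim_vec c = r + 1"
  "c \<in> parity_code r \<Longrightarrow> (\<Sum>i<r + 1. c $ i) = 0"
  by (auto simp: parity_code_def)

lemma linear_code_parity: "linear_code (r + 1) (parity_code r)"
proof (rule linear_codeI)
  show "0\<^sub>v (r + 1) \<in> parity_code r" by (simp add: parity_code_def)
  fix c c' :: "'a vec" and a :: 'a assume c: "c \<in> parity_code r"
  note d = parity_codeD[OF c]
  have "(\<Sum>i<r + 1. (a \<cdot>\<^sub>v c) $ i) = a * (\<Sum>i<r + 1. c $ i)"
    unfolding sum_distrib_left by (rule sum.cong) (use d in auto)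
  then show "a \<cdot>\<^sub>v c \<in> parity_code r"
    using c unfolding d(2) parity_code_def by (simp del: sum.lessThan_Suc)
  assume c': "c' \<in> parity_code r"
  note d' = parity_codeD[OF c']
  have "(\<Sum>i<r + 1. (c + c') $ i) = (\<Sum>i<r + 1. c $ i) + (\<Sum>i<r + 1. c' $ i)"
    unfolding sum.distrib[symmetric] by (rule sum.cong) (use d' in auto)
  then show "c + c' \<in> parity_code r"
    using c c' unfolding d(2) d'(2) parity_code_def by (simp del: sum.lessThan_Suc)
qed (auto simp: parity_code_def)

text \<open>The first \<open>r\<close> coordinates are free, and the last is minus their
  sum.\<close>

lemma card_parity_code:
  "card (parity_code r :: 'q :: {field, finite} vec set) = card (UNIV :: 'q set) ^ r"
proof -
  let ?L = "{xs :: 'q list. set xs \<subseteq> UNIV \<and> length xs = r}"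
  let ?f = "\<lambda>xs :: 'q list. vec_of_list (xs @ [- sum_list xs])"
  have inj: "inj_on ?f ?L"
  proof (rule inj_onI)
    fix xs ys assume "?f xs = ?f ys"
    then have "list_of_vec (?f xs) = list_of_vec (?f ys)" by (rule arg_cong)
    then have "xs @ [- sum_list xs] = ys @ [- sum_list ys]" unfolding list_vec .
    then show "xs = ys" by simp
  qed
  have img: "?f ` ?L = parity_code r"
  proof
    have "?f xs \<in> parity_code r" if "length xs = r" for xs :: "'q list"
    proof -
      let ?l = "xs @ [- sum_list xs]"
      have l: "length ?l = r + 1" using that by simp
      have "(\<Sum>i<r + 1. ?f xs $ i) = (\<Sum>i<r + 1. ?l ! i)" unfolding vec_of_list_index ..
      also have "\<dots> = sum_list ?l"
        using sum_list_sum_nth[of ?l] unfolding l atLeast0LessThan by (rule sym)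
      also have "\<dots> = 0" by simp
      finally show ?thesis
        unfolding parity_code_def mem_Collect_eq by (intro conjI carrier_vecI) (simp_all only: dim_vec_of_list l)
    qed
    then show "?f ` ?L \<subseteq> parity_code r" by auto
    show "parity_code r \<subseteq> ?f ` ?L"
    proof
      fix c :: "'q vec" assume c: "c \<in> parity_code r"
      note d = parity_codeD[OF c]
      define xs where "xs = map (($) c) [0..<r]"
      have l: "list_of_vec c = xs @ [c $ r]" unfolding list_of_vec_map d(1) xs_def by simp
      have "sum_list xs = (\<Sum>i<r. c $ i)"
        by (simp add: xs_def sum_list_sum_nth atLeast0LessThan)
      then have "c $ r = - sum_list xs" using d(2) by (simp add: eq_neg_iff_add_eq_0 add.commute)
      then have "c = ?f xs" using l vec_list[of c] by metis
      then show "c \<in> ?f ` ?L" by (rule image_eqI) (simp add: xs_def)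
    qed
  qed
  have "card (parity_code r :: 'q vec set) = card ?L"
    unfolding img[symmetric] by (rule card_image[OF inj])
  also have "\<dots> = card (UNIV :: 'q set) ^ r" by (rule card_lists_length_eq) simp
  finally show ?thesis .
qed

lemma code_dim_parity: "code_dim (r + 1) (parity_code r :: 'q :: {field, finite} vec set) = r"
proof -
  have "card {0 :: 'q, 1} \<le> card (UNIV :: 'q set)" by (rule card_mono) simp_all
  then have "card (UNIV :: 'q set) > 1" by simp
  moreover have "card (UNIV :: 'q set) ^ r
      = card (UNIV :: 'q set) ^ code_dim (r + 1) (parity_code r :: 'q vec set)"
    unfolding card_parity_code[of r, symmetric] by (rule card_linear_code[OF linear_code_parity])
  ultimately show ?thesis by (simp only: power_inject_exp)
qed

text \<open>If the words differed in a single coordinate, the difference there would be the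
  difference of the coordinate sums, which is zero.\<close>

lemma hamming_dist_parity:
  assumes c: "c \<in> parity_code r" and c': "c' \<in> parity_code r" and "c \<noteq> c'"
  shows "card {j. j < r + 1 \<and> c $ j \<noteq> c' $ j} \<ge> 2"
proof -
  let ?D = "{j. j < r + 1 \<and> c $ j \<noteq> c' $ j}"
  note d = parity_codeD[OF c] parity_codeD[OF c']
  have fin: "finite ?D" by simp
  have "?D \<noteq> {}"
  proof
    assume "?D = {}"
    then have "c = c'" using d(1,3) by (intro eq_vecI) auto
    with assms(3) show False by simp
  qed
  then obtain j where j: "j \<in> ?D" by blast
  have "?D \<noteq> {j}"
  proof
    assume D: "?D = {j}"
    have "(\<Sum>i<r + 1. c $ i - c' $ i) = 0" unfolding sum_subtractf d by simp
    moreover have "(\<Sum>i<r + 1. c $ i - c' $ i) = (\<Sum>i<r + 1. if i = j then c $ j - c' $ j else 0)"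
      by (rule sum.cong) (use D in auto)
    ultimately show False using j by (simp del: sum.lessThan_Suc)
  qed
  then have "{j} \<subset> ?D" using j by blast
  then have "card {j} < card ?D" by (rule psubset_card_mono[OF fin])
  then show ?thesis by simp
qed

lemma min_distance_parity:
  assumes "r > 1" shows "min_distance (parity_code r :: 'q :: {field, finite} vec set) = 2"
  unfolding min_distance_def
proof (rule Min_eqI)
  let ?P = "parity_code r :: 'q vec set"
  let ?H = "{hamming_dist c c' | c c'. c \<in> ?P \<and> c' \<in> ?P \<and> c \<noteq> c'}"
  have H: "hamming_dist c c' = card {j. j < r + 1 \<and> c $ j \<noteq> c' $ j}" if "c \<in> ?P" for c c'
    using parity_codeD(1)[OF that] by (simp add: hamming_dist_def)
  have "hamming_dist c c' \<le> r + 1" if "c \<in> ?P" for c c'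
    unfolding H[OF that] by (rule order_trans[OF card_mono[of "{..<r + 1}"]]) auto
  then have "?H \<subseteq> {..r + 1}" by blast
  then show "finite ?H" by (rule finite_subset) simp
  show "2 \<le> y" if y: "y \<in> ?H" for y
  proof -
    obtain c c' where c: "y = hamming_dist c c'" "c \<in> ?P" "c' \<in> ?P" "c \<noteq> c'" using y by blast
    show ?thesis unfolding c(1) H[OF c(2)] by (rule hamming_dist_parity[OF c(2-4)])
  qed
  \<comment> \<open>The word (1, -1, 0, ..., 0) of weight 2.\<close>
  define e :: "'q vec" where "e = vec (r + 1) (\<lambda>i. if i = 0 then 1 else if i = 1 then - 1 else 0)"
  have "(\<Sum>i<r + 1. e $ i) = (\<Sum>i\<in>{0, 1}. e $ i)"
    by (rule sum.mono_neutral_right) (use assms in \<open>auto simp: e_def\<close>)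
  then have e: "e \<in> ?P" using assms by (simp add: parity_code_def e_def)
  moreover have z: "0\<^sub>v (r + 1) \<in> ?P" by (simp add: parity_code_def)
  moreover have D: "{j. j < r + 1 \<and> e $ j \<noteq> 0\<^sub>v (r + 1) $ j} = {0, 1}"
    using assms by (auto simp: e_def split: if_splits)
  then have "hamming_dist e (0\<^sub>v (r + 1)) = 2" unfolding H[OF e] by simp
  moreover have "e \<noteq> 0\<^sub>v (r + 1)" using D by auto
  ultimately show "2 \<in> ?H" by (metis (mono_tags, lifting) mem_Collect_eq)
qed

section \<open>Block structure and parameters of the generalized code\<close>

lemma length_concat_uniform:
  "(\<And>l. l \<in> set ls \<Longrightarrow> length l = m) \<Longrightarrow> length (concat ls) = length ls * m"
  by (induction ls) auto

lemma nth_concat_uniform: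
  "(\<And>l. l \<in> set ls \<Longrightarrow> length l = m) \<Longrightarrow> i < length ls \<Longrightarrow> j < m \<Longrightarrow>
    concat ls ! (i * m + j) = ls ! i ! j"
proof (induction ls arbitrary: i)
  case (Cons l ls)
  show ?case
  proof (cases i)
    case 0
    then show ?thesis using Cons.prems by (simp add: nth_append)
  next
    case (Suc i')
    have "concat ls ! (i' * m + j) = ls ! i' ! j"
      using Cons.prems Suc by (intro Cons.IH) auto
    then show ?thesis using Cons.prems(1)[of l] Suc by (simp add: nth_append)
  qed
qed simp

text \<open>\<open>deg_G\<close> is the form taken by k < r s - g + 1 for deg G = k + g - 1;
  \<open>k\<close> and the genus themselves enter only through Riemann-Roch at the end.\<close>

locale generalized_AG_code = function_field_basis emb x U
  for emb :: "'q :: {field, finite} \<Rightarrow> 'f :: field" and x U +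
  fixes r s :: nat and P :: "nat \<Rightarrow> 'f set" and G :: "'f set \<Rightarrow>\<^sub>0 int" and \<pi> :: "nat \<Rightarrow> 'f set \<Rightarrow> 'q vec"
  assumes place_P: "i < s \<Longrightarrow> is_place emb (P i) \<and> place_degree emb (P i) = r"
    and inj_P: "inj_on P {..<s}"
    and divisor_G: "is_divisor emb G"
    and disjoint: "Poly_Mapping.keys G \<inter> P ` {..<s} = {}"
    and iso: "i < s \<Longrightarrow> residue_iso emb (P i) (r + 1) (parity_code r) (\<pi> i)"
    and deg_G: "div_degree emb G < int r * int s"
begin

definition A :: "'f set \<Rightarrow> int" where "A = Poly_Mapping.lookup G"

definition block :: "nat \<Rightarrow> 'f \<Rightarrow> 'q vec" where
  "block i f = \<pi> i (residue (P i) f)"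

definition word :: "'f \<Rightarrow> 'q vec" where
  "word f = vec_of_list (concat (map (\<lambda>i. list_of_vec (block i f)) [0..<s]))"

lemma gen_AG_code_eq: "gen_AG_code emb s P G \<pi> = word ` RR A"
  unfolding gen_AG_code_def RR_space_eq A_def word_def block_def ..

lemma divisor_A: "divisor A"
  using divisor_G by (simp add: divisor_lookup A_def)

lemma P_places: "i < s \<Longrightarrow> P i \<in> places"
  using place_P by (simp add: places_def)

lemma A_P: "i < s \<Longrightarrow> A (P i) = 0"
  using disjoint by (auto simp: A_def in_keys_iff)

lemma RR_A_vring: "f \<in> RR A \<Longrightarrow> i < s \<Longrightarrow> f \<in> vring (P i)"
  using vge_zero_iff[OF P_places, of i f] P_places A_P by (force simp: RR_def LS_def)

lemma block_props:
  assumes i: "i < s" and f: "f \<in> vring (P i)"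
  shows "block i f \<in> parity_code r"
    "h \<in> vring (P i) \<Longrightarrow> block i (f + h) = block i f + block i h"
    "block i (emb c * f) = c \<cdot>\<^sub>v block i f"
    "h \<in> vring (P i) \<Longrightarrow> block i f = block i h \<longleftrightarrow> f - h \<in> P i"
proof -
  let ?W = "(module_vec TYPE('q) (r + 1))\<lparr>carrier := parity_code r :: 'q vec set\<rparr>"
  let ?R = "residue_space emb (P i)"
  note Pi = P_places[OF i] and ops = residue_space_ops[OF P_places[OF i]]
  have lin: "linear_map class_ring ?R ?W (\<pi> i)"
    and bij: "bij_betw (\<pi> i) (carrier (residue_field (P i))) (parity_code r)"
    using iso[OF i] by (simp_all add: residue_iso_def)
  note hom = mod_hom.f_hom[OF linear_map.axioms(3)[OF lin]]
  have b: "block i g = \<pi> i (coset (P i) g)" for g by (simp add: block_def residue_eq_coset)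
  have car: "coset (P i) g \<in> carrier ?R" if "g \<in> vring (P i)" for g
    unfolding ops(1) using that by (rule imageI)
  show "block i f \<in> parity_code r"
    using bij_betwE[OF bij] f unfolding b carrier_residue_field by blast
  show "block i (f + h) = block i f + block i h" if h: "h \<in> vring (P i)"
    unfolding b ops(3)[OF f h, symmetric] module_hom_add[OF hom car[OF f] car[OF h]]
    by (simp add: module_vec_simps)
  show "block i (emb c * f) = c \<cdot>\<^sub>v block i f"
    unfolding b ops(4)[OF f, symmetric] using module_hom_smult[OF hom _ car[OF f], of c]
    by (simp add: module_vec_simps)
  show "block i f = block i h \<longleftrightarrow> f - h \<in> P i" if h: "h \<in> vring (P i)"
  proof -
    have "block i f = block i h \<longleftrightarrow> coset (P i) f = coset (P i) h"
      unfolding b using inj_on_eq_iff[OF bij_betw_imp_inj_on[OF bij]] f h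
      by (simp add: carrier_residue_field)
    then show ?thesis by (simp add: coset_eq_iff[OF add_subgroup_place[OF Pi]])
  qed
qed

lemma block_A:
  assumes "i < s" "f \<in> RR A"
  shows "block i f \<in> parity_code r" "dim_vec (block i f) = r + 1"
  using block_props(1)[OF assms(1) RR_A_vring[OF assms(2,1)]] parity_codeD(1) by auto

lemma dim_word: "f \<in> RR A \<Longrightarrow> dim_vec (word f) = (r + 1) * s"
  unfolding word_def by (subst dim_vec_of_list, subst length_concat_uniform[of _ "r + 1"])
    (auto simp: block_A)

lemma word_index:
  assumes f: "f \<in> RR A" and "i < s" "j < r + 1"
  shows "word f $ (i * (r + 1) + j) = block i f $ j"
proof -
  let ?ls = "map (\<lambda>i. list_of_vec (block i f)) [0..<s]"
  have "concat ?ls ! (i * (r + 1) + j) = ?ls ! i ! j"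
    by (rule nth_concat_uniform) (use assms block_A[OF _ f] in auto)
  also have "\<dots> = block i f $ j" using assms block_A[OF _ f] by simp
  finally show ?thesis unfolding word_def vec_of_list_index .
qed

lemma index_split:
  assumes "k < (r + 1) * s"
  obtains i j where "i < s" "j < r + 1" "k = i * (r + 1) + j"
proof (rule that[of "k div (r + 1)" "k mod (r + 1)"])
  show "k div (r + 1) < s" using assms by (simp add: less_mult_imp_div_less mult.commute)
qed (use div_mult_mod_eq[of k "r + 1"] in auto)

lemma index_less:
  assumes "i < s" "j < r + 1" shows "i * (r + 1) + j < (r + 1) * s"
proof -
  have "i * (r + 1) + j < Suc i * (r + 1)" using assms by simp
  also have "\<dots> \<le> s * (r + 1)" using assms by (intro mult_right_mono) auto
  finally show ?thesis by (simp add: mult.commute)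
qed

lemma word_eqI:
  assumes "f \<in> RR A" "dim_vec v = (r + 1) * s"
    and "\<And>i j. i < s \<Longrightarrow> j < r + 1 \<Longrightarrow> block i f $ j = v $ (i * (r + 1) + j)"
  shows "word f = v"
proof (rule eq_vecI)
  fix k assume "k < dim_vec v"
  then have "k < (r + 1) * s" using assms(2) by simp
  then obtain i j where "i < s" "j < r + 1" "k = i * (r + 1) + j" by (rule index_split)
  then show "word f $ k = v $ k" using word_index[OF assms(1)] assms(3) by simp
qed (simp add: dim_word assms)

lemma word_add: 
  assumes "f \<in> RR A" "h \<in> RR A" shows "word (f + h) = word f + word h"
proof (rule word_eqI)
  show "f + h \<in> RR A" using assms by (rule add_subgroup_add[OF add_subgroup_RR])
  fix i j assume ij: "i < s" "j < r + 1"
  have "block i (f + h) = block i f + block i h"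
    using ij assms by (intro block_props(2) RR_A_vring)
  then show "block i (f + h) $ j = (word f + word h) $ (i * (r + 1) + j)"
    by (simp only: index_add_vec(1) dim_word[OF assms(2)] block_A(2)[OF ij(1) assms(2)] ij(2)
        index_less[OF ij] word_index[OF assms(1) ij] word_index[OF assms(2) ij])
qed (simp add: dim_word assms)

lemma word_scale:
  assumes "f \<in> RR A" shows "word (emb c * f) = c \<cdot>\<^sub>v word f"
proof (rule word_eqI)
  show "emb c * f \<in> RR A" using assms unfolding RR_def by (intro LS_scale) simp_all
  fix i j assume ij: "i < s" "j < r + 1"
  have "block i (emb c * f) = c \<cdot>\<^sub>v block i f"
    using ij assms by (intro block_props(3) RR_A_vring)
  then show "block i (emb c * f) $ j = (c \<cdot>\<^sub>v word f) $ (i * (r + 1) + j)"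
    by (simp only: index_smult_vec(1) dim_word[OF assms] block_A(2)[OF ij(1) assms] ij(2)
        index_less[OF ij] word_index[OF assms ij])
qed (simp add: dim_word assms)

lemma linear_code_words: "linear_code ((r + 1) * s) (word ` RR A)"
proof (rule linear_codeI)
  show "word ` RR A \<subseteq> carrier_vec ((r + 1) * s)"
    by (intro image_subsetI carrier_vecI dim_word)
  have z: "0 \<in> RR A" by (rule add_subgroup_zero[OF add_subgroup_RR])
  have "word (emb 0 * 0) = 0 \<cdot>\<^sub>v word 0" by (rule word_scale[OF z])
  moreover have "0 \<cdot>\<^sub>v word 0 = 0\<^sub>v ((r + 1) * s)" by (rule eq_vecI) (simp_all add: dim_word[OF z])
  ultimately have "word 0 = 0\<^sub>v ((r + 1) * s)" by (simp only: hom_zero mult_zero_left)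
  with z show "0\<^sub>v ((r + 1) * s) \<in> word ` RR A" by (rule rev_image_eqI[OF _ sym])
  fix c c' a assume c: "c \<in> word ` RR A"
  then obtain f where f: "f \<in> RR A" "c = word f" by blast
  have "emb a * f \<in> RR A" using f unfolding RR_def by (intro LS_scale) simp_all
  then show "a \<cdot>\<^sub>v c \<in> word ` RR A" unfolding f(2) word_scale[OF f(1), symmetric] by (rule imageI)
  assume "c' \<in> word ` RR A"
  then obtain h where h: "h \<in> RR A" "c' = word h" by blast
  have "f + h \<in> RR A" using f(1) h(1) by (rule add_subgroup_add[OF add_subgroup_RR])
  then show "c + c' \<in> word ` RR A"
    unfolding f(2) h(2) word_add[OF f(1) h(1), symmetric] by (rule imageI)
qed

lemma zero_blocks:
  assumes f: "f \<in> RR A" "f \<noteq> 0" and Z: "Z \<subseteq> {..<s}" "\<And>i. i \<in> Z \<Longrightarrow> f \<in> P i"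
  shows "int r * int (card Z) \<le> div_degree emb G"
proof -
  define B where "B R = (if R \<in> P ` Z then 1 else 0 :: int)" for R
  have inj: "inj_on P Z" using inj_P Z(1) by (rule inj_on_subset)
  have fin: "finite (P ` Z)" using Z(1) finite_subset by blast
  have B: "divisor B" using Z(1) P_places by (intro divisorI[OF fin]) (auto simp: B_def)
  have "deg B = (\<Sum>R\<in>P ` Z. B R * int (place_degree emb R))"
    by (rule deg_eq_sum[OF fin]) (simp add: B_def)
  also have "\<dots> = (\<Sum>i\<in>Z. B (P i) * int (place_degree emb (P i)))"
    using inj by (simp add: sum.reindex)
  also have "\<dots> = (\<Sum>i\<in>Z. int r)" by (rule sum.cong) (use Z place_P in \<open>auto simp: B_def\<close>)
  finally have degB: "deg B = int r * int (card Z)" by simp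
  let ?D = "\<lambda>R. A R - B R"
  have D: "divisor ?D" by (rule divisor_combine[OF divisor_A B]) simp
  have "vge R f (- ?D R)" if R: "R \<in> places" for R
  proof (cases "R \<in> P ` Z")
    case True
    then obtain i where i: "i \<in> Z" "R = P i" by blast
    then have "vge R f 1" using vge_one_iff[OF R] Z(2) by simp
    then show ?thesis using i Z(1) A_P True by (auto simp: B_def)
  next
    case False
    then show ?thesis using f(1) R by (auto simp: RR_def LS_def B_def)
  qed
  then have "f \<in> RR ?D" by (simp add: RR_def LS_def)
  then have "\<not> deg ?D < 0" using RR_eq_zero[OF D] f(2) by blast
  then show ?thesis using deg_diff[OF divisor_A B] degB by (simp add: div_degree_eq A_def)
qed

text \<open>Both conclusions come from one count on f - h, which vanishes at \<open>card Z\<close>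
  of the places. Distinctness uses only \<open>card Z < s\<close>, so injectivity is independent of
  whether the floor bound is positive.\<close>

lemma card_differing:
  assumes f: "f \<in> RR A" and h: "h \<in> RR A" and "f \<noteq> h"
  shows "2 * (int s - \<lfloor>real_of_int (div_degree emb G) / real r\<rfloor>) \<le> int (hamming_dist (word f) (word h))"
    and "word f \<noteq> word h"
proof -
  define Z where "Z = {i. i < s \<and> f - h \<in> P i}"
  define I where "I = {..<s} - Z"
  define D where "D i = {j. j < r + 1 \<and> block i f $ j \<noteq> block i h $ j}" for i
  have Z: "Z \<subseteq> {..<s}" "finite Z" by (auto simp: Z_def)
  have fh: "f - h \<in> RR A" "f - h \<noteq> 0"
    using f h assms(3) add_subgroup_diff[OF add_subgroup_RR] by auto
  have zb: "int r * int (card Z) \<le> div_degree emb G"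
    by (rule zero_blocks[OF fh Z(1)]) (simp add: Z_def)
  \<comment> \<open>Strictness also excludes \<open>r = 0\<close>, so the later division by
    \<open>r\<close> is legitimate.\<close>
  have "int r * int (card Z) < int r * int s" using zb deg_G by linarith
  then have lt: "card Z < s" and r0: "r > 0" by (auto simp: mult_less_cancel_left)
  have cI: "card I = s - card Z" unfolding I_def using Z by (simp add: card_Diff_subset)
  have two: "card (D i) \<ge> 2" if "i \<in> I" for i
  proof -
    have i: "i < s" "f - h \<notin> P i" using that by (auto simp: I_def Z_def)
    then have "block i f \<noteq> block i h"
      using block_props(4)[OF i(1) RR_A_vring[OF f i(1)] RR_A_vring[OF h i(1)]] by simp
    then show ?thesis unfolding D_def using block_A(1)[OF i(1)] f h by (intro hamming_dist_parity)
  qed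
  have "2 * card I \<le> (\<Sum>i\<in>I. card (D i))" using sum_mono[of I "\<lambda>_. 2" "\<lambda>i. card (D i)"] two by simp
  also have "\<dots> = card (SIGMA i:I. D i)" by (rule card_SigmaI[symmetric]) (auto simp: I_def D_def)
  also have "\<dots> = card ((\<lambda>(i, j). i * (r + 1) + j) ` (SIGMA i:I. D i))"
  proof (rule card_image[symmetric], rule inj_onI, clarify)
    fix i j i' j' assume "j \<in> D i" "j' \<in> D i'" and eq: "i * (r + 1) + j = i' * (r + 1) + j'"
    then have j: "j < r + 1" "j' < r + 1" by (auto simp: D_def)
    have "(i * (r + 1) + j) div (r + 1) = i" "(i' * (r + 1) + j') div (r + 1) = i'"
      using j by (simp_all del: mult_Suc_right add_Suc_right)
    then have "i = i'" using eq by metis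
    then show "i = i' \<and> j = j'" using eq by simp
  qed
  also have "\<dots> \<le> hamming_dist (word f) (word h)"
    unfolding hamming_dist_def
  proof (rule card_mono)
    show "(\<lambda>(i, j). i * (r + 1) + j) ` (SIGMA i:I. D i)
        \<subseteq> {k. k < dim_vec (word f) \<and> word f $ k \<noteq> word h $ k}"
    proof clarify
      fix i j assume ij: "i \<in> I" "j \<in> D i"
      then have "i < s" "j < r + 1" "block i f $ j \<noteq> block i h $ j" by (auto simp: I_def D_def)
      then show "i * (r + 1) + j < dim_vec (word f) \<and>
          word f $ (i * (r + 1) + j) \<noteq> word h $ (i * (r + 1) + j)"
        using index_less[of i j] dim_word[OF f] word_index[OF f, of i j] word_index[OF h, of i j]
        by (simp only: simp_thms)
    qed
  qed simp
  finally have ham: "2 * (s - card Z) \<le> hamming_dist (word f) (word h)" unfolding cI .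
  have "real r * real (card Z) \<le> real_of_int (div_degree emb G)"
    using zb by (simp flip: of_int_le_iff[where ?'a = real])
  then have "real (card Z) \<le> real_of_int (div_degree emb G) / real r"
    using r0 by (simp add: field_simps)
  then have "int (card Z) \<le> \<lfloor>real_of_int (div_degree emb G) / real r\<rfloor>" by (simp add: le_floor_iff)
  then have "2 * (int s - \<lfloor>real_of_int (div_degree emb G) / real r\<rfloor>) \<le> 2 * (int s - int (card Z))"
    by simp
  also have "\<dots> = int (2 * (s - card Z))" using lt by simp
  also have "\<dots> \<le> int (hamming_dist (word f) (word h))" using ham by (simp only: of_nat_le_iff)
  finally show "2 * (int s - \<lfloor>real_of_int (div_degree emb G) / real r\<rfloor>) \<le> int (hamming_dist (word f) (word h))" .
  have "hamming_dist (word f) (word h) > 0" using ham lt by linarith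
  then show "word f \<noteq> word h" by (auto simp: hamming_dist_def)
qed

lemma code_dim_words: "code_dim ((r + 1) * s) (word ` RR A) = ell A"
proof -
  have "inj_on word (RR A)"
  proof (rule inj_onI, rule ccontr)
    fix f h assume "f \<in> RR A" "h \<in> RR A" "word f = word h" "f \<noteq> h"
    then show False using card_differing(2) by blast
  qed
  then have "card (word ` RR A) = q ^ ell A"
    unfolding card_RR[OF divisor_A, symmetric] by (rule card_image)
  then have "q ^ code_dim ((r + 1) * s) (word ` RR A) = q ^ ell A"
    using card_linear_code[OF linear_code_words] by (simp only: q_eq)
  then show ?thesis using q_gt_1 by (simp only: power_inject_exp)
qed

lemma locality_words: "has_locality ((r + 1) * s) (word ` RR A) r"
  unfolding has_locality_def
proof (intro allI impI)
  fix k assume k: "k < (r + 1) * s"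
  then obtain i j where ij: "i < s" "j < r + 1" "k = i * (r + 1) + j" by (rule index_split)
  let ?N = "(\<lambda>l. i * (r + 1) + l) ` ({..<r + 1} - {j})"
  have "?N \<subseteq> {..<(r + 1) * s} - {k}" using index_less[OF ij(1)] ij(3) by auto
  moreover have "card ?N \<le> r" by (rule order_trans[OF card_image_le]) (use ij(2) in auto)
  moreover have "word f $ k = word h $ k"
    if f: "f \<in> RR A" and h: "h \<in> RR A" and eq: "\<forall>l\<in>?N. word f $ l = word h $ l" for f h
  proof -
    have "block i f $ l = block i h $ l" if "l \<in> {..<r + 1} - {j}" for l
      using that eq word_index[OF f ij(1), of l] word_index[OF h ij(1), of l] by force
    then have "(\<Sum>l\<in>{..<r + 1} - {j}. block i f $ l) = (\<Sum>l\<in>{..<r + 1} - {j}. block i h $ l)"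
      by (rule sum.cong[OF refl])
    moreover have "block i e $ j = - (\<Sum>l\<in>{..<r + 1} - {j}. block i e $ l)" if "e \<in> RR A" for e
    proof -
      have "(\<Sum>l<r + 1. block i e $ l) = block i e $ j + (\<Sum>l\<in>{..<r + 1} - {j}. block i e $ l)"
        by (rule sum.remove) (use ij(2) in auto)
      then show ?thesis
        using parity_codeD(2)[OF block_A(1)[OF ij(1) that]] by (simp only: eq_neg_iff_add_eq_0)
    qed
    ultimately have "block i f $ j = block i h $ j" using f h by (simp only:)
    then show ?thesis
      by (simp only: ij(3) word_index[OF f ij(1,2)] word_index[OF h ij(1,2)])
  qed
  then have "\<forall>c\<in>word ` RR A. \<forall>c'\<in>word ` RR A. (\<forall>l\<in>?N. c $ l = c' $ l) \<longrightarrow> c $ k = c' $ k"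
    by blast
  ultimately show "\<exists>N\<subseteq>{..<(r + 1) * s} - {k}. card N \<le> r \<and>
      (\<forall>c\<in>word ` RR A. \<forall>c'\<in>word ` RR A. (\<forall>l\<in>N. c $ l = c' $ l) \<longrightarrow> c $ k = c' $ k)"
    by blast
qed

text \<open>\<open>Min\<close> must be taken over a finite nonempty set:
  \<open>ell A \<ge> 1\<close> supplies a nonzero function, whose word differs from that of
  0.\<close>

lemma min_distance_words:
  assumes "ell A \<ge> 1"
  shows "2 * (int s - \<lfloor>real_of_int (div_degree emb G) / real r\<rfloor>) \<le> int (min_distance (word ` RR A))"
proof -
  let ?H = "{hamming_dist c c' | c c'. c \<in> word ` RR A \<and> c' \<in> word ` RR A \<and> c \<noteq> c'}"
  have "?H \<subseteq> (\<lambda>(c, c'). hamming_dist c c') ` (word ` RR A \<times> word ` RR A)" by auto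
  then have fin: "finite ?H"
    by (rule finite_subset) (intro finite_imageI finite_cartesian_product finite_RR divisor_A)
  have "card (RR A) > 1" using card_RR[OF divisor_A] one_less_power[OF q_gt_1, of "ell A"] assms by simp
  then have "\<not> RR A \<subseteq> {0}" using card_mono[of "{0}" "RR A"] by auto
  then obtain f where f: "f \<in> RR A" "f \<noteq> 0" by blast
  have "word f \<noteq> word 0" by (rule card_differing(2)[OF f(1) add_subgroup_zero[OF add_subgroup_RR] f(2)])
  then have "hamming_dist (word f) (word 0) \<in> ?H"
    using f(1) add_subgroup_zero[OF add_subgroup_RR, of A] by blast
  then have "Min ?H \<in> ?H" using fin by (intro Min_in) auto
  then obtain c c' where c: "Min ?H = hamming_dist c c'" "c \<in> word ` RR A" "c' \<in> word ` RR A" "c \<noteq> c'"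
    by blast
  then obtain f h where fh: "f \<in> RR A" "h \<in> RR A" "c = word f" "c' = word h" "f \<noteq> h" by blast
  show ?thesis unfolding min_distance_def c(1) fh(3,4) by (rule card_differing(1)[OF fh(1,2,5)])
qed

end

theorem proposition5p2:
  fixes emb :: "'q :: {field, finite} \<Rightarrow> 'f :: field"
    and P :: "nat \<Rightarrow> 'f set"
    and r s n d :: nat
    and g k :: int
    and G :: "'f set \<Rightarrow>\<^sub>0 int"
    and \<pi> :: "nat \<Rightarrow> 'f set \<Rightarrow> 'q vec"
    and C :: "'q vec set"
  assumes "function_field emb"
    and "g = genus emb"
    and "r > 1"
    and "\<And>i. i < s \<Longrightarrow> is_place emb (P i) \<and> place_degree emb (P i) = r"
    and "inj_on P {..<s}"
    and "g - 1 < k" and "k < int r * int s - g + 1"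
    and "is_divisor emb G" and "div_degree emb G = k + g - 1"
    and "Poly_Mapping.keys G \<inter> P ` {..<s} = {}"
    and "\<And>i. i < s \<Longrightarrow> residue_iso emb (P i) (r + 1) (parity_code r) (\<pi> i)"
    and "C = gen_AG_code emb s P G \<pi>"
    and "n = (r + 1) * s"
    and "d = min_distance C"
  shows "linear_code (r + 1) (parity_code r :: 'q vec set) \<and>
         code_dim (r + 1) (parity_code r :: 'q vec set) = r \<and>
         min_distance (parity_code r :: 'q vec set) = 2 \<and>
         linear_code n C \<and>
         has_locality n C r \<and>
         int (code_dim n C) = k \<and>
         (k \<ge> 1 \<longrightarrow>
           int d \<ge> 2 * (int s - \<lfloor>real_of_int (k + g - 1) / real r\<rfloor>) \<and>
           real_of_int k / real n \<ge>
             real r / real (r + 1) - real r / 2 * (real d / real n) - real_of_int (g - 1) / real n)"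
proof -
  interpret function_field emb by (rule assms(1))
  obtain x U where basis: "function_field_basis emb x U" using ex_function_field_basis by blast
  interpret generalized_AG_code emb x U r s P G \<pi>
  proof (intro generalized_AG_code.intro generalized_AG_code_axioms.intro)
    show "div_degree emb G < int r * int s" using assms(7,9) by linarith
  qed (rule basis assms; assumption)+
  have C: "C = word ` RR A" unfolding assms(12) by (rule gen_AG_code_eq)
  have dA: "deg A = k + g - 1" using assms(9) by (simp add: div_degree_eq A_def)
  \<comment> \<open>g - 1 < k means k \<ge> g, hence deg A = k + g - 1 \<ge> 2 g - 1.\<close>
  have "int (ell A) = deg A + 1 - genus emb"
    by (rule Riemann_Roch_nonspecial[OF divisor_A]) (use assms(2,6) dA in linarith)
  then have ell: "int (ell A) = k" unfolding dA assms(2) by simp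
  have g0: "g \<ge> 0"
  proof -
    obtain B where "\<And>D. divisor D \<Longrightarrow> chi D \<le> genus emb - 1" using genus_greatest by blast
    from this[OF divisor_zero] show ?thesis using chi_zero assms(2) by simp
  qed
  have dist: "2 * (int s - \<lfloor>real_of_int (k + g - 1) / real r\<rfloor>) \<le> int d" if "k \<ge> 1"
    using min_distance_words ell that unfolding assms(9,14) C by simp
  have rate: "real_of_int k / real n \<ge>
      real r / real (r + 1) - real r / 2 * (real d / real n) - real_of_int (g - 1) / real n" if k: "k \<ge> 1"
  proof -
    \<comment> \<open>For s = 0 the upper bound on \<open>k\<close> would read k < 1 - g \<le>
      1.\<close>
    have s: "real s > 0" using assms(7) g0 k by (cases "s = 0") auto
    have nn: "real n = real (r + 1) * real s" by (simp only: assms(13) of_nat_mult)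
    have n: "real n > 0" unfolding nn by (rule mult_pos_pos) (use s in simp_all)
    have rs: "real r / real (r + 1) = real r * real s / real n"
      unfolding nn by (rule mult_divide_mult_cancel_right[symmetric]) (use s in simp)
    define y where "y = real_of_int (k + g - 1) / real r"
    have r0: "real r > 0" using assms(3) by simp
    have ry: "real r * y = real_of_int (k + g - 1)" using r0 by (simp add: y_def)
    \<comment> \<open>Dropping the floor weakens the distance bound to d \<ge> 2 (s - y). Multiplied
      by r/2 it reads r s - (k + g - 1) \<le> r d / 2, and division by n = (r + 1) s gives the
      rate.\<close>
    have "2 * (real s - y) \<le> 2 * (real s - real_of_int \<lfloor>y\<rfloor>)"
      using of_int_floor_le[of y] by (intro mult_left_mono diff_left_mono) simp_all
    also have "\<dots> = real_of_int (2 * (int s - \<lfloor>y\<rfloor>))" by simp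
    also have "\<dots> \<le> real_of_int (int d)" using dist[OF k] by (simp only: of_int_le_iff y_def)
    finally have "real r * (2 * (real s - y)) \<le> real r * real d"
      using r0 by (intro mult_left_mono) simp_all
    then have "real r * real s - real_of_int (k + g - 1) \<le> real r / 2 * real d"
      unfolding ry[symmetric] by (simp add: algebra_simps)
    then have "(real r * real s - real r / 2 * real d - real_of_int (g - 1)) / real n \<le> real_of_int k / real n"
      using n by (intro divide_right_mono) simp_all
    then show ?thesis unfolding rs by (simp add: diff_divide_distrib)
  qed
  have "code_dim n C = ell A" unfolding C assms(13) by (rule code_dim_words)
  then have "int (code_dim n C) = k" using ell by (simp only:)
  moreover have "linear_code n C" unfolding C assms(13) by (rule linear_code_words)
  moreover have "has_locality n C r" unfolding C assms(13) by (rule locality_words)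
  ultimately show ?thesis
    by (intro conjI impI linear_code_parity code_dim_parity min_distance_parity assms(3) dist rate)
qed

end
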